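(* Let $N\ge 3$, $T>0$, let $\Omega\subset\mathbb R^N$ be open and bounded, and let $M$ be a measurable matrix field on $\Omega_T$ such that, for two constants $0<\alpha\le\beta$, $\alpha|\xi|^2\le M(t,x)\xi\cdot\xi$ and $|M(t,x)|\le\beta$ for a.e. $(t,x)\in\Omega_T$ and every $\xi\in\mathbb R^N$. Take $\theta>0$, $f,g\in L^1(\Omega_T)$, and a vector field $E\in L^2(\Omega_T)$ with values in $\mathbb R^N$. Let $v,w\in C([0,T];L^1(\Omega))\cap W^2_{loc}(0,T)$ be such that $|E|(|v|^{\theta+1}+|w|^{\theta+1})\in L^2_{loc}((0,T);L^2(\Omega))$ and $$\int_{t_1}^{t_2}\langle\partial_t v,\varphi\rangle\,dt+\int_{t_1}^{t_2}\!\!\int_\Omega\big(M\nabla v\cdot\nabla\varphi+E|v|^\theta v\cdot\nabla\varphi\big)\,dx\,dt\le\int_{t_1}^{t_2}\!\!\int_\Omega f\varphi\,dx\,dt,$$ $$\int_{t_1}^{t_2}\langle\partial_t w,\varphi\rangle\,dt+\int_{t_1}^{t_2}\!\!\int_\Omega\big(M\nabla w\cdot\nabla\varphi+E|w|^\theta w\cdot\nabla\varphi\big)\,dx\,dt\ge\int_{t_1}^{t_2}\!\!\int_\Omega g\varphi\,dx\,dt,$$ for every $0<t_1<t_2<T$ and every $\varphi\in W^2(0,T)\cap L^\infty(\Omega_T)$ with $\varphi\ge0$ in $\Omega_T$. Assume moreover that $$(|v|^\theta+|w|^\theta)|E|\in L^2(\Omega_T).$$ Then, for any $\tau\in[0,T]$,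 $$\int_\Omega(v(\tau)-w(\tau))_+\,dx\le\int_0^\tau\!\!\int_\Omega(f-g)\chi_{\{v>w\}}\,dx\,dt+\int_\Omega(v(0)-w(0))_+\,dx.$$
   Context: $\Omega_T=(0,T)\times\Omega$; $s_+=\max\{s,0\}$; $\chi_A$ is the characteristic function of $A$; $\langle\cdot,\cdot\rangle$ is the duality pairing between $W^{-1,2}(\Omega)$ and $W^{1,2}_0(\Omega)$. $L^p_{loc}((0,T);X)$ is the set of measurable $u:[0,T]\to X$ with $u\in L^p(t_1,t_2;X)$ for every $[t_1,t_2]\subset(0,T)$. $$W^2(0,T)=\{u\in L^2(0,T;W^{1,2}_0(\Omega)):\ u_t\in L^2(0,T;W^{-1,2}(\Omega))\},$$ $$W^2_{loc}(0,T)=\{u\in L^2_{loc}((0,T);W^{1,2}_0(\Omega)):\ u_t\in L^2_{loc}((0,T);W^{-1,2}(\Omega))\}.$$ *)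

theory Defs
  imports "HOL-Analysis.Analysis"
begin

text \<open>
  Elements of function spaces over \<open>\<Omega>\<close> are represented by total functions \<open>'a \<Rightarrow> real\<close> of which only
  the restriction to \<open>\<Omega>\<close>, up to null sets, matters; all norms below are therefore seminorms on
  representatives.  A function of time and space is curried, \<open>u :: real \<Rightarrow> 'a \<Rightarrow> real\<close>, so that
  \<open>u t\<close> is a representative of its value at time \<open>t\<close>.
\<close>

section \<open>Lebesgue spaces\<close>

definition L1 :: "'a measure \<Rightarrow> ('a \<Rightarrow> 'b::{banach, second_countable_topology}) set" where
  "L1 M = {f. integrable M f}"

definition L1_norm :: "'a measure \<Rightarrow> ('a \<Rightarrow> 'b::{banach, second_countable_topology}) \<Rightarrow> real" where
  "L1_norm M f = (LINT x|M. norm (f x))"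

definition L2 :: "'a measure \<Rightarrow> ('a \<Rightarrow> 'b::{banach, second_countable_topology}) set" where
  "L2 M = {f \<in> borel_measurable M. integrable M (\<lambda>x. (norm (f x))\<^sup>2)}"

definition L2_norm :: "'a measure \<Rightarrow> ('a \<Rightarrow> 'b::{banach, second_countable_topology}) \<Rightarrow> real" where
  "L2_norm M f = sqrt (LINT x|M. (norm (f x))\<^sup>2)"

definition Linf :: "'a measure \<Rightarrow> ('a \<Rightarrow> 'b::{banach, second_countable_topology}) set" where
  "Linf M = {f \<in> borel_measurable M. \<exists>C. AE x in M. norm (f x) \<le> C}"

section \<open>Test functions\<close>

definition partial_deriv :: "'a::euclidean_space \<Rightarrow> ('a \<Rightarrow> real) \<Rightarrow> 'a \<Rightarrow> real" where
  "partial_deriv b f x = frechet_derivative f (at x) b"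

fun C_diff :: "nat \<Rightarrow> ('a::euclidean_space \<Rightarrow> real) \<Rightarrow> bool" where
  "C_diff 0 f \<longleftrightarrow> continuous_on UNIV f"
| "C_diff (Suc k) f \<longleftrightarrow>
     (\<forall>x. f differentiable at x) \<and> (\<forall>b\<in>Basis. C_diff k (partial_deriv b f))"

text \<open>\<open>C\<^sub>c\<^sup>\<infinity>(\<Omega>)\<close>; its elements are extended by zero to the whole space.\<close>

definition test_functions :: "'a::euclidean_space set \<Rightarrow> ('a \<Rightarrow> real) set" where
  "test_functions \<Omega> = {\<phi>. (\<forall>k. C_diff k \<phi>) \<and>
     compact (closure {x. \<phi> x \<noteq> 0}) \<and> closure {x. \<phi> x \<noteq> 0} \<subseteq> \<Omega>}"

section \<open>Sobolev spaces\<close>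

definition is_weak_gradient ::
    "'a::euclidean_space set \<Rightarrow> ('a \<Rightarrow> real) \<Rightarrow> ('a \<Rightarrow> 'a) \<Rightarrow> bool" where
  "is_weak_gradient \<Omega> u G \<longleftrightarrow> (\<forall>\<phi>\<in>test_functions \<Omega>. \<forall>b\<in>Basis.
     (LINT x|lebesgue_on \<Omega>. u x * partial_deriv b \<phi> x)
       = - (LINT x|lebesgue_on \<Omega>. (G x \<bullet> b) * \<phi> x))"

definition W12 :: "'a::euclidean_space set \<Rightarrow> ('a \<Rightarrow> real) set" where
  "W12 \<Omega> = {u \<in> L2 (lebesgue_on \<Omega>). \<exists>G\<in>L2 (lebesgue_on \<Omega>). is_weak_gradient \<Omega> u G}"

text \<open>Meaningful for \<open>u \<in> W12 \<Omega>\<close>; the choice is unique up to a null subset of \<open>\<Omega>\<close>.\<close>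

definition weak_grad :: "'a::euclidean_space set \<Rightarrow> ('a \<Rightarrow> real) \<Rightarrow> 'a \<Rightarrow> 'a" where
  "weak_grad \<Omega> u = (SOME G. G \<in> L2 (lebesgue_on \<Omega>) \<and> is_weak_gradient \<Omega> u G)"

definition W12_norm :: "'a::euclidean_space set \<Rightarrow> ('a \<Rightarrow> real) \<Rightarrow> real" where
  "W12_norm \<Omega> u =
     sqrt ((L2_norm (lebesgue_on \<Omega>) u)\<^sup>2 + (L2_norm (lebesgue_on \<Omega>) (weak_grad \<Omega> u))\<^sup>2)"

text \<open>\<open>W\<^sub>0\<^sup>1\<^sup>,\<^sup>2(\<Omega>)\<close>, the closure of the test functions in \<open>W\<^sup>1\<^sup>,\<^sup>2(\<Omega>)\<close>.\<close>

definition W012 :: "'a::euclidean_space set \<Rightarrow> ('a \<Rightarrow> real) set" where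
  "W012 \<Omega> = {u \<in> W12 \<Omega>. \<forall>\<epsilon>>0. \<exists>\<phi>\<in>test_functions \<Omega>. W12_norm \<Omega> (u - \<phi>) < \<epsilon>}"

text \<open>
  \<open>W\<^sup>-\<^sup>1\<^sup>,\<^sup>2(\<Omega>)\<close>, the dual of \<open>W012 \<Omega>\<close>.  Only the values of a functional on \<open>W012 \<Omega>\<close> matter;
  there, boundedness and linearity make it invariant under changes on null sets.  The duality
  pairing of \<open>F\<close> and \<open>u\<close> is the application \<open>F u\<close>.
\<close>

definition Wm12 :: "'a::euclidean_space set \<Rightarrow> (('a \<Rightarrow> real) \<Rightarrow> real) set" where
  "Wm12 \<Omega> = {F.
     (\<forall>u\<in>W012 \<Omega>. \<forall>w\<in>W012 \<Omega>. \<forall>a b. F (\<lambda>x. a * u x + b * w x) = a * F u + b * F w) \<and>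
     (\<exists>C. \<forall>u\<in>W012 \<Omega>. \<bar>F u\<bar> \<le> C * W12_norm \<Omega> u)}"

definition Wm12_norm :: "'a::euclidean_space set \<Rightarrow> (('a \<Rightarrow> real) \<Rightarrow> real) \<Rightarrow> real" where
  "Wm12_norm \<Omega> F = (SUP u\<in>{u \<in> W012 \<Omega>. W12_norm \<Omega> u \<le> 1}. \<bar>F u\<bar>)"

section \<open>Vector-valued functions of time\<close>

text \<open>
  The value space \<open>X\<close> is given by a set \<open>V\<close> of real-valued functions together with its (semi)norm
  \<open>nrm\<close>.  Measurability is strong (Bochner) measurability: almost everywhere limit, in norm, of
  simple functions.  Values in \<open>V\<close> are required only for almost every time.
\<close>

definition bochner_measurable ::
    "('c \<Rightarrow> real) set \<Rightarrow> (('c \<Rightarrow> real) \<Rightarrow> real) \<Rightarrow> real set \<Rightarrow> (real \<Rightarrow> 'c \<Rightarrow> real) \<Rightarrow> bool" where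
  "bochner_measurable V nrm I u \<longleftrightarrow>
     (AE t in lebesgue_on I. u t \<in> V) \<and>
     (\<exists>s. (\<forall>k::nat. simple_function (lebesgue_on I) (s k) \<and> s k ` I \<subseteq> V) \<and>
          (AE t in lebesgue_on I. (\<lambda>k. nrm (s k t - u t)) \<longlonglongrightarrow> 0))"

definition L2_time ::
    "('c \<Rightarrow> real) set \<Rightarrow> (('c \<Rightarrow> real) \<Rightarrow> real) \<Rightarrow> real set \<Rightarrow> (real \<Rightarrow> 'c \<Rightarrow> real) set" where
  "L2_time V nrm I = {u. bochner_measurable V nrm I u \<and>
     integrable (lebesgue_on I) (\<lambda>t. (nrm (u t))\<^sup>2)}"

definition L2_loc_time ::
    "('c \<Rightarrow> real) set \<Rightarrow> (('c \<Rightarrow> real) \<Rightarrow> real) \<Rightarrow> real \<Rightarrow> (real \<Rightarrow> 'c \<Rightarrow> real) set" where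
  "L2_loc_time V nrm T = {u. bochner_measurable V nrm {0..T} u \<and>
     (\<forall>t1 t2. 0 < t1 \<and> t1 \<le> t2 \<and> t2 < T \<longrightarrow> u \<in> L2_time V nrm {t1..t2})}"

definition C_time ::
    "('c \<Rightarrow> real) set \<Rightarrow> (('c \<Rightarrow> real) \<Rightarrow> real) \<Rightarrow> real \<Rightarrow> (real \<Rightarrow> 'c \<Rightarrow> real) set" where
  "C_time V nrm T = {u. (\<forall>t\<in>{0..T}. u t \<in> V) \<and>
     (\<forall>t\<in>{0..T}. ((\<lambda>s. nrm (u s - u t)) \<longlongrightarrow> 0) (at t within {0..T}))}"

text \<open>
  \<open>F = u\<^sub>t\<close> in the sense of \<open>W\<^sup>-\<^sup>1\<^sup>,\<^sup>2(\<Omega>)\<close>-valued distributions on \<open>(0,T)\<close>, where \<open>W\<^sub>0\<^sup>1\<^sup>,\<^sup>2(\<Omega>)\<close> is embedded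
  in \<open>W\<^sup>-\<^sup>1\<^sup>,\<^sup>2(\<Omega>)\<close> through the inner product of \<open>L\<^sup>2(\<Omega>)\<close>.  The two integrals over \<open>(0,T)\<close> are elements of
  \<open>W\<^sup>-\<^sup>1\<^sup>,\<^sup>2(\<Omega>)\<close>, and their equality is spelled out on every \<open>\<psi> \<in> W\<^sub>0\<^sup>1\<^sup>,\<^sup>2(\<Omega>)\<close>.
\<close>

definition is_time_deriv ::
    "real \<Rightarrow> 'a::euclidean_space set \<Rightarrow> (real \<Rightarrow> 'a \<Rightarrow> real)
      \<Rightarrow> (real \<Rightarrow> ('a \<Rightarrow> real) \<Rightarrow> real) \<Rightarrow> bool" where
  "is_time_deriv T \<Omega> u F \<longleftrightarrow> (\<forall>\<eta>\<in>test_functions {0<..<T}. \<forall>\<psi>\<in>W012 \<Omega>.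
     (LINT t|lebesgue_on {0<..<T}. deriv \<eta> t * (LINT x|lebesgue_on \<Omega>. u t x * \<psi> x))
       = - (LINT t|lebesgue_on {0<..<T}. \<eta> t * F t \<psi>))"

definition cylinder :: "real \<Rightarrow> 'a::euclidean_space set \<Rightarrow> (real \<times> 'a) set" where
  "cylinder T \<Omega> = {0<..<T} \<times> \<Omega>"

text \<open>
  \<open>W\<^sup>2(0,T)\<close> and its local version.  Their elements are also used as functions on \<open>\<Omega>\<^sub>T\<close>, so the
  representative is required to be jointly measurable.  This excludes only pathological choices
  of \<open>u t\<close> within its class of functions equal almost everywhere in \<open>\<Omega>\<close>: every class
  of \<open>L\<^sup>2\<^sub>l\<^sub>o\<^sub>c((0,T); L\<^sup>2(\<Omega>))\<close> has a jointly measurable representative, which can be prescribed at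
  each \<open>t\<close> in a null set of times.
\<close>

definition W2 :: "real \<Rightarrow> 'a::euclidean_space set \<Rightarrow> (real \<Rightarrow> 'a \<Rightarrow> real) set" where
  "W2 T \<Omega> = {u \<in> L2_time (W012 \<Omega>) (W12_norm \<Omega>) {0<..<T}.
     case_prod u \<in> borel_measurable (lebesgue_on (cylinder T \<Omega>)) \<and>
     (\<exists>F\<in>L2_time (Wm12 \<Omega>) (Wm12_norm \<Omega>) {0<..<T}. is_time_deriv T \<Omega> u F)}"

definition W2_loc :: "real \<Rightarrow> 'a::euclidean_space set \<Rightarrow> (real \<Rightarrow> 'a \<Rightarrow> real) set" where
  "W2_loc T \<Omega> = {u \<in> L2_loc_time (W012 \<Omega>) (W12_norm \<Omega>) T.
     case_prod u \<in> borel_measurable (lebesgue_on (cylinder T \<Omega>)) \<and>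
     (\<exists>F\<in>L2_loc_time (Wm12 \<Omega>) (Wm12_norm \<Omega>) T. is_time_deriv T \<Omega> u F)}"

text \<open>Meaningful for \<open>u \<in> W2_loc T \<Omega>\<close>; as an element of \<open>W\<^sup>-\<^sup>1\<^sup>,\<^sup>2(\<Omega>)\<close> the value at \<open>t\<close> is unique for
  almost every \<open>t \<in> (0,T)\<close>.\<close>

definition time_deriv ::
    "real \<Rightarrow> 'a::euclidean_space set \<Rightarrow> (real \<Rightarrow> 'a \<Rightarrow> real) \<Rightarrow> real \<Rightarrow> ('a \<Rightarrow> real) \<Rightarrow> real" where
  "time_deriv T \<Omega> u =
     (SOME F. F \<in> L2_loc_time (Wm12 \<Omega>) (Wm12_norm \<Omega>) T \<and> is_time_deriv T \<Omega> u F)"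

section \<open>The parabolic problem\<close>

text \<open>
  Left-hand side of the weak formulation on \<open>(t\<^sub>1,t\<^sub>2)\<close>.  Space-time integrals are iterated ones: the
  gradients are taken for each fixed time, and the inner integrals do not depend on their
  representatives.
\<close>

definition weak_form ::
    "real \<Rightarrow> (real^'n) set \<Rightarrow> (real \<Rightarrow> real^'n \<Rightarrow> real^'n^'n) \<Rightarrow> (real \<Rightarrow> real^'n \<Rightarrow> real^'n) \<Rightarrow> real
      \<Rightarrow> real \<Rightarrow> real \<Rightarrow> (real \<Rightarrow> real^'n \<Rightarrow> real) \<Rightarrow> (real \<Rightarrow> real^'n \<Rightarrow> real) \<Rightarrow> real" where
  "weak_form T \<Omega> M E \<theta> t1 t2 u \<phi> =
     (LINT t|lebesgue_on {t1..t2}. time_deriv T \<Omega> u t (\<phi> t)) +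
     (LINT t|lebesgue_on {t1..t2}. LINT x|lebesgue_on \<Omega>.
        (M t x *v weak_grad \<Omega> (u t) x) \<bullet> weak_grad \<Omega> (\<phi> t) x +
        ((\<bar>u t x\<bar> powr \<theta> * u t x) *\<^sub>R E t x) \<bullet> weak_grad \<Omega> (\<phi> t) x)"

end

theory Submission
  imports Defs
begin

text \<open>
  Put \<open>z = v - w\<close>.  Instead of testing with a time-dependent truncation of \<open>z\<close>, whose time derivative
  is not in \<open>L\<^sup>2(W\<^sup>-\<^sup>1\<^sup>,\<^sup>2)\<close>, only test functions constant in time are used:
  \<open>\<psi>\<^sub>s = F\<^sub>r(z(s))\<close> on the interval \<open>(s - h, s)\<close>, where \<open>F\<^sub>r(y) = exp (- 1 / (r y))\<close> for \<open>y > 0\<close> and \<open>0\<close>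
  otherwise.  If \<open>S\<^sub>r\<close> is the (convex) primitive of \<open>F\<^sub>r\<close> and \<open>J(s) = \<integral> S\<^sub>r(z(s)) dx\<close>, then
  \<open>J(s) - J(s - h) \<le> \<integral> (z(s) - z(s - h)) \<psi>\<^sub>s dx\<close>, which the two inequalities bound by an integral
  over \<open>(s - h, s)\<close>.  Integrating over \<open>s \<in> (a,b)\<close>, dividing by \<open>h\<close> and letting \<open>h \<rightarrow> 0\<close> (translations are
  continuous in \<open>L\<^sup>1\<close> and \<open>L\<^sup>2\<close>) gives the estimate that the chain rule in time would give.  Since
  \<open>y\<^sup>2 F\<^sub>r'(y) \<le> 1 / r\<close>, Young's inequality bounds the flux term by
  \<open>C / r\<close> times the integral of \<open>(|v|\<^sup>\<theta> + |w|\<^sup>\<theta>)\<^sup>2 |E|\<^sup>2\<close>, so it disappears as \<open>r \<rightarrow> \<infinity>\<close>, while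
  \<open>F\<^sub>r(z)\<close> tends to the characteristic function of \<open>{v > w}\<close>.
\<close>

section \<open>Smooth functions and test functions\<close>

text \<open>The form of F_r serves several purposes. All its derivatives vanish at 0, so F_r
  composed with a test function is a test function; F_r(z(s)) therefore lies in W_0^{1,2} by
  composing the approximating test functions, using that F_r' is bounded. Differentiation gives y^2
  F_r'(y) = F_r(y) / r for y > 0, the source of the bound 1 / r. Freezing the test function has a
  price: the flux at time t meets the gradient of z at another time s, so integrating in s requires
  the gradients, chosen slice by slice, to agree almost everywhere with jointly measurable
  functions. The increment is taken backwards because the tangent inequality for S_r bounds S_r(y) -
  S_r(y') by the slope at y, that is, by the test function frozen at the later time. In the flux,
  the bound (\<theta> + 1)(|v|^\<theta> + |w|^\<theta>)|v - w| for the difference of |v|^\<theta> v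
  and |w|^\<theta> w supplies the factor |z| that Young's inequality turns into z^2 F_r'(z). Global
  square integrability of (|v|^\<theta> + |w|^\<theta>)|E| keeps the error uniform up to the ends of
  (0,T).\<close>

lemma partial_deriv_eqI: "(f has_derivative D) (at x) \<Longrightarrow> partial_deriv b f x = D b"
  unfolding partial_deriv_def using frechet_derivative_at by metis

lemma C_diff_imp_continuous: "C_diff k f \<Longrightarrow> continuous_on UNIV f"
  by (cases k) (auto intro!: continuous_at_imp_continuous_on differentiable_imp_continuous_within)

lemma C_diff_Suc_imp: "C_diff (Suc k) f \<Longrightarrow> C_diff k f"
proof (induction k arbitrary: f)
  case 0
  then show ?case using C_diff_imp_continuous by fastforce
next
  case (Suc k)
  then show ?case by (simp del: C_diff.simps add: C_diff.simps(2)[of "Suc k"] C_diff.simps(2)[of k])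
qed

lemma C_diff_const [simp]: "C_diff k (\<lambda>x. c)"
proof (induction k arbitrary: c)
  case (Suc k)
  have "partial_deriv b (\<lambda>x. c) = (\<lambda>x. 0)" for b :: 'a
    by (rule ext, subst partial_deriv_eqI[of _ "\<lambda>_. 0"]) auto
  then show ?case using Suc by auto
qed auto

lemma partial_deriv_add:
  assumes "f differentiable at x" "g differentiable at x"
  shows "partial_deriv b (\<lambda>x. f x + g x) x = partial_deriv b f x + partial_deriv b g x"
proof -
  have "((\<lambda>x. f x + g x) has_derivative
      (\<lambda>h. frechet_derivative f (at x) h + frechet_derivative g (at x) h)) (at x)"
    using assms by (intro has_derivative_add) (auto simp: frechet_derivative_works)
  from partial_deriv_eqI[OF this] show ?thesis unfolding partial_deriv_def .
qed

lemma partial_deriv_mult: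
  fixes f g :: "'a::euclidean_space \<Rightarrow> real"
  assumes "f differentiable at x" "g differentiable at x"
  shows "partial_deriv b (\<lambda>x. f x * g x) x = f x * partial_deriv b g x + partial_deriv b f x * g x"
proof -
  have "((\<lambda>x. f x * g x) has_derivative
      (\<lambda>h. f x * frechet_derivative g (at x) h + frechet_derivative f (at x) h * g x)) (at x)"
    using assms by (intro has_derivative_mult) (auto simp: frechet_derivative_works)
  from partial_deriv_eqI[OF this] show ?thesis unfolding partial_deriv_def .
qed

lemma partial_deriv_chain:
  assumes "f differentiable at x" "(g has_real_derivative d) (at (f x))"
  shows "partial_deriv b (\<lambda>x. g (f x)) x = d * partial_deriv b f x"
    and "(\<lambda>x. g (f x)) differentiable at x"
proof -
  have "((\<lambda>x. g (f x)) has_derivative (\<lambda>h. frechet_derivative f (at x) h * d)) (at x)"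
    using assms(1,2) by (intro DERIV_compose_FDERIV) (auto simp: frechet_derivative_works)
  from this partial_deriv_eqI[OF this] show "partial_deriv b (\<lambda>x. g (f x)) x = d * partial_deriv b f x"
      "(\<lambda>x. g (f x)) differentiable at x"
    unfolding partial_deriv_def differentiable_def by (simp_all add: mult.commute) blast
qed

lemma C_diff_add: "C_diff k f \<Longrightarrow> C_diff k g \<Longrightarrow> C_diff k (\<lambda>x. f x + g x)"
proof (induction k arbitrary: f g)
  case 0
  then show ?case by (auto intro: continuous_on_add)
next
  case (Suc k)
  then have "partial_deriv b (\<lambda>x. f x + g x) = (\<lambda>x. partial_deriv b f x + partial_deriv b g x)" for b
    by (auto intro!: ext partial_deriv_add)
  with Suc show ?case by auto
qed

lemma C_diff_mult: "C_diff k f \<Longrightarrow> C_diff k g \<Longrightarrow> C_diff k (\<lambda>x. f x * g x)"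
proof (induction k arbitrary: f g)
  case 0
  then show ?case by (auto intro: continuous_on_mult)
next
  case (Suc k)
  then have "partial_deriv b (\<lambda>x. f x * g x)
      = (\<lambda>x. f x * partial_deriv b g x + partial_deriv b f x * g x)" for b
    by (auto intro!: ext partial_deriv_mult)
  moreover have "C_diff k (\<lambda>x. f x * partial_deriv b g x + partial_deriv b f x * g x)" if "b \<in> Basis" for b
    using Suc.prems that
    by (intro C_diff_add Suc.IH C_diff_Suc_imp[OF Suc.prems(1)] C_diff_Suc_imp[OF Suc.prems(2)]) auto
  ultimately show ?case using Suc.prems by auto
qed

lemma C_diff_inner: "C_diff k (\<lambda>x. x \<bullet> c)"
proof (cases k)
  case (Suc m)
  have "partial_deriv b (\<lambda>x. x \<bullet> c) = (\<lambda>x. b \<bullet> c)" for b :: 'a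
    by (rule ext, rule partial_deriv_eqI) (auto intro!: derivative_eq_intros)
  with Suc show ?thesis by auto
qed (auto intro!: continuous_intros)

lemma C_diff_prod: "(\<And>i. i \<in> I \<Longrightarrow> C_diff k (f i)) \<Longrightarrow> C_diff k (\<lambda>x. \<Prod>i\<in>I. f i x)"
  by (induction I rule: infinite_finite_induct) (auto intro: C_diff_mult)

text \<open>The linear span of these functions is closed under differentiation.\<close>

definition gexp :: "nat \<Rightarrow> real \<Rightarrow> real" where
  "gexp k s = (if s > 0 then exp (- inverse s) * inverse s ^ k else 0)"

text \<open>The substitution x = 1/s turns the claim into x^k / exp x -> 0 at infinity.\<close>

lemma gexp_tendsto_0_right: "(gexp k \<longlongrightarrow> 0) (at_right 0)"
proof -
  have "((\<lambda>x::real. x ^ k / exp x) \<longlongrightarrow> 0) at_top" by (rule tendsto_power_div_exp_0)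
  then have "((\<lambda>x::real. inverse x ^ k / exp (inverse x)) \<longlongrightarrow> 0) (at_right 0)"
    by (rule filterlim_compose[OF _ filterlim_inverse_at_top_right])
  moreover have "eventually (\<lambda>x. inverse x ^ k / exp (inverse x) = gexp k x) (at_right 0)"
    by (auto simp: eventually_at_right_field gexp_def exp_minus field_simps intro!: exI[of _ 1])
  ultimately show ?thesis by (rule Lim_transform_eventually)
qed

lemma gexp_tendsto_0: "(gexp k \<longlongrightarrow> 0) (at 0)"
proof (rule filterlim_split_at)
  have "eventually (\<lambda>x. 0 = gexp k x) (at_left 0)"
    by (auto simp: eventually_at_left_field gexp_def intro!: exI[of _ "-1"])
  then show "(gexp k \<longlongrightarrow> 0) (at_left 0)"
    by (rule Lim_transform_eventually[OF tendsto_const])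
qed (rule gexp_tendsto_0_right)

text \<open>For s > 0 this is the product rule. At 0 the difference quotient of
  \<open>gexp k\<close> is \<open>gexp (k + 1)\<close>, which tends to 0. A single formula thus
  covers the whole line and can be iterated to every order.\<close>

lemma DERIV_gexp: "(gexp k has_real_derivative gexp (k + 2) s - real k * gexp (k + 1) s) (at s)"
proof -
  consider "s > 0" | "s = 0" | "s < 0" by linarith
  then show ?thesis
  proof cases
    case 1
    \<comment> \<open>The exponent k - 1 is a difference of natural numbers; for k = 0 the factor
      \<open>real k\<close> removes the term that contains it.\<close>
    have *: "inverse s ^ 2 * inverse s ^ (k - 1) = inverse s ^ (k + 1)" if "k \<noteq> 0"
      using that by (cases k) (simp_all add: power2_eq_square)
    have "((\<lambda>s. exp (- inverse s) * inverse s ^ k) has_real_derivative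
        exp (- inverse s) * (inverse s ^ 2) * inverse s ^ k
          + exp (- inverse s) * (real k * inverse s ^ (k - 1) * - (inverse s ^ 2))) (at s)"
      using 1 by (auto intro!: derivative_eq_intros simp: power2_eq_square)
    also have "exp (- inverse s) * (inverse s ^ 2) * inverse s ^ k
          + exp (- inverse s) * (real k * inverse s ^ (k - 1) * - (inverse s ^ 2))
        = gexp (k + 2) s - real k * gexp (k + 1) s"
      using 1 * by (cases "k = 0") (simp_all add: gexp_def power_add algebra_simps power2_eq_square)
    finally have "((\<lambda>s. exp (- inverse s) * inverse s ^ k) has_real_derivative
        gexp (k + 2) s - real k * gexp (k + 1) s) (at s)" .
    moreover have "eventually (\<lambda>s. s > 0) (nhds s)"
      using 1 eventually_nhds_in_open[of "{0<..}" s] by simp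
    ultimately show ?thesis
      by (subst DERIV_cong_ev[OF refl _ refl, where g="\<lambda>s. exp (- inverse s) * inverse s ^ k"])
        (auto simp: gexp_def elim!: eventually_mono)
  next
    case 2
    have "(\<lambda>h. (gexp k h - gexp k 0) / h) = gexp (k + 1)"
      by (auto simp: gexp_def fun_eq_iff divide_inverse)
    then show ?thesis using 2 gexp_tendsto_0[of "k+1"]
      by (simp add: has_field_derivative_iff gexp_def)
  next
    case 3
    have "eventually (\<lambda>s. s < 0) (nhds s)"
      using 3 eventually_nhds_in_open[of "{..<0}" s] by simp
    then have "(gexp k has_real_derivative 0) (at s) \<longleftrightarrow> ((\<lambda>s. 0) has_real_derivative 0) (at s)"
      by (intro DERIV_cong_ev) (auto simp: gexp_def elim!: eventually_mono)
    with 3 show ?thesis by (auto simp: gexp_def)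
  qed
qed

lemma continuous_on_gexp: "continuous_on A (gexp k)"
  by (rule DERIV_continuous_on[OF has_field_derivative_at_within[OF DERIV_gexp]])

lemma gexp_nonneg: "gexp k s \<ge> 0" by (auto simp: gexp_def)

lemma gexp_le_1: "gexp 0 s \<le> 1" by (auto simp: gexp_def)

lemma gexp_0_eq_0_iff: "gexp k s = 0 \<longleftrightarrow> s \<le> 0" by (auto simp: gexp_def)

lemma gexp_0_mono:
  assumes "s \<le> t"
  shows "gexp 0 s \<le> gexp 0 t"
using assms proof (rule DERIV_nonneg_imp_nondecreasing)
  fix x
  show "\<exists>y. (gexp 0 has_real_derivative y) (at x) \<and> 0 \<le> y"
    using DERIV_gexp[of 0 x] gexp_nonneg[of 2 x] by (intro exI[of _ "gexp 2 x"]) (simp add: numeral_2_eq_2)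
qed

lemma gexp_0_tendsto_1: "filterlim f at_top F \<Longrightarrow> ((\<lambda>x. gexp 0 (f x)) \<longlongrightarrow> 1) F"
proof -
  assume f: "filterlim f at_top F"
  have "((\<lambda>x. exp (- inverse (f x))) \<longlongrightarrow> exp (- 0)) F"
    by (intro tendsto_exp tendsto_minus filterlim_compose[OF tendsto_inverse_0_at_top f] filterlim_ident)
  moreover have "eventually (\<lambda>x. exp (- inverse (f x)) = gexp 0 (f x)) F"
    using filterlim_at_top_dense[THEN iffD1, OF f, rule_format, of 0]
    by (auto simp: gexp_def inverse_eq_divide elim!: eventually_mono)
  ultimately show ?thesis by (auto intro: Lim_transform_eventually)
qed

text \<open>Steepening by n + 1 sends a positive argument to infinity and leaves a nonpositive one
  at the value 0. The same limit yields indicators of boxes, of time intervals and, at the very end,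
  of the set {v > w}.\<close>

lemma gexp_tendsto_indicator: "(\<lambda>n. gexp 0 (real (Suc n) * y)) \<longlonglongrightarrow> (if y > 0 then 1 else 0)"
proof (cases "y > 0")
  case True
  have "filterlim (\<lambda>n. y * real (Suc n)) at_top sequentially"
    by (intro filterlim_tendsto_pos_mult_at_top[OF tendsto_const True]
        filterlim_compose[OF filterlim_real_sequentially filterlim_Suc])
  from gexp_0_tendsto_1[OF this] True show ?thesis by (simp add: mult.commute)
next
  case False
  then have "gexp 0 (real (Suc n) * y) = 0" for n
    unfolding gexp_0_eq_0_iff by (intro mult_nonneg_nonpos) auto
  with False show ?thesis by simp
qed

text \<open>Differentiating the function with exponent j produces exponents j + 1 and j + 2, so the
  induction on the order of differentiability has to treat all j at once.\<close>

lemma C_diff_gexp: "(\<And>k. C_diff k \<phi>) \<Longrightarrow> C_diff k (\<lambda>x. gexp j (\<phi> x))"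
proof (induction k arbitrary: j)
  case 0
  then have "continuous_on UNIV \<phi>" using C_diff.simps(1) by blast
  then show ?case by (auto intro: continuous_on_compose2[OF continuous_on_gexp[of UNIV]])
next
  case (Suc k)
  have d: "\<phi> differentiable at x" for x using Suc.prems[of 1] by auto
  have "partial_deriv b (\<lambda>x. gexp j (\<phi> x))
      = (\<lambda>x. (gexp (j + 2) (\<phi> x) + (- real j) * gexp (j + 1) (\<phi> x)) * partial_deriv b \<phi> x)" for b
    using partial_deriv_chain(1)[OF d DERIV_gexp] by auto
  moreover have "C_diff k (partial_deriv b \<phi>)" if "b \<in> Basis" for b
    using Suc.prems[of "Suc k"] that by auto
  moreover have "C_diff k (\<lambda>x. (gexp (j + 2) (\<phi> x) + (- real j) * gexp (j + 1) (\<phi> x)) * partial_deriv b \<phi> x)"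
    if "b \<in> Basis" for b
    by (intro C_diff_add C_diff_mult C_diff_const Suc.IH Suc.prems calculation that)
  ultimately show ?case using partial_deriv_chain(2)[OF d DERIV_gexp] by auto
qed

section \<open>Construction and closure properties of test functions\<close>

lemma test_functionsD:
  assumes "\<phi> \<in> test_functions \<Omega>"
  shows "C_diff k \<phi>" "compact (closure {x. \<phi> x \<noteq> 0})" "closure {x. \<phi> x \<noteq> 0} \<subseteq> \<Omega>"
    "\<phi> differentiable at x" "continuous_on UNIV \<phi>"
proof -
  show *: "C_diff k \<phi>" for k using assms by (auto simp: test_functions_def)
  show "compact (closure {x. \<phi> x \<noteq> 0})" "closure {x. \<phi> x \<noteq> 0} \<subseteq> \<Omega>"
    using assms by (auto simp: test_functions_def)
  show "\<phi> differentiable at x" "continuous_on UNIV \<phi>" using *[of 1] *[of 0] by auto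
qed

lemma test_functionsI:
  assumes "\<And>k. C_diff k \<phi>" "{x. \<phi> x \<noteq> 0} \<subseteq> K" "compact K" "K \<subseteq> \<Omega>"
  shows "\<phi> \<in> test_functions \<Omega>"
proof -
  have "closure {x. \<phi> x \<noteq> 0} \<subseteq> K" using assms closure_minimal compact_imp_closed by blast
  then show ?thesis using assms compact_Int_closed[of K "closure {x. \<phi> x \<noteq> 0}"]
    by (auto simp: test_functions_def Int_absorb1)
qed

text \<open>A product of one-dimensional bumps, two factors per coordinate, one for each face. It is
  positive exactly in the open box, and a growing r steepens it towards the indicator of that
  box.\<close>

lemma test_functions_box:
  fixes a c :: "'a::euclidean_space"
  assumes "cbox a c \<subseteq> \<Omega>" "r > 0"
  shows "(\<lambda>x. \<Prod>b\<in>Basis. gexp 0 (r * (x \<bullet> b - a \<bullet> b)) * gexp 0 (r * (c \<bullet> b - x \<bullet> b))) \<in> test_functions \<Omega>"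
    (is "?f \<in> _")
proof (rule test_functionsI[of _ "cbox a c"])
  have *: "C_diff j (\<lambda>x. p * (q + s * (x \<bullet> b)))" for p q s j and b :: 'a
    by (intro C_diff_mult C_diff_const C_diff_add C_diff_inner)
  have "C_diff j (\<lambda>x. r * (x \<bullet> b - a \<bullet> b))" "C_diff j (\<lambda>x. r * (c \<bullet> b - x \<bullet> b))" for j and b :: 'a
    using *[of j r "- (a \<bullet> b)" 1 b] *[of j r "(c \<bullet> b)" "-1" b] by simp_all
  then show "C_diff k ?f" for k
    by (intro C_diff_prod C_diff_mult[of k "\<lambda>x. gexp 0 (_ x)" "\<lambda>x. gexp 0 (_ x)"] C_diff_gexp)
  show "{x. ?f x \<noteq> 0} \<subseteq> cbox a c"
    using assms(2) by (auto simp: mem_box gexp_0_eq_0_iff zero_less_mult_iff not_le less_imp_le)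
qed (use assms in auto)

lemma test_functions_add:
  assumes "\<phi> \<in> test_functions \<Omega>" "\<psi> \<in> test_functions \<Omega>"
  shows "(\<lambda>x. \<phi> x + \<psi> x) \<in> test_functions \<Omega>"
proof (rule test_functionsI[of _ "closure {x. \<phi> x \<noteq> 0} \<union> closure {x. \<psi> x \<noteq> 0}"])
  show "C_diff k (\<lambda>x. \<phi> x + \<psi> x)" for k
    by (intro C_diff_add test_functionsD(1)[OF assms(1)] test_functionsD(1)[OF assms(2)])
  show "{x. \<phi> x + \<psi> x \<noteq> 0} \<subseteq> closure {x. \<phi> x \<noteq> 0} \<union> closure {x. \<psi> x \<noteq> 0}"
    by (rule order_trans[OF _ Un_mono[OF closure_subset closure_subset]]) auto
qed (use test_functionsD(2,3)[OF assms(1)] test_functionsD(2,3)[OF assms(2)] in auto)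

lemma test_functions_mult:
  assumes "\<phi> \<in> test_functions \<Omega>" "\<And>k. C_diff k \<psi>"
  shows "(\<lambda>x. \<psi> x * \<phi> x) \<in> test_functions \<Omega>"
proof (rule test_functionsI[of _ "closure {x. \<phi> x \<noteq> 0}"])
  show "C_diff k (\<lambda>x. \<psi> x * \<phi> x)" for k
    by (intro C_diff_mult test_functionsD(1)[OF assms(1)] assms(2))
  show "{x. \<psi> x * \<phi> x \<noteq> 0} \<subseteq> closure {x. \<phi> x \<noteq> 0}"
    by (rule order_trans[OF _ closure_subset]) auto
qed (use test_functionsD(2,3)[OF assms(1)] in auto)

lemma test_functions_scale: "\<phi> \<in> test_functions \<Omega> \<Longrightarrow> (\<lambda>x. c * \<phi> x) \<in> test_functions \<Omega>"
  by (rule test_functions_mult) auto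

lemma test_functions_zero: "(\<lambda>x. 0) \<in> test_functions \<Omega>"
  by (rule test_functionsI[of _ "{}"]) auto

text \<open>Since \<open>gexp 0\<close> vanishes at 0, the composition vanishes wherever \<phi>
  does, so the support cannot grow. This is why a smooth function flat at 0 replaces the usual
  piecewise linear truncation.\<close>

lemma test_functions_gexp:
  assumes "\<phi> \<in> test_functions \<Omega>"
  shows "(\<lambda>x. gexp 0 (r * \<phi> x)) \<in> test_functions \<Omega>"
proof (rule test_functionsI[of _ "closure {x. \<phi> x \<noteq> 0}"])
  show "C_diff k (\<lambda>x. gexp 0 (r * \<phi> x))" for k
    using test_functionsD(1)[OF assms] by (intro C_diff_gexp C_diff_mult) auto
  show "{x. gexp 0 (r * \<phi> x) \<noteq> 0} \<subseteq> closure {x. \<phi> x \<noteq> 0}"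
    by (rule order_trans[OF _ closure_subset]) (auto simp: gexp_0_eq_0_iff)
qed (use test_functionsD[OF assms] in auto)

lemma partial_deriv_test_function:
  assumes "\<phi> \<in> test_functions \<Omega>" "b \<in> Basis"
  shows "{x. partial_deriv b \<phi> x \<noteq> 0} \<subseteq> closure {x. \<phi> x \<noteq> 0}"
    "continuous_on UNIV (partial_deriv b \<phi>)"
proof -
  show "continuous_on UNIV (partial_deriv b \<phi>)"
    using test_functionsD(1)[OF assms(1), of 1] assms(2) by auto
  show "{x. partial_deriv b \<phi> x \<noteq> 0} \<subseteq> closure {x. \<phi> x \<noteq> 0}"
  proof (rule ccontr)
    assume "\<not> ?thesis"
    then obtain x where x: "partial_deriv b \<phi> x \<noteq> 0" "x \<notin> closure {x. \<phi> x \<noteq> 0}" by auto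
    define S where "S = - closure {x. \<phi> x \<noteq> 0}"
    have S: "open S" "x \<in> S" using x by (auto simp: S_def)
    have "\<phi> y = 0" if "y \<in> S" for y
      using that closure_subset[of "{x. \<phi> x \<noteq> 0}"] by (auto simp: S_def)
    with S have "(\<phi> has_derivative (\<lambda>_. 0)) (at x)"
      by (intro has_derivative_transform_within_open[of "\<lambda>_. 0" "\<lambda>_. 0" x UNIV S \<phi>]) auto
    with x(1) show False by (simp add: partial_deriv_eqI)
  qed
qed

section \<open>Borel representatives of Lebesgue measurable functions\<close>

lemma AE_lebesgue_on_iff:
  assumes "\<Omega> \<in> sets lebesgue"
  shows "(AE x in lebesgue_on \<Omega>. P x) \<longleftrightarrow> (AE x in lborel. x \<in> \<Omega> \<longrightarrow> P x)"
  using assms by (simp add: AE_restrict_space_iff AE_completion_iff)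

text \<open>Each coordinate has a Borel representative; there are finitely many coordinates, so
  their exceptional sets unite to a null set.\<close>

lemma lebesgue_ex_borel_measurable:
  fixes f :: "'a::euclidean_space \<Rightarrow> 'b::euclidean_space"
  assumes "f \<in> borel_measurable lebesgue"
  obtains f' where "f' \<in> borel_measurable borel" "AE x in lborel. f x = f' x"
proof -
  have "\<exists>g\<in>borel_measurable lborel. AE x in lborel. f x \<bullet> b = g x" for b
    using assms by (intro completion_ex_borel_measurable_real) auto
  then obtain g where g: "\<And>b. g b \<in> borel_measurable lborel" "\<And>b. AE x in lborel. f x \<bullet> b = g b x"
    by metis
  show thesis
  proof
    have "g b \<in> borel_measurable borel" for b using g(1)[of b] by simp
    then show "(\<lambda>x. \<Sum>b\<in>Basis. g b x *\<^sub>R b) \<in> borel_measurable borel"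
      by measurable
    have "AE x in lborel. \<forall>b\<in>Basis. f x \<bullet> b = g b x"
      using g(2) by (intro AE_finite_allI) auto
    then show "AE x in lborel. f x = (\<Sum>b\<in>Basis. g b x *\<^sub>R b)"
    proof eventually_elim
      case (elim x)
      have "f x = (\<Sum>b\<in>Basis. (f x \<bullet> b) *\<^sub>R b)" by (simp add: euclidean_representation)
      with elim show ?case by simp
    qed
  qed
qed

lemma lebesgue_on_ex_borel_measurable:
  fixes f :: "'a::euclidean_space \<Rightarrow> 'b::euclidean_space"
  assumes "f \<in> borel_measurable (lebesgue_on \<Omega>)" "\<Omega> \<in> sets lebesgue"
  obtains f' where "f' \<in> borel_measurable borel" "AE x in lborel. x \<in> \<Omega> \<longrightarrow> f x = f' x"
proof -
  have "(\<lambda>x. indicator \<Omega> x *\<^sub>R f x) \<in> borel_measurable lebesgue"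
    using assms by (subst (asm) borel_measurable_restrict_space_iff) auto
  then obtain f' where "f' \<in> borel_measurable borel" "AE x in lborel. indicator \<Omega> x *\<^sub>R f x = f' x"
    by (rule lebesgue_ex_borel_measurable)
  then show thesis by (intro that[of f']) (auto elim!: eventually_mono)
qed

text \<open>A Borel representative moves integrals over \<Omega> to \<open>lborel\<close> on the
  whole space. That measure is compatible with products and invariant under translations, which the
  Fubini and shift arguments rely on.\<close>

lemma
  fixes f :: "'a::euclidean_space \<Rightarrow> 'b::euclidean_space"
  assumes "\<Omega> \<in> sets borel" "f' \<in> borel_measurable borel" "AE x in lborel. x \<in> \<Omega> \<longrightarrow> f x = f' x"
  shows lebesgue_on_lborel_measurable: "f \<in> borel_measurable (lebesgue_on \<Omega>)"
    and lebesgue_on_lborel_integrable: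
      "integrable (lebesgue_on \<Omega>) f \<longleftrightarrow> integrable lborel (\<lambda>x. indicator \<Omega> x *\<^sub>R f' x)"
    and lebesgue_on_lborel_integral:
      "(LINT x|lebesgue_on \<Omega>. f x) = (LINT x|lborel. indicator \<Omega> x *\<^sub>R f' x)"
proof -
  have [measurable]: "\<Omega> \<in> sets borel" "f' \<in> borel_measurable borel" by fact+
  have L: "\<Omega> \<in> sets lebesgue" using assms(1) by simp
  have f': "f' \<in> borel_measurable lebesgue" using assms(2) by (simp add: measurable_completion)
  have fr: "f' \<in> borel_measurable (lebesgue_on \<Omega>)" using f' by (rule measurable_restrict_space1)
  have ae: "AE x in lebesgue_on \<Omega>. f' x = f x"
    using assms(3) by (subst AE_lebesgue_on_iff[OF L]) (auto elim!: eventually_mono)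
  have ae2: "AE x in lebesgue. indicator \<Omega> x *\<^sub>R f' x = indicator \<Omega> x *\<^sub>R f x"
    using assms(3) by (subst AE_completion_iff) (auto elim!: eventually_mono simp: indicator_def)
  have m2: "(\<lambda>x. indicator \<Omega> x *\<^sub>R f' x) \<in> borel_measurable lebesgue" using f' L by measurable
  have m3: "(\<lambda>x. indicator \<Omega> x *\<^sub>R f x) \<in> borel_measurable lebesgue"
    by (rule borel_measurable_AE[OF m2 ae2])
  then show m: "f \<in> borel_measurable (lebesgue_on \<Omega>)"
    using L by (subst borel_measurable_restrict_space_iff) auto
  show "integrable (lebesgue_on \<Omega>) f \<longleftrightarrow> integrable lborel (\<lambda>x. indicator \<Omega> x *\<^sub>R f' x)"
    using L integrable_cong_AE[OF m2 m3 ae2]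
    by (subst integrable_restrict_space) (auto simp: integrable_completion)
  show "(LINT x|lebesgue_on \<Omega>. f x) = (LINT x|lborel. indicator \<Omega> x *\<^sub>R f' x)"
    using L integral_cong_AE[OF m2 m3 ae2]
    by (subst integral_restrict_space) (auto simp: integral_completion)
qed

section \<open>Bounds and integration by parts for test functions\<close>

lemma borel_measurable_test:
  assumes "\<phi> \<in> test_functions \<Omega>"
  shows "\<phi> \<in> borel_measurable borel" "b \<in> Basis \<Longrightarrow> partial_deriv b \<phi> \<in> borel_measurable borel"
  using test_functionsD(5)[OF assms] partial_deriv_test_function(2)[OF assms]
  by (auto intro: borel_measurable_continuous_onI)

lemma bounded_compact_support:
  fixes f :: "'a::euclidean_space \<Rightarrow> real"
  assumes "continuous_on UNIV f" "{x. f x \<noteq> 0} \<subseteq> K" "compact K"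
  obtains C where "C > 0" "\<And>x. \<bar>f x\<bar> \<le> C"
proof -
  have "bounded (f ` K)"
    using assms by (intro compact_imp_bounded compact_continuous_image) (auto intro: continuous_on_subset)
  then obtain C where C: "C > 0" "\<And>y. y \<in> f ` K \<Longrightarrow> norm y \<le> C" using bounded_pos by metis
  show thesis
  proof (rule that[OF C(1)])
    fix x show "\<bar>f x\<bar> \<le> C"
      using C assms(2) by (cases "x \<in> K"; cases "f x = 0") auto
  qed
qed

lemma test_functions_bounded:
  assumes "\<phi> \<in> test_functions \<Omega>"
  obtains C where "C > 0" "\<And>x. \<bar>\<phi> x\<bar> \<le> C" "\<And>x b. b \<in> Basis \<Longrightarrow> \<bar>partial_deriv b \<phi> x\<bar> \<le> C"
proof -
  note t = test_functionsD[OF assms] and p = partial_deriv_test_function[OF assms]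
  obtain C0 where C0: "C0 > 0" "\<And>x. \<bar>\<phi> x\<bar> \<le> C0"
    using bounded_compact_support[OF t(5) closure_subset t(2)] by metis
  have "\<exists>C. \<forall>x. \<bar>partial_deriv b \<phi> x\<bar> \<le> C" if "b \<in> Basis" for b
    using bounded_compact_support[OF p(2,1)[OF that] t(2)] by metis
  then obtain C where C: "\<And>b x. b \<in> Basis \<Longrightarrow> \<bar>partial_deriv b \<phi> x\<bar> \<le> C b" by metis
  have "\<bar>partial_deriv b \<phi> x\<bar> \<le> C0 + (\<Sum>b\<in>Basis. \<bar>C b\<bar>)" if "b \<in> Basis" for b x
    using C[OF that, of x] member_le_sum[of b Basis "\<lambda>b. \<bar>C b\<bar>"] that C0(1) by force
  moreover have "\<bar>\<phi> x\<bar> \<le> C0 + (\<Sum>b\<in>Basis. \<bar>C b\<bar>)" for x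
    using C0(2)[of x] by (simp add: add_increasing2 sum_nonneg)
  moreover have "C0 + (\<Sum>b\<in>Basis. \<bar>C b\<bar>) > 0"
    using C0(1) by (simp add: add_pos_nonneg sum_nonneg)
  ultimately show thesis using that by blast
qed

text \<open>By translation invariance every difference quotient of g has integral zero. The
  quotients converge to the derivative and are dominated by a constant on a fixed ball, so the zero
  passes to the limit; no iterated integration is involved.\<close>

lemma integral_partial_deriv_test:
  fixes g :: "'a::euclidean_space \<Rightarrow> real"
  assumes g: "g \<in> test_functions UNIV" and b: "b \<in> Basis"
  shows "(LINT x|lborel. partial_deriv b g x) = 0"
proof -
  note t = test_functionsD[OF g] and p = partial_deriv_test_function[OF g b]
  have [measurable]: "g \<in> borel_measurable borel" using borel_measurable_test[OF g] by auto
  obtain C where C: "C > 0" "\<And>x. \<bar>partial_deriv b g x\<bar> \<le> C" "\<And>x. \<bar>g x\<bar> \<le> C"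
    using test_functions_bounded[OF g] b by metis
  obtain R where R: "R > 0" "closure {x. g x \<noteq> 0} \<subseteq> cball 0 R"
    using compact_imp_bounded[OF t(2)] unfolding bounded_pos by (auto simp: subset_eq)
  have zero: "g x = 0" if "x \<notin> cball 0 R" for x using R(2) that closure_subset[of "{x. g x \<noteq> 0}"] by auto
  \<comment> \<open>Step sizes of at most 1, so that all shifted supports stay inside the ball of
    radius R + 1.\<close>
  define e where "e n = inverse (real (Suc n))" for n
  have e: "0 < e n" "e n \<le> 1" for n by (auto simp: e_def field_simps)
  have e0: "e \<longlonglongrightarrow> 0" unfolding e_def by (rule LIMSEQ_inverse_real_of_nat)
  have int_g: "integrable lborel g"
  proof (rule Bochner_Integration.integrable_bound)
    show "integrable lborel (\<lambda>x. C * indicator (cball (0::'a) R) x)"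
      using emeasure_lborel_cball_finite[of "0::'a" R] by simp
    have "norm (g x) \<le> norm (C * indicator (cball 0 R) x)" for x
      using C(1) C(3)[of x] zero by (auto simp: indicator_def)
    then show "AE x in lborel. norm (g x) \<le> norm (C * indicator (cball 0 R) x)" by simp
  qed simp
  have D: "(g has_derivative (\<lambda>h. frechet_derivative g (at x) h)) (at x)" for x
    using t(4) frechet_derivative_works by blast
  have line: "((\<lambda>r. g (x + r *\<^sub>R b)) has_real_derivative partial_deriv b g (x + r *\<^sub>R b)) (at r)" for x r
  proof -
    have "((\<lambda>r. x + r *\<^sub>R b) has_derivative (\<lambda>h. h *\<^sub>R b)) (at r)"
      by (auto intro!: derivative_eq_intros)
    from has_derivative_compose[OF this D]
    have "((\<lambda>r. g (x + r *\<^sub>R b)) has_derivative (\<lambda>h. frechet_derivative g (at (x + r *\<^sub>R b)) (h *\<^sub>R b))) (at r)" .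
    moreover have "frechet_derivative g (at (x + r *\<^sub>R b)) (h *\<^sub>R b) = partial_deriv b g (x + r *\<^sub>R b) * h" for h
      using has_derivative_bounded_linear[OF D, of "x + r *\<^sub>R b"]
      by (simp add: partial_deriv_def linear_cmul bounded_linear.linear mult.commute)
    ultimately show ?thesis by (simp add: has_field_derivative_def)
  qed
  have lim: "(\<lambda>n. (g (x + e n *\<^sub>R b) - g x) / e n) \<longlonglongrightarrow> partial_deriv b g x" for x
  proof -
    have "((\<lambda>r. (g (x + r *\<^sub>R b) - g x) / r) \<longlongrightarrow> partial_deriv b g x) (at 0)"
      using line[of x 0] by (simp add: has_field_derivative_iff)
    moreover have "filterlim e (at 0) sequentially"
      unfolding filterlim_at using e0 e(1) by (auto intro!: always_eventually simp: less_imp_neq[THEN not_sym] less_imp_le)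
    ultimately show ?thesis by (rule filterlim_compose)
  qed
  have bound: "\<bar>(g (x + e n *\<^sub>R b) - g x) / e n\<bar> \<le> C * indicator (cball 0 (R + 1)) x" for x n
  proof (cases "x \<in> cball 0 (R + 1)")
    case True
    have "\<bar>g (x + e n *\<^sub>R b) - g (x + 0 *\<^sub>R b)\<bar> \<le> C * \<bar>e n - 0\<bar>"
      using e(1)[of n] C(2)
      by (intro field_differentiable_bound[where S="{0..e n}" and f="\<lambda>r. g (x + r *\<^sub>R b)"
            and f'="\<lambda>r. partial_deriv b g (x + r *\<^sub>R b)", unfolded real_norm_def])
        (auto intro: has_field_derivative_at_within[OF line])
    then show ?thesis using True e(1)[of n] by (simp add: field_simps abs_mult)
  next
    case False
    have "norm (e n *\<^sub>R b) \<le> 1" using e[of n] b by simp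
    then have "norm (x + e n *\<^sub>R b) > R"
      using False norm_triangle_ineq4[of "x + e n *\<^sub>R b" "e n *\<^sub>R b"] by auto
    with False R(1) show ?thesis by (auto simp: zero)
  qed
  have shift: "integrable lborel (\<lambda>x. g (x + c))" "(LINT x|lborel. g (x + c)) = (LINT x|lborel. g x)" for c
  proof -
    have *: "distr lborel borel ((+) c) = (lborel :: 'a measure)" by (simp add: lborel_distr_plus)
    show "integrable lborel (\<lambda>x. g (x + c))"
      using int_g integrable_distr_eq[of "(+) c" lborel borel g] unfolding * by (simp add: add.commute)
    show "(LINT x|lborel. g (x + c)) = (LINT x|lborel. g x)"
      using integral_distr[of "(+) c" lborel borel g] unfolding * by (simp add: add.commute)
  qed
  have "(\<lambda>n. LINT x|lborel. (g (x + e n *\<^sub>R b) - g x) / e n) \<longlonglongrightarrow> (LINT x|lborel. partial_deriv b g x)"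
  proof (rule integral_dominated_convergence[where w="\<lambda>x. C * indicator (cball 0 (R + 1)) x"])
    show "integrable lborel (\<lambda>x. C * indicator (cball (0::'a) (R + 1)) x)"
      using emeasure_lborel_cball_finite[of "0::'a" "R + 1"] by simp
    show "AE x in lborel. norm ((g (x + e n *\<^sub>R b) - g x) / e n) \<le> C * indicator (cball 0 (R + 1)) x" for n
      using bound by (simp only: real_norm_def always_eventually simp_thms)
    show "partial_deriv b g \<in> borel_measurable lborel"
      using borel_measurable_test(2)[OF g b] by simp
  qed (simp_all only: lim always_eventually simp_thms, measurable)
  moreover have "(LINT x|lborel. (g (x + e n *\<^sub>R b) - g x) / e n) = 0" for n
    using int_g shift[of "e n *\<^sub>R b"] by simp
  ultimately show ?thesis by (simp only: LIMSEQ_const_iff)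
qed

lemma integrable_test_lborel:
  fixes \<phi> :: "'a::euclidean_space \<Rightarrow> real"
  assumes "\<phi> \<in> test_functions \<Omega>" "\<psi> \<in> borel_measurable borel" "\<And>x. \<bar>\<psi> x\<bar> \<le> C"
  shows "integrable lborel (\<lambda>x. \<phi> x * \<psi> x)"
proof -
  note t = test_functionsD[OF assms(1)]
  have [measurable]: "\<phi> \<in> borel_measurable borel" "\<psi> \<in> borel_measurable borel"
    using borel_measurable_test[OF assms(1)] assms by auto
  obtain D where D: "D > 0" "\<And>x. \<bar>\<phi> x\<bar> \<le> D"
    using test_functions_bounded[OF assms(1)] by metis
  obtain R where R: "closure {x. \<phi> x \<noteq> 0} \<subseteq> cball 0 R"
    using compact_imp_bounded[OF t(2)] unfolding bounded_pos by (auto simp: subset_eq)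
  have zero: "\<phi> x = 0" if "x \<notin> cball 0 R" for x using R that closure_subset[of "{x. \<phi> x \<noteq> 0}"] by auto
  show ?thesis
  proof (rule Bochner_Integration.integrable_bound)
    show "integrable lborel (\<lambda>x. (D * C) * indicator (cball (0::'a) R) x)"
      using emeasure_lborel_cball_finite[of "0::'a" R] by simp
    have "\<bar>\<phi> x * \<psi> x\<bar> \<le> \<bar>D * C * indicator (cball 0 R) x\<bar>" for x
      using mult_mono[OF D(2)[of x] assms(3)[of x]] D(1) zero abs_ge_zero[of "\<psi> x", THEN order_trans, OF assms(3)]
      by (auto simp: indicator_def abs_mult)
    then show "AE x in lborel. norm (\<phi> x * \<psi> x) \<le> norm (D * C * indicator (cball 0 R) x)"
      by simp
  qed simp
qed

lemma test_functions_subset: "\<phi> \<in> test_functions \<Omega> \<Longrightarrow> \<Omega> \<subseteq> \<Omega>' \<Longrightarrow> \<phi> \<in> test_functions \<Omega>'"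
  by (auto simp: test_functions_def)

lemma integral_by_parts_test:
  fixes \<phi> \<eta> :: "'a::euclidean_space \<Rightarrow> real"
  assumes "\<phi> \<in> test_functions \<Omega>" "\<eta> \<in> test_functions \<Omega>" "b \<in> Basis"
  shows "(LINT x|lborel. \<phi> x * partial_deriv b \<eta> x) = - (LINT x|lborel. partial_deriv b \<phi> x * \<eta> x)"
proof -
  have "(\<lambda>x. \<eta> x * \<phi> x) \<in> test_functions UNIV"
    using test_functions_mult[OF assms(1) test_functionsD(1)[OF assms(2)]] by (rule test_functions_subset) simp
  from integral_partial_deriv_test[OF this assms(3)]
  have "(LINT x|lborel. \<phi> x * partial_deriv b \<eta> x + \<eta> x * partial_deriv b \<phi> x) = 0"
    using test_functionsD(4)[OF assms(1)] test_functionsD(4)[OF assms(2)]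
    by (subst (asm) partial_deriv_mult) (simp_all add: algebra_simps)
  moreover obtain C where C: "\<And>x. \<bar>partial_deriv b \<phi> x\<bar> \<le> C"
    using test_functions_bounded[OF assms(1)] assms(3) by metis
  moreover obtain C' where C': "\<And>x. \<bar>partial_deriv b \<eta> x\<bar> \<le> C'"
    using test_functions_bounded[OF assms(2)] assms(3) by metis
  ultimately show ?thesis
    using integrable_test_lborel[OF assms(1) borel_measurable_test(2)[OF assms(2,3)] C']
      integrable_test_lborel[OF assms(2) borel_measurable_test(2)[OF assms(1,3)] C]
    by (simp add: mult.commute)
qed

section \<open>The fundamental lemma of the calculus of variations\<close>

lemma enn2real_inject_finite: "enn2real a = enn2real b \<Longrightarrow> a < \<infinity> \<Longrightarrow> b < \<infinity> \<Longrightarrow> a = b"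
  by (metis ennreal_enn2real infinity_ennreal_def)

text \<open>The positive and the negative part of u on the box are densities of two finite measures.
  The hypothesis says that they agree on open boxes, an intersection-stable generator of the Borel
  sets, so the measures and hence the densities agree.\<close>

lemma AE_zero_on_box:
  fixes u :: "'a::euclidean_space \<Rightarrow> real"
  assumes u: "integrable lborel u"
    and z: "\<And>p q. (LINT x|lborel. u x * indicator (box p q \<inter> box a c) x) = 0"
  shows "AE x in lborel. x \<in> box a c \<longrightarrow> u x = 0"
proof -
  have um[measurable]: "u \<in> borel_measurable borel" using borel_measurable_integrable[OF u] by simp
  \<comment> \<open>\<open>ennreal\<close> truncates negative numbers to 0, so s = 1 gives the
    positive part of u on the box and s = -1 the negative part.\<close>
  define h where "h s x = ennreal (s * u x * indicator (box a c) x)" for s x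
  have hm[measurable]: "h s \<in> borel_measurable borel" for s unfolding h_def by measurable
  have fin: "(\<integral>\<^sup>+x. h s x \<partial>lborel) < \<infinity>" if "\<bar>s\<bar> = 1" for s
  proof -
    have "integrable lborel (\<lambda>x. s * u x * indicator (box a c) x)"
      using integrable_mult_indicator[of "box a c" lborel "\<lambda>x. s * u x"] u by (simp add: mult.commute)
    then show ?thesis unfolding h_def by (auto simp: real_integrable_def top.not_eq_extremum)
  qed
  have "density lborel (h 1) = density lborel (h (-1))"
  proof (rule measure_eqI_generator_eq[where E="range (\<lambda>(a, b). box a b)" and \<Omega>=UNIV
        and A="\<lambda>n::nat. box (- (real n *\<^sub>R One)) (real n *\<^sub>R One)"])
    let ?E = "range (\<lambda>(a, b). box a b::'a set)"
    show "Int_stable ?E" by (auto simp: Int_stable_def box_Int_box)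
    show "?E \<subseteq> Pow UNIV" "sets (density lborel (h 1)) = sigma_sets UNIV ?E"
      "sets (density lborel (h (-1))) = sigma_sets UNIV ?E"
      by (simp_all add: borel_eq_box)
    show "range (\<lambda>n::nat. box (- (real n *\<^sub>R One)) (real n *\<^sub>R One)) \<subseteq> ?E" 
         "(\<Union>n::nat. box (- (real n *\<^sub>R One)) (real n *\<^sub>R One)) = (UNIV::'a set)"
      unfolding UN_box_eq_UNIV by auto
    show "emeasure (density lborel (h 1)) (box (- (real i *\<^sub>R One)) (real i *\<^sub>R One)) \<noteq> \<infinity>" for i
    proof -
      have "emeasure (density lborel (h 1)) (box (- (real i *\<^sub>R One)) (real i *\<^sub>R One)) \<le> (\<integral>\<^sup>+x. h 1 x \<partial>lborel)"
        by (subst emeasure_density) (auto intro!: nn_integral_mono simp: indicator_def)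
      then show ?thesis using fin[of 1] by (auto simp: top_unique)
    qed
    show "emeasure (density lborel (h 1)) X = emeasure (density lborel (h (-1))) X" if "X \<in> ?E" for X
    proof -
      from that obtain p q where X: "X = box p q" by auto
      define k where "k x = u x * indicator (X \<inter> box a c) x" for x
      have k: "integrable lborel k" unfolding k_def X
        using integrable_mult_indicator[of "box p q \<inter> box a c" lborel u] u by (simp add: mult.commute)
      have e: "emeasure (density lborel (h s)) X = (\<integral>\<^sup>+x. ennreal (s * k x) \<partial>lborel)" for s
        unfolding X by (subst emeasure_density)
          (auto intro!: nn_integral_cong simp: h_def k_def X indicator_def)
      have "enn2real (\<integral>\<^sup>+x. ennreal (k x) \<partial>lborel) = enn2real (\<integral>\<^sup>+x. ennreal (- k x) \<partial>lborel)"
      proof -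
        have "integral\<^sup>L lborel k = 0" unfolding k_def X by (rule z)
        with real_lebesgue_integral_def[OF k] show ?thesis by simp
      qed
      moreover have "(\<integral>\<^sup>+x. ennreal (k x) \<partial>lborel) < \<infinity>" "(\<integral>\<^sup>+x. ennreal (- k x) \<partial>lborel) < \<infinity>"
        using k by (auto simp: real_integrable_def top.not_eq_extremum)
      ultimately have "(\<integral>\<^sup>+x. ennreal (k x) \<partial>lborel) = (\<integral>\<^sup>+x. ennreal (- k x) \<partial>lborel)"
        by (rule enn2real_inject_finite)
      then show ?thesis using e[of 1] e[of "-1"] by simp
    qed
  qed
  then have "AE x in lborel. h 1 x = h (-1) x"
    using fin[of 1] by (subst (asm) finite_density_unique) auto
  then show ?thesis
  proof eventually_elim
    case (elim x)
    \<comment> \<open>One of the two sides is 0 by truncation; the other one is then 0 too, which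
      excludes both signs of r.\<close>
    have "r = 0" if "ennreal r = ennreal (- r)" for r
      using that by (cases r "0::real" rule: linorder_cases) (auto simp: ennreal_neg ennreal_eq_0_iff)
    from this[of "u x * indicator (box a c) x"] elim show ?case by (auto simp: h_def)
  qed
qed

text \<open>Bumps between 0 and 1 converge pointwise to the indicator of the open box, and |u|
  dominates the integrands.\<close>

lemma integral_box_zero:
  fixes u :: "'a::euclidean_space \<Rightarrow> real"
  assumes u: "integrable lborel u" and "cbox a c \<subseteq> \<Omega>"
    and z: "\<And>\<phi>. \<phi> \<in> test_functions \<Omega> \<Longrightarrow> (LINT x|lborel. u x * \<phi> x) = 0"
  shows "(LINT x|lborel. u x * indicator (box a c) x) = 0"
proof -
  have [measurable]: "u \<in> borel_measurable borel" using borel_measurable_integrable[OF u] by simp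
  define \<phi> where "\<phi> n x = (\<Prod>b\<in>Basis. gexp 0 (real (Suc n) * (x \<bullet> b - a \<bullet> b)) * gexp 0 (real (Suc n) * (c \<bullet> b - x \<bullet> b)))"
    for n and x :: 'a
  have t: "\<phi> n \<in> test_functions \<Omega>" for n
    unfolding \<phi>_def using assms(2) by (intro test_functions_box) auto
  have [measurable]: "\<phi> n \<in> borel_measurable borel" for n
    using borel_measurable_test(1)[OF t] .
  have le: "\<bar>\<phi> n x\<bar> \<le> 1" for n x
    unfolding \<phi>_def abs_prod
    by (intro prod_le_1) (auto simp: abs_mult gexp_nonneg gexp_le_1 intro!: mult_le_one)
  have lim: "(\<lambda>n. \<phi> n x) \<longlonglongrightarrow> indicator (box a c) x" for x
  proof -
    have "(\<lambda>n. \<phi> n x) \<longlonglongrightarrow> (\<Prod>b\<in>Basis. (if x \<bullet> b - a \<bullet> b > 0 then 1 else 0) * (if c \<bullet> b - x \<bullet> b > 0 then 1 else 0))"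
      unfolding \<phi>_def by (intro tendsto_prod tendsto_mult gexp_tendsto_indicator)
    also have "(\<Prod>b\<in>Basis. (if x \<bullet> b - a \<bullet> b > 0 then 1 else 0) * (if c \<bullet> b - x \<bullet> b > 0 then 1 else 0))
        = (indicator (box a c) x :: real)"
      by (cases "x \<in> box a c") (auto simp: mem_box intro!: prod.neutral prod_zero)
    finally show ?thesis .
  qed
  have "(\<lambda>n. LINT x|lborel. u x * \<phi> n x) \<longlonglongrightarrow> (LINT x|lborel. u x * indicator (box a c) x)"
  proof (rule integral_dominated_convergence[where w="\<lambda>x. \<bar>u x\<bar>"])
    show "AE x in lborel. norm (u x * \<phi> i x) \<le> \<bar>u x\<bar>" for i
      using le by (auto simp: abs_mult intro!: mult_right_le_one_le)
  qed (use lim u in \<open>auto intro!: tendsto_mult\<close>)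
  then show ?thesis unfolding z[OF t] by (simp only: LIMSEQ_const_iff)
qed

lemma fundamental_lemma_lborel:
  fixes u :: "'a::euclidean_space \<Rightarrow> real"
  assumes u: "integrable lborel u" and "open \<Omega>"
    and z: "\<And>\<phi>. \<phi> \<in> test_functions \<Omega> \<Longrightarrow> (LINT x|lborel. u x * \<phi> x) = 0"
  shows "AE x in lborel. x \<in> \<Omega> \<longrightarrow> u x = 0"
proof -
  obtain D where D0: "countable D" "D \<subseteq> Pow \<Omega>" "\<And>X. X \<in> D \<Longrightarrow> \<exists>a b. X = cbox a b" "\<Union>D = \<Omega>"
    by (rule open_countable_Union_open_cbox[OF assms(2)]) (rule that)
  have D: "countable D" "\<And>X. X \<in> D \<Longrightarrow> X \<subseteq> \<Omega> \<and> (\<exists>a b. X = cbox a b)" "\<Union>D = \<Omega>"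
    using D0 by auto
  have "AE x in lborel. x \<in> X \<longrightarrow> u x = 0" if "X \<in> D" for X
  proof -
    from D(2)[OF that] obtain a c where X: "X = cbox a c" "cbox a c \<subseteq> \<Omega>" by auto
    have "(LINT x|lborel. u x * indicator (box p q \<inter> box a c) x) = 0" for p q
    proof -
      \<comment> \<open>Two open boxes meet in an open box. If it is nonempty, its closure is a
        closed box inside \<Omega>, as the construction of bumps demands.\<close>
      obtain a' c' where ac: "box p q \<inter> box a c = box a' c'" unfolding box_Int_box by blast
      show ?thesis
      proof (cases "box a' c' = {}")
        case False
        then have "cbox a' c' \<subseteq> cbox a c" using ac closure_box[OF False]
          by (metis box_subset_cbox closed_cbox closure_minimal inf.cobounded2 order_trans)
        with X(2) show ?thesis unfolding ac using integral_box_zero[OF u _ z] by blast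
      qed (simp add: ac)
    qed
    from AE_zero_on_box[OF u this] have "AE x in lborel. x \<in> box a c \<longrightarrow> u x = 0" by blast
    \<comment> \<open>The countable cover consists of closed boxes while the argument above reaches
      only their interiors; the faces form a null set.\<close>
    moreover have "AE x in lborel. x \<notin> cbox a c - box a c"
    proof -
      have "cbox a c - box a c \<in> null_sets lebesgue"
        using negligible_frontier_interval[of a c] by (simp add: negligible_iff_null_sets)
      from AE_not_in[OF this] show ?thesis by (simp add: AE_completion_iff)
    qed
    ultimately show ?thesis unfolding X by eventually_elim auto
  qed
  then have "AE x in lborel. \<forall>X\<in>D. x \<in> X \<longrightarrow> u x = 0"
    by (rule AE_ball_countable'[OF _ D(1)])
  then show ?thesis by eventually_elim (use D(3) in auto)
qed

lemma fundamental_lemma: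
  fixes u :: "'a::euclidean_space \<Rightarrow> real"
  assumes u: "integrable (lebesgue_on \<Omega>) u" and \<Omega>: "open \<Omega>"
    and z: "\<And>\<phi>. \<phi> \<in> test_functions \<Omega> \<Longrightarrow> (LINT x|lebesgue_on \<Omega>. u x * \<phi> x) = 0"
  shows "AE x in lebesgue_on \<Omega>. u x = 0"
proof -
  have B: "\<Omega> \<in> sets borel" "\<Omega> \<in> sets lebesgue" using \<Omega> by auto
  obtain u' where u': "u' \<in> borel_measurable borel" "AE x in lborel. x \<in> \<Omega> \<longrightarrow> u x = u' x"
    using lebesgue_on_ex_borel_measurable[OF borel_measurable_integrable[OF u] B(2)] by metis
  have "AE x in lborel. x \<in> \<Omega> \<longrightarrow> indicator \<Omega> x *\<^sub>R u' x = 0"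
  proof (rule fundamental_lemma_lborel[OF _ \<Omega>])
    show "integrable lborel (\<lambda>x. indicator \<Omega> x *\<^sub>R u' x)"
      using u lebesgue_on_lborel_integrable[OF B(1) u'] by simp
    fix \<phi> assume \<phi>: "\<phi> \<in> test_functions \<Omega>"
    have [measurable]: "\<phi> \<in> borel_measurable borel" "u' \<in> borel_measurable borel"
      using borel_measurable_test(1)[OF \<phi>] u'(1) by auto
    have "(LINT x|lebesgue_on \<Omega>. u x * \<phi> x) = (LINT x|lborel. indicator \<Omega> x *\<^sub>R (u' x * \<phi> x))"
      by (rule lebesgue_on_lborel_integral[OF B(1)]) (use u'(2) in \<open>auto elim!: eventually_mono\<close>)
    with z[OF \<phi>] show "(LINT x|lborel. indicator \<Omega> x *\<^sub>R u' x * \<phi> x) = 0"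
      by (simp add: mult.assoc)
  qed
  with u'(2) show ?thesis
    by (subst AE_lebesgue_on_iff[OF B(2)]) (auto elim!: eventually_elim2)
qed

section \<open>Weak gradients in \<open>L\<^sup>2\<close>\<close>

lemma L2_measurable: "f \<in> L2 M \<Longrightarrow> f \<in> borel_measurable M"
  by (simp add: L2_def)

lemma L2_integrable_sq: "f \<in> L2 M \<Longrightarrow> integrable M (\<lambda>x. (norm (f x))\<^sup>2)"
  by (simp add: L2_def)

lemma L2_norm_nonneg: "L2_norm M f \<ge> 0"
  by (simp add: L2_norm_def)

lemma L2_norm_sq: "(L2_norm M f)\<^sup>2 = (LINT x|M. (norm (f x))\<^sup>2)"
  by (simp add: L2_norm_def)

lemma norm_add_sq_le: "(norm (a + b))\<^sup>2 \<le> 2 * (norm a)\<^sup>2 + 2 * (norm (b::'a::real_normed_vector))\<^sup>2"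
proof -
  have "(norm (a + b))\<^sup>2 \<le> (norm a + norm b)\<^sup>2" by (intro power_mono norm_triangle_ineq norm_ge_zero)
  also have "\<dots> \<le> 2 * (norm a)\<^sup>2 + 2 * (norm b)\<^sup>2"
    using sum_squares_bound[of "norm a" "norm b"] by (simp add: power2_sum)
  finally show ?thesis .
qed

lemma L2_bound:
  assumes "f \<in> borel_measurable M" "integrable M g" "AE x in M. (norm (f x))\<^sup>2 \<le> g x"
  shows "f \<in> L2 M"
  unfolding L2_def mem_Collect_eq
proof (intro conjI)
  show "integrable M (\<lambda>x. (norm (f x))\<^sup>2)"
    by (rule Bochner_Integration.integrable_bound[OF assms(2)]) (use assms(1,3) in auto)
qed fact

lemma L2_lincomb:
  assumes "f \<in> L2 M" "g \<in> L2 M"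
  shows "(\<lambda>x. a *\<^sub>R f x + b *\<^sub>R g x) \<in> L2 M"
proof (rule L2_bound)
  have [measurable]: "f \<in> borel_measurable M" "g \<in> borel_measurable M" using assms L2_measurable by auto
  show "(\<lambda>x. a *\<^sub>R f x + b *\<^sub>R g x) \<in> borel_measurable M" by measurable
  show "integrable M (\<lambda>x. 2 * a\<^sup>2 * (norm (f x))\<^sup>2 + 2 * b\<^sup>2 * (norm (g x))\<^sup>2)"
    using assms by (auto simp: L2_integrable_sq)
  have "(norm (a *\<^sub>R f x + b *\<^sub>R g x))\<^sup>2 \<le> 2 * a\<^sup>2 * (norm (f x))\<^sup>2 + 2 * b\<^sup>2 * (norm (g x))\<^sup>2" for x
    using norm_add_sq_le[of "a *\<^sub>R f x" "b *\<^sub>R g x"] by (simp add: power_mult_distrib)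
  then show "AE x in M. (norm (a *\<^sub>R f x + b *\<^sub>R g x))\<^sup>2 \<le> 2 * a\<^sup>2 * (norm (f x))\<^sup>2 + 2 * b\<^sup>2 * (norm (g x))\<^sup>2"
    by simp
qed

lemma L2_add: "f \<in> L2 M \<Longrightarrow> g \<in> L2 M \<Longrightarrow> (\<lambda>x. f x + g x) \<in> L2 M"
  and L2_diff: "f \<in> L2 M \<Longrightarrow> g \<in> L2 M \<Longrightarrow> (\<lambda>x. f x - g x) \<in> L2 M"
  using L2_lincomb[of f M g 1 1] L2_lincomb[of f M g 1 "-1"] by simp_all

lemma L2_integrable_inner:
  fixes f g :: "'a \<Rightarrow> 'b::euclidean_space"
  assumes "f \<in> L2 M" "g \<in> L2 M"
  shows "integrable M (\<lambda>x. f x \<bullet> g x)"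
proof (rule Bochner_Integration.integrable_bound)
  have [measurable]: "f \<in> borel_measurable M" "g \<in> borel_measurable M" using assms L2_measurable by auto
  show "(\<lambda>x. f x \<bullet> g x) \<in> borel_measurable M" by measurable
  show "integrable M (\<lambda>x. (norm (f x))\<^sup>2 + (norm (g x))\<^sup>2)"
    using assms by (auto simp: L2_integrable_sq)
  have "norm (f x \<bullet> g x) \<le> norm ((norm (f x))\<^sup>2 + (norm (g x))\<^sup>2)" for x
  proof -
    have "\<bar>f x \<bullet> g x\<bar> \<le> norm (f x) * norm (g x)" by (rule Cauchy_Schwarz_ineq2)
    also have "\<dots> \<le> 2 * norm (f x) * norm (g x)" by simp
    also have "\<dots> \<le> (norm (f x))\<^sup>2 + (norm (g x))\<^sup>2" by (rule sum_squares_bound)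
    finally show ?thesis by simp
  qed
  then show "AE x in M. norm (f x \<bullet> g x) \<le> norm ((norm (f x))\<^sup>2 + (norm (g x))\<^sup>2)" by simp
qed

text \<open>The squared norm of f - t g is a nonnegative quadratic polynomial in t; evaluation at a
  suitable t gives the inequality.\<close>

lemma L2_Cauchy_Schwarz:
  fixes f g :: "'a \<Rightarrow> 'b::euclidean_space"
  assumes "f \<in> L2 M" "g \<in> L2 M"
  shows "\<bar>LINT x|M. f x \<bullet> g x\<bar> \<le> L2_norm M f * L2_norm M g"
proof -
  define A where "A = (L2_norm M f)\<^sup>2"
  define B where "B = (L2_norm M g)\<^sup>2"
  define c where "c = (LINT x|M. f x \<bullet> g x)"
  note i = L2_integrable_inner[OF assms] L2_integrable_sq[OF assms(1)] L2_integrable_sq[OF assms(2)]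
  have AB: "A \<ge> 0" "B \<ge> 0" by (auto simp: A_def B_def)
  have quad: "0 \<le> A - 2 * t * c + t\<^sup>2 * B" for t
  proof -
    have "0 \<le> (LINT x|M. (norm (f x))\<^sup>2 - 2 * t * (f x \<bullet> g x) + t\<^sup>2 * (norm (g x))\<^sup>2)"
    proof (rule integral_nonneg_AE, rule AE_I2)
      fix x
      have "0 \<le> (norm (f x - t *\<^sub>R g x))\<^sup>2" by simp
      also have "\<dots> = (norm (f x))\<^sup>2 - 2 * t * (f x \<bullet> g x) + t\<^sup>2 * (norm (g x))\<^sup>2"
        unfolding power2_norm_eq_inner by (simp add: inner_diff inner_commute algebra_simps power2_eq_square)
      finally show "0 \<le> (norm (f x))\<^sup>2 - 2 * t * (f x \<bullet> g x) + t\<^sup>2 * (norm (g x))\<^sup>2" .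
    qed
    also have "\<dots> = A - 2 * t * c + t\<^sup>2 * B"
      using i by (simp add: A_def B_def c_def L2_norm_sq)
    finally show ?thesis .
  qed
  have "c\<^sup>2 \<le> A * B"
  proof (cases "B = 0")
    case True
    have "c = 0"
    proof (rule ccontr)
      assume "c \<noteq> 0"
      \<comment> \<open>For B = 0 the polynomial is A - 2 t c, and this t makes it equal to
        -1.\<close>
      with quad[of "(A + 1) / (2 * c)"] True show False by simp
    qed
    with True show ?thesis by simp
  next
    case False
    with AB have "B > 0" by simp
    \<comment> \<open>The point c / B is the minimiser of the quadratic polynomial.\<close>
    have "0 \<le> B * (A - 2 * (c / B) * c + (c / B)\<^sup>2 * B)"
      using quad[of "c / B"] AB by simp
    also have "\<dots> = A * B - c\<^sup>2" using False by (simp add: field_simps power2_eq_square)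
    finally show ?thesis by simp
  qed
  then have "c\<^sup>2 \<le> (L2_norm M f * L2_norm M g)\<^sup>2" by (simp add: A_def B_def power_mult_distrib)
  then show ?thesis unfolding c_def
    by (metis L2_norm_nonneg abs_le_square_iff abs_of_nonneg mult_nonneg_nonneg)
qed

lemma tendsto_L2_integral:
  fixes g :: "'a \<Rightarrow> 'b::euclidean_space"
  assumes "\<And>n. f n \<in> L2 M" "h \<in> L2 M" "g \<in> L2 M"
    "(\<lambda>n. L2_norm M (\<lambda>x. h x - f n x)) \<longlonglongrightarrow> 0"
  shows "(\<lambda>n. LINT x|M. f n x \<bullet> g x) \<longlonglongrightarrow> (LINT x|M. h x \<bullet> g x)"
proof (rule Lim_transform2)
  show "(\<lambda>n. LINT x|M. h x \<bullet> g x) \<longlonglongrightarrow> (LINT x|M. h x \<bullet> g x)" by simp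
  have "\<bar>(LINT x|M. h x \<bullet> g x) - (LINT x|M. f n x \<bullet> g x)\<bar> \<le> L2_norm M (\<lambda>x. h x - f n x) * L2_norm M g" for n
    using L2_Cauchy_Schwarz[OF L2_diff[OF assms(2) assms(1)[of n]] assms(3)]
      L2_integrable_inner[OF assms(2,3)] L2_integrable_inner[OF assms(1)[of n] assms(3)]
    by (simp add: inner_diff_left)
  then show "(\<lambda>n. (LINT x|M. h x \<bullet> g x) - (LINT x|M. f n x \<bullet> g x)) \<longlonglongrightarrow> 0"
    by (intro Lim_null_comparison[OF _ tendsto_mult_left_zero[OF assms(4)]]) (auto intro: always_eventually)
qed

lemma L2_norm_cong_AE:
  assumes "f \<in> borel_measurable M" "g \<in> borel_measurable M" "AE x in M. f x = g x"
  shows "L2_norm M f = L2_norm M g"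
  unfolding L2_norm_def using assms
  by (intro arg_cong[of _ _ sqrt] integral_cong_AE) (auto elim!: eventually_mono)

lemma L2_norm_zero [simp]: "L2_norm M (\<lambda>x. 0) = 0"
  by (simp add: L2_norm_def)

section \<open>Classical and weak gradients on a bounded open set\<close>

definition grad :: "('a::euclidean_space \<Rightarrow> real) \<Rightarrow> 'a \<Rightarrow> 'a" where
  "grad \<phi> x = (\<Sum>b\<in>Basis. partial_deriv b \<phi> x *\<^sub>R b)"

lemma grad_inner: "b \<in> Basis \<Longrightarrow> grad \<phi> x \<bullet> b = partial_deriv b \<phi> x"
  by (simp add: grad_def inner_sum_left_Basis)

lemma lebesgue_on_integral_support:
  fixes f :: "'a::euclidean_space \<Rightarrow> 'b::euclidean_space"
  assumes "open \<Omega>" "f \<in> borel_measurable borel" "\<And>x. f x \<noteq> 0 \<Longrightarrow> x \<in> \<Omega>"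
  shows "(LINT x|lebesgue_on \<Omega>. f x) = (LINT x|lborel. f x)"
proof -
  have B: "\<Omega> \<in> sets borel" using assms(1) by auto
  have "(\<lambda>x. indicator \<Omega> x *\<^sub>R f x) = f" using assms(3) by (auto simp: fun_eq_iff indicator_def)
  then show ?thesis by (subst lebesgue_on_lborel_integral[OF B assms(2)]) auto
qed

context
  fixes \<Omega> :: "'a::euclidean_space set"
  assumes op: "open \<Omega>" and bd: "bounded \<Omega>"
begin

lemma finite_measure_Omega: "finite_measure (lebesgue_on \<Omega>)"
  using bd op by (simp add: finite_measure_lebesgue_on lmeasurable_open)

lemma bounded_L2:
  assumes "f \<in> borel_measurable (lebesgue_on \<Omega>)" "AE x in lebesgue_on \<Omega>. norm (f x) \<le> C"
  shows "f \<in> L2 (lebesgue_on \<Omega>)"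
  by (rule L2_bound[OF assms(1) finite_measure.integrable_const[OF finite_measure_Omega, of "C\<^sup>2"]])
    (use assms(2) in \<open>auto elim!: eventually_mono intro!: power_mono\<close>)

lemma L2_integrable:
  assumes "f \<in> L2 (lebesgue_on \<Omega>)"
  shows "integrable (lebesgue_on \<Omega>) f"
proof (rule Bochner_Integration.integrable_bound)
  show "integrable (lebesgue_on \<Omega>) (\<lambda>x. 1 + (norm (f x))\<^sup>2)"
    by (intro Bochner_Integration.integrable_add L2_integrable_sq[OF assms]
        finite_measure.integrable_const[OF finite_measure_Omega])
  have "norm (f x) \<le> norm (1 + (norm (f x))\<^sup>2)" for x
    using sum_squares_bound[of "norm (f x)" 1] norm_ge_zero[of "f x"] by (simp del: norm_ge_zero)
  then show "AE x in lebesgue_on \<Omega>. norm (f x) \<le> norm (1 + (norm (f x))\<^sup>2)" by simp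
qed (rule L2_measurable[OF assms])

lemma test_L2:
  assumes "\<phi> \<in> test_functions \<Omega>"
  shows "\<phi> \<in> L2 (lebesgue_on \<Omega>)" "b \<in> Basis \<Longrightarrow> partial_deriv b \<phi> \<in> L2 (lebesgue_on \<Omega>)"
    "grad \<phi> \<in> L2 (lebesgue_on \<Omega>)"
proof -
  have *: "f \<in> borel_measurable (lebesgue_on \<Omega>)" if "f \<in> borel_measurable borel"
    for f :: "'a \<Rightarrow> 'b::euclidean_space"
    using that by (intro measurable_restrict_space1 measurable_completion) simp
  obtain C where C: "\<And>x. \<bar>\<phi> x\<bar> \<le> C" "\<And>x b. b \<in> Basis \<Longrightarrow> \<bar>partial_deriv b \<phi> x\<bar> \<le> C"
    using test_functions_bounded[OF assms] by metis
  note m = borel_measurable_test[OF assms]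
  show "\<phi> \<in> L2 (lebesgue_on \<Omega>)" by (rule bounded_L2[OF *[OF m(1)]]) (use C in auto)
  show p: "partial_deriv b \<phi> \<in> L2 (lebesgue_on \<Omega>)" if "b \<in> Basis" for b
    by (rule bounded_L2[OF *[OF m(2)[OF that]]]) (use C(2)[OF that] in auto)
  have g: "grad \<phi> \<in> borel_measurable borel"
    unfolding grad_def[abs_def] using m(2) by (intro borel_measurable_sum borel_measurable_scaleR) auto
  have "norm (grad \<phi> x) \<le> (\<Sum>b\<in>(Basis::'a set). C)" for x
    unfolding grad_def using C(2) by (intro sum_norm_le) auto
  then show "grad \<phi> \<in> L2 (lebesgue_on \<Omega>)" by (intro bounded_L2[OF *[OF g]]) auto
qed

lemma is_weak_gradient_test:
  assumes "\<phi> \<in> test_functions \<Omega>"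
  shows "is_weak_gradient \<Omega> \<phi> (grad \<phi>)"
  unfolding is_weak_gradient_def
proof (intro ballI)
  fix \<eta> b assume \<eta>: "\<eta> \<in> test_functions \<Omega>" and b: "b \<in> (Basis :: 'a set)"
  note m = borel_measurable_test[OF assms] borel_measurable_test[OF \<eta>]
  have [measurable]: "\<phi> \<in> borel_measurable borel" "\<eta> \<in> borel_measurable borel"
    "partial_deriv b \<phi> \<in> borel_measurable borel" "partial_deriv b \<eta> \<in> borel_measurable borel"
    using m b by auto
  have s: "x \<in> \<Omega>" if "\<phi> x \<noteq> 0" for x
    using that test_functionsD(3)[OF assms] closure_subset[of "{x. \<phi> x \<noteq> 0}"] by auto
  have s': "x \<in> \<Omega>" if "\<eta> x \<noteq> 0" for x
    using that test_functionsD(3)[OF \<eta>] closure_subset[of "{x. \<eta> x \<noteq> 0}"] by auto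
  have "(LINT x|lebesgue_on \<Omega>. \<phi> x * partial_deriv b \<eta> x) = (LINT x|lborel. \<phi> x * partial_deriv b \<eta> x)"
    by (rule lebesgue_on_integral_support[OF op]) (use s in auto)
  also have "\<dots> = - (LINT x|lborel. partial_deriv b \<phi> x * \<eta> x)"
    by (rule integral_by_parts_test[OF assms \<eta> b])
  also have "(LINT x|lborel. partial_deriv b \<phi> x * \<eta> x) = (LINT x|lebesgue_on \<Omega>. partial_deriv b \<phi> x * \<eta> x)"
    by (rule lebesgue_on_integral_support[OF op, symmetric]) (use s' in auto)
  finally show "(LINT x|lebesgue_on \<Omega>. \<phi> x * partial_deriv b \<eta> x) = - (LINT x|lebesgue_on \<Omega>. (grad \<phi> x \<bullet> b) * \<eta> x)"
    by (simp add: grad_inner[OF b])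
qed

lemma L2_inner_Basis: "G \<in> L2 (lebesgue_on \<Omega>) \<Longrightarrow> b \<in> Basis \<Longrightarrow> (\<lambda>x. G x \<bullet> (b::'b::euclidean_space)) \<in> L2 (lebesgue_on \<Omega>)"
proof (rule L2_bound)
  assume G: "G \<in> L2 (lebesgue_on \<Omega>)" and b: "b \<in> Basis"
  have [measurable]: "G \<in> borel_measurable (lebesgue_on \<Omega>)" using G by (rule L2_measurable)
  show "(\<lambda>x. G x \<bullet> b) \<in> borel_measurable (lebesgue_on \<Omega>)" by measurable
  show "integrable (lebesgue_on \<Omega>) (\<lambda>x. (norm (G x))\<^sup>2)" using G by (rule L2_integrable_sq)
  show "AE x in lebesgue_on \<Omega>. (norm (G x \<bullet> b))\<^sup>2 \<le> (norm (G x))\<^sup>2"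
  proof (rule AE_I2)
    show "(norm (G x \<bullet> b))\<^sup>2 \<le> (norm (G x))\<^sup>2" for x
      using Basis_le_norm[OF b, of "G x"] by (simp flip: abs_le_square_iff)
  qed
qed

lemma is_weak_gradient_lincomb:
  assumes "u \<in> L2 (lebesgue_on \<Omega>)" "w \<in> L2 (lebesgue_on \<Omega>)" "G \<in> L2 (lebesgue_on \<Omega>)" "H \<in> L2 (lebesgue_on \<Omega>)"
    "is_weak_gradient \<Omega> u G" "is_weak_gradient \<Omega> w H"
  shows "is_weak_gradient \<Omega> (\<lambda>x. r * u x + s * w x) (\<lambda>x. r *\<^sub>R G x + s *\<^sub>R H x)"
  unfolding is_weak_gradient_def
proof (intro ballI)
  fix \<phi> b assume \<phi>: "\<phi> \<in> test_functions \<Omega>" and b: "b \<in> (Basis :: 'a set)"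
  note t = test_L2(1)[OF \<phi>] test_L2(2)[OF \<phi> b]
  note i = L2_integrable_inner[OF assms(1) t(2), simplified] L2_integrable_inner[OF assms(2) t(2), simplified]
    L2_integrable_inner[OF L2_inner_Basis[OF assms(3) b] t(1), simplified]
    L2_integrable_inner[OF L2_inner_Basis[OF assms(4) b] t(1), simplified]
  have "(LINT x|lebesgue_on \<Omega>. (r * u x + s * w x) * partial_deriv b \<phi> x)
      = r * (LINT x|lebesgue_on \<Omega>. u x * partial_deriv b \<phi> x) + s * (LINT x|lebesgue_on \<Omega>. w x * partial_deriv b \<phi> x)"
    using i by (simp add: algebra_simps)
  moreover have "(LINT x|lebesgue_on \<Omega>. ((r *\<^sub>R G x + s *\<^sub>R H x) \<bullet> b) * \<phi> x)
      = r * (LINT x|lebesgue_on \<Omega>. (G x \<bullet> b) * \<phi> x) + s * (LINT x|lebesgue_on \<Omega>. (H x \<bullet> b) * \<phi> x)"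
    using i by (simp add: algebra_simps inner_add_left)
  ultimately show "(LINT x|lebesgue_on \<Omega>. (r * u x + s * w x) * partial_deriv b \<phi> x)
      = - (LINT x|lebesgue_on \<Omega>. ((r *\<^sub>R G x + s *\<^sub>R H x) \<bullet> b) * \<phi> x)"
    using assms(5,6) \<phi> b by (simp add: is_weak_gradient_def)
qed

text \<open>Each coordinate of the difference is orthogonal to all test functions and therefore
  vanishes by the fundamental lemma. This makes the choice operator behind \<open>weak_grad\<close>
  harmless.\<close>

lemma is_weak_gradient_unique:
  assumes "G \<in> L2 (lebesgue_on \<Omega>)" "H \<in> L2 (lebesgue_on \<Omega>)"
    "is_weak_gradient \<Omega> u G" "is_weak_gradient \<Omega> u H"
  shows "AE x in lebesgue_on \<Omega>. G x = H x"
proof -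
  have "AE x in lebesgue_on \<Omega>. (G x - H x) \<bullet> b = 0" if b: "b \<in> Basis" for b
  proof (rule fundamental_lemma[OF _ op])
    show "integrable (lebesgue_on \<Omega>) (\<lambda>x. (G x - H x) \<bullet> b)"
      by (intro L2_integrable L2_inner_Basis L2_diff assms b)
    fix \<phi> assume \<phi>: "\<phi> \<in> test_functions \<Omega>"
    have "(LINT x|lebesgue_on \<Omega>. (G x \<bullet> b) * \<phi> x) = (LINT x|lebesgue_on \<Omega>. (H x \<bullet> b) * \<phi> x)"
      using assms(3,4) \<phi> b by (auto simp: is_weak_gradient_def)
    then show "(LINT x|lebesgue_on \<Omega>. (G x - H x) \<bullet> b * \<phi> x) = 0"
      using L2_integrable_inner[OF L2_inner_Basis[OF assms(1) b] test_L2(1)[OF \<phi>]]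
        L2_integrable_inner[OF L2_inner_Basis[OF assms(2) b] test_L2(1)[OF \<phi>]]
      unfolding inner_diff_left left_diff_distrib inner_real_def by simp
  qed
  then have "AE x in lebesgue_on \<Omega>. \<forall>b\<in>Basis. (G x - H x) \<bullet> b = 0"
    by (intro AE_finite_allI) auto
  then show ?thesis by eventually_elim (simp add: euclidean_all_zero_iff)
qed

text \<open>Once any square integrable weak gradient is known, it may replace the chosen one in
  pointwise statements up to null sets and in the Sobolev norm.\<close>

lemma weak_grad_props:
  assumes "G \<in> L2 (lebesgue_on \<Omega>)" "is_weak_gradient \<Omega> u G"
  shows "weak_grad \<Omega> u \<in> L2 (lebesgue_on \<Omega>)" "is_weak_gradient \<Omega> u (weak_grad \<Omega> u)"
    "AE x in lebesgue_on \<Omega>. weak_grad \<Omega> u x = G x"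
    "W12_norm \<Omega> u = sqrt ((L2_norm (lebesgue_on \<Omega>) u)\<^sup>2 + (L2_norm (lebesgue_on \<Omega>) G)\<^sup>2)"
proof -
  have "weak_grad \<Omega> u \<in> L2 (lebesgue_on \<Omega>) \<and> is_weak_gradient \<Omega> u (weak_grad \<Omega> u)"
    unfolding weak_grad_def by (rule someI[of _ G]) (use assms in blast)
  then show *: "weak_grad \<Omega> u \<in> L2 (lebesgue_on \<Omega>)" "is_weak_gradient \<Omega> u (weak_grad \<Omega> u)" by auto
  show **: "AE x in lebesgue_on \<Omega>. weak_grad \<Omega> u x = G x"
    by (rule is_weak_gradient_unique) fact+
  show "W12_norm \<Omega> u = sqrt ((L2_norm (lebesgue_on \<Omega>) u)\<^sup>2 + (L2_norm (lebesgue_on \<Omega>) G)\<^sup>2)"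
    unfolding W12_norm_def L2_norm_cong_AE[OF L2_measurable[OF *(1)] L2_measurable[OF assms(1)] **] ..
qed

lemma W12_weak_grad:
  assumes "u \<in> W12 \<Omega>"
  shows "u \<in> L2 (lebesgue_on \<Omega>)" "weak_grad \<Omega> u \<in> L2 (lebesgue_on \<Omega>)" "is_weak_gradient \<Omega> u (weak_grad \<Omega> u)"
  using assms weak_grad_props unfolding W12_def by auto

end

section \<open>The space \<open>W\<^sub>0\<^sup>1\<^sup>,\<^sup>2\<close>\<close>

text \<open>With y = 1/s the bound reads y^2 <= 2 exp y, which is part of the exponential series. As
  \<open>gexp 2\<close> is the derivative of \<open>gexp 0\<close>, the same 2 becomes the Lipschitz
  constant of \<open>gexp 0\<close>.\<close>

lemma gexp_2_le: "gexp 2 s \<le> 2"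
proof (cases "s > 0")
  case True
  define y where "y = inverse s"
  have y: "y > 0" using True by (simp add: y_def)
  have "y\<^sup>2 / 2 \<le> exp y" using exp_lower_Taylor_quadratic[of y] y by simp
  then have "exp (- y) * y\<^sup>2 \<le> 2" using y by (simp add: exp_minus field_simps)
  then show ?thesis using True by (simp add: gexp_def y_def)
qed (simp add: gexp_def)

lemma gexp_0_lipschitz: "\<bar>gexp 0 s - gexp 0 t\<bar> \<le> 2 * \<bar>s - t\<bar>"
proof -
  have "norm (gexp 0 s - gexp 0 t) \<le> 2 * norm (s - t)"
    by (rule field_differentiable_bound[where S=UNIV and f'="gexp 2"])
      (use DERIV_gexp[of 0] gexp_2_le gexp_nonneg in \<open>auto simp: numeral_2_eq_2 abs_of_nonneg\<close>)
  then show ?thesis by simp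
qed

lemma borel_measurable_gexp [measurable]: "gexp k \<in> borel_measurable borel"
  by (intro borel_measurable_continuous_onI continuous_on_gexp)

lemma grad_gexp:
  assumes "\<phi> \<in> test_functions \<Omega>"
  shows "grad (\<lambda>x. gexp 0 (r * \<phi> x)) x = (r * gexp 2 (r * \<phi> x)) *\<^sub>R grad \<phi> x"
proof -
  have d: "\<phi> differentiable at x" by (rule test_functionsD(4)[OF assms])
  have "((\<lambda>s. gexp 0 (r * s)) has_real_derivative gexp 2 (r * \<phi> x) * r) (at (\<phi> x))"
  proof -
    have "((\<lambda>s. gexp 0 (r * s)) has_real_derivative
        (gexp (0 + 2) (r * \<phi> x) - real 0 * gexp (0 + 1) (r * \<phi> x)) * r) (at (\<phi> x))"
      by (rule DERIV_chain2[of "gexp 0" _ "\<lambda>s. r * s", OF DERIV_gexp]) (auto intro!: derivative_eq_intros)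
    then show ?thesis by (simp add: numeral_2_eq_2)
  qed
  from partial_deriv_chain(1)[OF d this] show ?thesis
    unfolding grad_def scaleR_sum_right by (intro sum.cong) (auto simp: mult_ac)
qed

lemma L2_norm_tendsto_0_iff:
  "(\<lambda>n. L2_norm M (f n)) \<longlonglongrightarrow> 0 \<longleftrightarrow> (\<lambda>n. LINT x|M. (norm (f n x))\<^sup>2) \<longlonglongrightarrow> 0"
proof
  assume "(\<lambda>n. L2_norm M (f n)) \<longlonglongrightarrow> 0"
  from tendsto_power[OF this, of 2] show "(\<lambda>n. LINT x|M. (norm (f n x))\<^sup>2) \<longlonglongrightarrow> 0"
    by (simp add: L2_norm_sq)
next
  assume "(\<lambda>n. LINT x|M. (norm (f n x))\<^sup>2) \<longlonglongrightarrow> 0"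
  from tendsto_real_sqrt[OF this] show "(\<lambda>n. L2_norm M (f n)) \<longlonglongrightarrow> 0"
    by (simp add: L2_norm_def)
qed

lemma L2_norm_bound_tendsto_0:
  assumes "\<And>n. f n \<in> borel_measurable M" "\<And>n. integrable M (g n)"
    "\<And>n. AE x in M. (norm (f n x))\<^sup>2 \<le> g n x" "(\<lambda>n. LINT x|M. g n x) \<longlonglongrightarrow> 0"
  shows "(\<lambda>n. L2_norm M (f n)) \<longlonglongrightarrow> 0"
  unfolding L2_norm_tendsto_0_iff
proof (rule Lim_null_comparison[OF always_eventually assms(4)], rule allI)
  fix n
  have "f n \<in> L2 M" by (rule L2_bound[OF assms(1,2,3)])
  then have "(LINT x|M. (norm (f n x))\<^sup>2) \<le> (LINT x|M. g n x)"
    by (intro integral_mono_AE L2_integrable_sq assms)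
  then show "norm (LINT x|M. (norm (f n x))\<^sup>2) \<le> (LINT x|M. g n x)" by simp
qed

text \<open>Sequential membership in W_0^{1,2} with the gradient G carried along as data. Linear
  combinations and compositions can then compute their gradient explicitly instead of reasoning
  about the choice in \<open>weak_grad\<close>.\<close>

definition W012_approx :: "'a::euclidean_space set \<Rightarrow> ('a \<Rightarrow> real) \<Rightarrow> ('a \<Rightarrow> 'a) \<Rightarrow> bool" where
  "W012_approx \<Omega> u G \<longleftrightarrow> u \<in> L2 (lebesgue_on \<Omega>) \<and> G \<in> L2 (lebesgue_on \<Omega>) \<and>
     (\<exists>\<phi>. (\<forall>n::nat. \<phi> n \<in> test_functions \<Omega>) \<and>
       (\<lambda>n. L2_norm (lebesgue_on \<Omega>) (\<lambda>x. u x - \<phi> n x)) \<longlonglongrightarrow> 0 \<and>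
       (\<lambda>n. L2_norm (lebesgue_on \<Omega>) (\<lambda>x. G x - grad (\<phi> n) x)) \<longlonglongrightarrow> 0)"

context
  fixes \<Omega> :: "'a::euclidean_space set"
  assumes op: "open \<Omega>" and bd: "bounded \<Omega>"
begin

lemmas wg_props = weak_grad_props[OF op bd]

text \<open>The integration by parts formula holds for each approximating test function, and both of
  its sides are continuous under convergence in L^2.\<close>

lemma W012_approx_weak_gradient:
  assumes "W012_approx \<Omega> u G"
  shows "is_weak_gradient \<Omega> u G"
  unfolding is_weak_gradient_def
proof (intro ballI)
  fix \<eta> b assume \<eta>: "\<eta> \<in> test_functions \<Omega>" and b: "b \<in> (Basis :: 'a set)"
  from assms obtain \<phi> where u: "u \<in> L2 (lebesgue_on \<Omega>)" and G: "G \<in> L2 (lebesgue_on \<Omega>)"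
    and \<phi>: "\<And>n::nat. \<phi> n \<in> test_functions \<Omega>"
    and lim: "(\<lambda>n. L2_norm (lebesgue_on \<Omega>) (\<lambda>x. u x - \<phi> n x)) \<longlonglongrightarrow> 0"
      "(\<lambda>n. L2_norm (lebesgue_on \<Omega>) (\<lambda>x. G x - grad (\<phi> n) x)) \<longlonglongrightarrow> 0"
    unfolding W012_approx_def by blast
  have \<eta>b: "(\<lambda>x. \<eta> x *\<^sub>R b) \<in> L2 (lebesgue_on \<Omega>)"
  proof (rule L2_bound)
    show "(\<lambda>x. \<eta> x *\<^sub>R b) \<in> borel_measurable (lebesgue_on \<Omega>)"
      using L2_measurable[OF test_L2(1)[OF op bd \<eta>]] by measurable
  qed (use L2_integrable_sq[OF test_L2(1)[OF op bd \<eta>]] b in auto)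
  have "(\<lambda>n. LINT x|lebesgue_on \<Omega>. \<phi> n x \<bullet> partial_deriv b \<eta> x) \<longlonglongrightarrow> (LINT x|lebesgue_on \<Omega>. u x \<bullet> partial_deriv b \<eta> x)"
    by (rule tendsto_L2_integral[OF test_L2(1)[OF op bd \<phi>] u test_L2(2)[OF op bd \<eta> b] lim(1)])
  moreover have "(\<lambda>n. - (LINT x|lebesgue_on \<Omega>. grad (\<phi> n) x \<bullet> (\<eta> x *\<^sub>R b))) \<longlonglongrightarrow> - (LINT x|lebesgue_on \<Omega>. G x \<bullet> (\<eta> x *\<^sub>R b))"
    by (intro tendsto_minus) (rule tendsto_L2_integral[OF test_L2(3)[OF op bd \<phi>] G \<eta>b lim(2)])
  moreover have "(LINT x|lebesgue_on \<Omega>. \<phi> n x \<bullet> partial_deriv b \<eta> x) = - (LINT x|lebesgue_on \<Omega>. grad (\<phi> n) x \<bullet> (\<eta> x *\<^sub>R b))" for n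
    using is_weak_gradient_test[OF op bd \<phi>[of n]] \<eta> b by (simp add: is_weak_gradient_def mult.commute)
  ultimately have "(LINT x|lebesgue_on \<Omega>. u x \<bullet> partial_deriv b \<eta> x) = - (LINT x|lebesgue_on \<Omega>. G x \<bullet> (\<eta> x *\<^sub>R b))"
    by (simp only: LIMSEQ_unique)
  then show "(LINT x|lebesgue_on \<Omega>. u x * partial_deriv b \<eta> x) = - (LINT x|lebesgue_on \<Omega>. G x \<bullet> b * \<eta> x)"
    by (simp add: mult.commute)
qed

lemma is_weak_gradient_diff_test:
  assumes "u \<in> L2 (lebesgue_on \<Omega>)" "G \<in> L2 (lebesgue_on \<Omega>)" "is_weak_gradient \<Omega> u G" "\<phi> \<in> test_functions \<Omega>"
  shows "is_weak_gradient \<Omega> (\<lambda>x. u x - \<phi> x) (\<lambda>x. G x - grad \<phi> x)"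
    "(\<lambda>x. G x - grad \<phi> x) \<in> L2 (lebesgue_on \<Omega>)"
  using is_weak_gradient_lincomb[OF op bd assms(1) test_L2(1)[OF op bd assms(4)] assms(2)
      test_L2(3)[OF op bd assms(4)] assms(3) is_weak_gradient_test[OF op bd assms(4)], of 1 "-1"]
    L2_diff[OF assms(2) test_L2(3)[OF op bd assms(4)]]
  by simp_all

lemma W012_approx_W012:
  assumes "W012_approx \<Omega> u G"
  shows "u \<in> W012 \<Omega>"
proof -
  note wg = W012_approx_weak_gradient[OF assms]
  from assms obtain \<phi> where u: "u \<in> L2 (lebesgue_on \<Omega>)" and G: "G \<in> L2 (lebesgue_on \<Omega>)"
    and \<phi>: "\<And>n::nat. \<phi> n \<in> test_functions \<Omega>"
    and lim: "(\<lambda>n. L2_norm (lebesgue_on \<Omega>) (\<lambda>x. u x - \<phi> n x)) \<longlonglongrightarrow> 0"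
      "(\<lambda>n. L2_norm (lebesgue_on \<Omega>) (\<lambda>x. G x - grad (\<phi> n) x)) \<longlonglongrightarrow> 0"
    unfolding W012_approx_def by blast
  have n: "W12_norm \<Omega> (u - \<phi> n) = sqrt ((L2_norm (lebesgue_on \<Omega>) (\<lambda>x. u x - \<phi> n x))\<^sup>2
      + (L2_norm (lebesgue_on \<Omega>) (\<lambda>x. G x - grad (\<phi> n) x))\<^sup>2)" for n
    using wg_props(4) is_weak_gradient_diff_test[OF u G wg \<phi>[of n]] by (simp add: fun_diff_def)
  have "(\<lambda>n. W12_norm \<Omega> (u - \<phi> n)) \<longlonglongrightarrow> sqrt (0\<^sup>2 + 0\<^sup>2)"
    unfolding n by (intro tendsto_real_sqrt tendsto_add tendsto_power lim)
  then have "(\<lambda>n. W12_norm \<Omega> (u - \<phi> n)) \<longlonglongrightarrow> 0" by simp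
  then have "\<exists>\<phi>\<in>test_functions \<Omega>. W12_norm \<Omega> (u - \<phi>) < \<epsilon>" if \<epsilon>: "\<epsilon> > 0" for \<epsilon>
  proof -
    obtain N where "\<And>n. n \<ge> N \<Longrightarrow> W12_norm \<Omega> (u - \<phi> n) < \<epsilon>"
      using order_tendstoD(2)[OF \<open>(\<lambda>n. W12_norm \<Omega> (u - \<phi> n)) \<longlonglongrightarrow> 0\<close> \<epsilon>]
      unfolding eventually_sequentially by blast
    then show ?thesis using \<phi>[of N] by blast
  qed
  moreover have "u \<in> W12 \<Omega>" using u G wg by (auto simp: W12_def)
  ultimately show ?thesis by (auto simp: W012_def)
qed

lemma W012_W012_approx:
  assumes "u \<in> W012 \<Omega>"
  shows "W012_approx \<Omega> u (weak_grad \<Omega> u)"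
proof -
  have u12: "u \<in> W12 \<Omega>" using assms by (simp add: W012_def)
  note u = W12_weak_grad[OF op bd u12]
  have "\<exists>\<phi>\<in>test_functions \<Omega>. W12_norm \<Omega> (u - \<phi>) < inverse (real (Suc n))" for n
    using assms by (simp add: W012_def)
  then obtain \<phi> where \<phi>: "\<And>n. \<phi> n \<in> test_functions \<Omega>" "\<And>n. W12_norm \<Omega> (u - \<phi> n) < inverse (real (Suc n))"
    by metis
  have n: "W12_norm \<Omega> (u - \<phi> n) = sqrt ((L2_norm (lebesgue_on \<Omega>) (\<lambda>x. u x - \<phi> n x))\<^sup>2
      + (L2_norm (lebesgue_on \<Omega>) (\<lambda>x. weak_grad \<Omega> u x - grad (\<phi> n) x))\<^sup>2)" for n
    using wg_props(4) is_weak_gradient_diff_test[OF u \<phi>(1)[of n]] by (simp add: fun_diff_def)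
  have "\<bar>L2_norm (lebesgue_on \<Omega>) (\<lambda>x. u x - \<phi> n x)\<bar> \<le> W12_norm \<Omega> (u - \<phi> n)"
    "\<bar>L2_norm (lebesgue_on \<Omega>) (\<lambda>x. weak_grad \<Omega> u x - grad (\<phi> n) x)\<bar> \<le> W12_norm \<Omega> (u - \<phi> n)" for n
    unfolding n by (rule real_sqrt_sum_squares_ge1 real_sqrt_sum_squares_ge2 real_le_rsqrt; simp)+
  then have "norm (L2_norm (lebesgue_on \<Omega>) (\<lambda>x. u x - \<phi> n x)) \<le> inverse (real (Suc n))"
    "norm (L2_norm (lebesgue_on \<Omega>) (\<lambda>x. weak_grad \<Omega> u x - grad (\<phi> n) x)) \<le> inverse (real (Suc n))" for n
    using \<phi>(2)[of n] unfolding real_norm_def by (meson order_trans less_imp_le)+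
  then have "(\<lambda>n. L2_norm (lebesgue_on \<Omega>) (\<lambda>x. u x - \<phi> n x)) \<longlonglongrightarrow> 0"
    "(\<lambda>n. L2_norm (lebesgue_on \<Omega>) (\<lambda>x. weak_grad \<Omega> u x - grad (\<phi> n) x)) \<longlonglongrightarrow> 0"
    by (auto intro!: Lim_null_comparison[OF always_eventually LIMSEQ_inverse_real_of_nat])
  with u \<phi>(1) show ?thesis unfolding W012_approx_def by blast
qed

lemma W012_approx_weak_grad:
  assumes "W012_approx \<Omega> u G"
  shows "AE x in lebesgue_on \<Omega>. weak_grad \<Omega> u x = G x" "weak_grad \<Omega> u \<in> L2 (lebesgue_on \<Omega>)"
    "W12_norm \<Omega> u = sqrt ((L2_norm (lebesgue_on \<Omega>) u)\<^sup>2 + (L2_norm (lebesgue_on \<Omega>) G)\<^sup>2)"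
  using wg_props[OF _ W012_approx_weak_gradient[OF assms]] assms by (auto simp: W012_approx_def)

lemma W012_approx_lincomb:
  assumes "W012_approx \<Omega> u G" "W012_approx \<Omega> w H"
  shows "W012_approx \<Omega> (\<lambda>x. r * u x + s * w x) (\<lambda>x. r *\<^sub>R G x + s *\<^sub>R H x)"
proof -
  from assms(1) obtain \<phi> where u: "u \<in> L2 (lebesgue_on \<Omega>)" and G: "G \<in> L2 (lebesgue_on \<Omega>)"
    and \<phi>: "\<And>n::nat. \<phi> n \<in> test_functions \<Omega>"
    and lim: "(\<lambda>n. L2_norm (lebesgue_on \<Omega>) (\<lambda>x. u x - \<phi> n x)) \<longlonglongrightarrow> 0"
      "(\<lambda>n. L2_norm (lebesgue_on \<Omega>) (\<lambda>x. G x - grad (\<phi> n) x)) \<longlonglongrightarrow> 0"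
    unfolding W012_approx_def by blast
  from assms(2) obtain \<psi> where w: "w \<in> L2 (lebesgue_on \<Omega>)" and H: "H \<in> L2 (lebesgue_on \<Omega>)"
    and \<psi>: "\<And>n::nat. \<psi> n \<in> test_functions \<Omega>"
    and lim': "(\<lambda>n. L2_norm (lebesgue_on \<Omega>) (\<lambda>x. w x - \<psi> n x)) \<longlonglongrightarrow> 0"
      "(\<lambda>n. L2_norm (lebesgue_on \<Omega>) (\<lambda>x. H x - grad (\<psi> n) x)) \<longlonglongrightarrow> 0"
    unfolding W012_approx_def by blast
  have key: "(\<lambda>n. L2_norm (lebesgue_on \<Omega>) (\<lambda>x. r *\<^sub>R f n x + s *\<^sub>R g n x)) \<longlonglongrightarrow> 0"
    if "\<And>n. f n \<in> L2 (lebesgue_on \<Omega>)" "\<And>n. g n \<in> L2 (lebesgue_on \<Omega>)"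
      "(\<lambda>n. L2_norm (lebesgue_on \<Omega>) (f n)) \<longlonglongrightarrow> 0" "(\<lambda>n. L2_norm (lebesgue_on \<Omega>) (g n)) \<longlonglongrightarrow> 0"
    for f g :: "nat \<Rightarrow> 'a \<Rightarrow> 'b::euclidean_space"
  proof (rule L2_norm_bound_tendsto_0)
    show "(\<lambda>x. r *\<^sub>R f n x + s *\<^sub>R g n x) \<in> borel_measurable (lebesgue_on \<Omega>)" for n
      by (intro L2_measurable L2_lincomb that)
    show "integrable (lebesgue_on \<Omega>) (\<lambda>x. 2 * r\<^sup>2 * (norm (f n x))\<^sup>2 + 2 * s\<^sup>2 * (norm (g n x))\<^sup>2)" for n
      using L2_integrable_sq[OF that(1)[of n]] L2_integrable_sq[OF that(2)[of n]] by simp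
    have "(norm (r *\<^sub>R f n x + s *\<^sub>R g n x))\<^sup>2 \<le> 2 * r\<^sup>2 * (norm (f n x))\<^sup>2 + 2 * s\<^sup>2 * (norm (g n x))\<^sup>2" for n x
      using norm_add_sq_le[of "r *\<^sub>R f n x" "s *\<^sub>R g n x"] by (simp add: power_mult_distrib)
    then show "AE x in lebesgue_on \<Omega>. (norm (r *\<^sub>R f n x + s *\<^sub>R g n x))\<^sup>2 \<le> 2 * r\<^sup>2 * (norm (f n x))\<^sup>2 + 2 * s\<^sup>2 * (norm (g n x))\<^sup>2" for n
      by simp
    have "(\<lambda>n. 2 * r\<^sup>2 * (L2_norm (lebesgue_on \<Omega>) (f n))\<^sup>2 + 2 * s\<^sup>2 * (L2_norm (lebesgue_on \<Omega>) (g n))\<^sup>2) \<longlonglongrightarrow> 2 * r\<^sup>2 * 0\<^sup>2 + 2 * s\<^sup>2 * 0\<^sup>2"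
      by (intro tendsto_intros that)
    then show "(\<lambda>n. LINT x|lebesgue_on \<Omega>. 2 * r\<^sup>2 * (norm (f n x))\<^sup>2 + 2 * s\<^sup>2 * (norm (g n x))\<^sup>2) \<longlonglongrightarrow> 0"
      using L2_integrable_sq[OF that(1)] L2_integrable_sq[OF that(2)] by (simp add: L2_norm_sq)
  qed
  note t = test_L2[OF op bd \<phi>] test_L2[OF op bd \<psi>]
  have gr: "grad (\<lambda>x. r * \<phi> n x + s * \<psi> n x) x = r *\<^sub>R grad (\<phi> n) x + s *\<^sub>R grad (\<psi> n) x" for n x
  proof -
    have "partial_deriv b (\<lambda>x. r * \<phi> n x + s * \<psi> n x) x = r * partial_deriv b (\<phi> n) x + s * partial_deriv b (\<psi> n) x" for b
    proof -
      have "(\<phi> n has_derivative frechet_derivative (\<phi> n) (at x)) (at x)"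
        "(\<psi> n has_derivative frechet_derivative (\<psi> n) (at x)) (at x)"
        using test_functionsD(4)[OF \<phi>] test_functionsD(4)[OF \<psi>] frechet_derivative_works by blast+
      then have "((\<lambda>x. r * \<phi> n x + s * \<psi> n x) has_derivative
          (\<lambda>h. r * frechet_derivative (\<phi> n) (at x) h + s * frechet_derivative (\<psi> n) (at x) h)) (at x)"
        by (auto intro!: derivative_eq_intros)
      from partial_deriv_eqI[OF this] show ?thesis by (simp add: partial_deriv_def)
    qed
    then show ?thesis by (simp add: grad_def scaleR_sum_right scaleR_add_left sum.distrib)
  qed
  have "(\<lambda>n. L2_norm (lebesgue_on \<Omega>) (\<lambda>x. r *\<^sub>R (u x - \<phi> n x) + s *\<^sub>R (w x - \<psi> n x))) \<longlonglongrightarrow> 0"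
    by (rule key[OF _ _ lim(1) lim'(1)]) (intro L2_diff u w t)+
  moreover have "(\<lambda>n. L2_norm (lebesgue_on \<Omega>) (\<lambda>x. r *\<^sub>R (G x - grad (\<phi> n) x) + s *\<^sub>R (H x - grad (\<psi> n) x))) \<longlonglongrightarrow> 0"
    by (rule key[OF _ _ lim(2) lim'(2)]) (intro L2_diff G H t)+
  moreover have "(\<lambda>x. r * \<phi> n x + s * \<psi> n x) \<in> test_functions \<Omega>" for n
    by (intro test_functions_add test_functions_scale \<phi> \<psi>)
  ultimately show ?thesis
    unfolding W012_approx_def using L2_lincomb[OF u w, of r s] L2_lincomb[OF G H, of r s]
    by (intro conjI exI[of _ "\<lambda>n x. r * \<phi> n x + s * \<psi> n x"]) (simp_all add: gr algebra_simps)
qed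

text \<open>A chain rule that stays inside the approximation scheme: composing the approximating
  test functions with \<open>gexp 0\<close> gives test functions again. Their gradients converge
  because the outer derivative is bounded and continuous, provided the inner functions converge
  almost everywhere.\<close>

lemma W012_approx_gexp:
  assumes "W012_approx \<Omega> u G"
  shows "W012_approx \<Omega> (\<lambda>x. gexp 0 (r * u x)) (\<lambda>x. (r * gexp 2 (r * u x)) *\<^sub>R G x)"
proof -
  let ?M = "lebesgue_on \<Omega>"
  from assms(1) obtain \<phi>0 where u: "u \<in> L2 ?M" and G: "G \<in> L2 ?M"
    and \<phi>0: "\<And>n::nat. \<phi>0 n \<in> test_functions \<Omega>"
    and lim0: "(\<lambda>n. L2_norm ?M (\<lambda>x. u x - \<phi>0 n x)) \<longlonglongrightarrow> 0"
      "(\<lambda>n. L2_norm ?M (\<lambda>x. G x - grad (\<phi>0 n) x)) \<longlonglongrightarrow> 0"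
    unfolding W012_approx_def by blast
  \<comment> \<open>Convergence in L^2 provides almost everywhere convergence only along a
    subsequence, so the approximating sequence is thinned out first.\<close>
  have "\<exists>k. strict_mono k \<and> (AE x in ?M. (\<lambda>n. (norm (u x - \<phi>0 (k n) x))\<^sup>2) \<longlonglongrightarrow> 0)"
  proof -
    have "integrable ?M (\<lambda>x. (norm (u x - \<phi>0 n x))\<^sup>2)" for n
      by (intro L2_integrable_sq L2_diff u test_L2(1)[OF op bd \<phi>0])
    then show ?thesis
      using lim0(1)[unfolded L2_norm_tendsto_0_iff]
        tendsto_L1_AE_subseq[of ?M "\<lambda>n x. (norm (u x - \<phi>0 n x))\<^sup>2"] by auto
  qed
  then obtain k where k: "strict_mono k" "AE x in ?M. (\<lambda>n. (norm (u x - \<phi>0 (k n) x))\<^sup>2) \<longlonglongrightarrow> 0" by auto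
  define \<phi> where "\<phi> n = \<phi>0 (k n)" for n
  have \<phi>: "\<phi> n \<in> test_functions \<Omega>" for n unfolding \<phi>_def by (rule \<phi>0)
  have lim: "(\<lambda>n. L2_norm ?M (\<lambda>x. u x - \<phi> n x)) \<longlonglongrightarrow> 0"
      "(\<lambda>n. L2_norm ?M (\<lambda>x. G x - grad (\<phi> n) x)) \<longlonglongrightarrow> 0"
    using lim0[THEN LIMSEQ_subseq_LIMSEQ[OF _ k(1)]] by (simp_all add: \<phi>_def comp_def)
  have ae: "AE x in ?M. (\<lambda>n. \<phi> n x) \<longlonglongrightarrow> u x"
    using k(2)
  proof eventually_elim
    case (elim x)
    from tendsto_real_sqrt[OF elim] have "(\<lambda>n. \<bar>u x - \<phi> n x\<bar>) \<longlonglongrightarrow> 0" by (simp add: \<phi>_def)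
    then have "(\<lambda>n. u x - \<phi> n x) \<longlonglongrightarrow> 0" by (simp add: tendsto_rabs_zero_iff)
    from tendsto_diff[OF tendsto_const[of "u x"] this] show ?case by simp
  qed
  have [measurable]: "u \<in> borel_measurable ?M" "G \<in> borel_measurable ?M"
    "\<And>n. \<phi> n \<in> borel_measurable ?M" "\<And>n. grad (\<phi> n) \<in> borel_measurable ?M"
    using u G test_L2(1,3)[OF op bd \<phi>] by (auto intro: L2_measurable)
  \<comment> \<open>F is the derivative of the outer function s -> \<open>gexp 0 (r * s)\<close>;
    its bound 2 |r| comes from \<open>gexp_2_le\<close>.\<close>
  define F where "F s = r * gexp 2 (r * s)" for s
  have Fb: "(F s)\<^sup>2 \<le> (2 * r)\<^sup>2" for s
  proof -
    have "(gexp 2 (r * s))\<^sup>2 \<le> 2\<^sup>2" by (intro power_mono gexp_2_le gexp_nonneg)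
    then have "r\<^sup>2 * (gexp 2 (r * s))\<^sup>2 \<le> r\<^sup>2 * 2\<^sup>2" by (intro mult_left_mono) auto
    then show ?thesis by (simp add: F_def power_mult_distrib mult.commute)
  qed
  have [measurable]: "F \<in> borel_measurable borel" unfolding F_def[abs_def] by measurable
  have "(\<lambda>n. L2_norm ?M (\<lambda>x. gexp 0 (r * u x) - gexp 0 (r * \<phi> n x))) \<longlonglongrightarrow> 0"
  proof (rule L2_norm_bound_tendsto_0[where g="\<lambda>n x. (2 * r)\<^sup>2 * (norm (u x - \<phi> n x))\<^sup>2"])
    show "integrable ?M (\<lambda>x. (2 * r)\<^sup>2 * (norm (u x - \<phi> n x))\<^sup>2)" for n
      by (intro integrable_mult_right L2_integrable_sq L2_diff u test_L2(1)[OF op bd \<phi>])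
    have "(norm (gexp 0 (r * u x) - gexp 0 (r * \<phi> n x)))\<^sup>2 \<le> (2 * r)\<^sup>2 * (norm (u x - \<phi> n x))\<^sup>2" for n x
    proof -
      have "\<bar>gexp 0 (r * u x) - gexp 0 (r * \<phi> n x)\<bar> \<le> 2 * \<bar>r * (u x - \<phi> n x)\<bar>"
        using gexp_0_lipschitz[of "r * u x" "r * \<phi> n x"] by (simp add: algebra_simps)
      from power_mono[OF this, of 2] show ?thesis by (simp add: power_mult_distrib)
    qed
    then show "AE x in ?M. (norm (gexp 0 (r * u x) - gexp 0 (r * \<phi> n x)))\<^sup>2 \<le> (2 * r)\<^sup>2 * (norm (u x - \<phi> n x))\<^sup>2" for n
      by simp
    show "(\<lambda>n. LINT x|?M. (2 * r)\<^sup>2 * (norm (u x - \<phi> n x))\<^sup>2) \<longlonglongrightarrow> 0"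
      using tendsto_mult_right_zero[OF lim(1)[unfolded L2_norm_tendsto_0_iff], of "(2 * r)\<^sup>2"] by simp
  qed measurable
  moreover have "(\<lambda>n. L2_norm ?M (\<lambda>x. F (u x) *\<^sub>R G x - F (\<phi> n x) *\<^sub>R grad (\<phi> n) x)) \<longlonglongrightarrow> 0"
  proof (rule L2_norm_bound_tendsto_0[where g="\<lambda>n x. 2 * ((F (u x) - F (\<phi> n x))\<^sup>2 * (norm (G x))\<^sup>2)
        + 2 * (2 * r)\<^sup>2 * (norm (G x - grad (\<phi> n) x))\<^sup>2"])
    have bnd: "(F (u x) - F (\<phi> n x))\<^sup>2 * (norm (G x))\<^sup>2 \<le> 4 * (2 * r)\<^sup>2 * (norm (G x))\<^sup>2" for n x
    proof (rule mult_right_mono)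
      have "(F (u x) - F (\<phi> n x))\<^sup>2 \<le> 2 * (F (u x))\<^sup>2 + 2 * (F (\<phi> n x))\<^sup>2"
        using norm_add_sq_le[of "F (u x)" "- F (\<phi> n x)"] by simp
      then show "(F (u x) - F (\<phi> n x))\<^sup>2 \<le> 4 * (2 * r)\<^sup>2" using Fb[of "u x"] Fb[of "\<phi> n x"] by linarith
    qed simp
    have i1: "integrable ?M (\<lambda>x. 4 * (2 * r)\<^sup>2 * (norm (G x))\<^sup>2)"
      by (intro integrable_mult_right L2_integrable_sq G)
    have i2: "integrable ?M (\<lambda>x. (F (u x) - F (\<phi> n x))\<^sup>2 * (norm (G x))\<^sup>2)" for n
      by (rule Bochner_Integration.integrable_bound[OF i1]) (use bnd in \<open>auto simp: abs_mult\<close>)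
    have i3: "integrable ?M (\<lambda>x. (norm (G x - grad (\<phi> n) x))\<^sup>2)" for n
      by (intro L2_integrable_sq L2_diff G test_L2(3)[OF op bd \<phi>])
    show "integrable ?M (\<lambda>x. 2 * ((F (u x) - F (\<phi> n x))\<^sup>2 * (norm (G x))\<^sup>2)
        + 2 * (2 * r)\<^sup>2 * (norm (G x - grad (\<phi> n) x))\<^sup>2)" for n
      by (intro Bochner_Integration.integrable_add integrable_mult_right i2 i3)
    have "(norm (F (u x) *\<^sub>R G x - F (\<phi> n x) *\<^sub>R grad (\<phi> n) x))\<^sup>2
        \<le> 2 * ((F (u x) - F (\<phi> n x))\<^sup>2 * (norm (G x))\<^sup>2) + 2 * (2 * r)\<^sup>2 * (norm (G x - grad (\<phi> n) x))\<^sup>2" for n x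
    proof -
      \<comment> \<open>The first summand keeps the fixed gradient G and is handled by dominated
        convergence; the second has a bounded factor and a factor tending to 0 in L^2.\<close>
      have e: "F (u x) *\<^sub>R G x - F (\<phi> n x) *\<^sub>R grad (\<phi> n) x
          = (F (u x) - F (\<phi> n x)) *\<^sub>R G x + F (\<phi> n x) *\<^sub>R (G x - grad (\<phi> n) x)"
        by (simp add: algebra_simps)
      have "(norm (F (u x) *\<^sub>R G x - F (\<phi> n x) *\<^sub>R grad (\<phi> n) x))\<^sup>2
          \<le> 2 * ((F (u x) - F (\<phi> n x))\<^sup>2 * (norm (G x))\<^sup>2) + 2 * ((F (\<phi> n x))\<^sup>2 * (norm (G x - grad (\<phi> n) x))\<^sup>2)"
        unfolding e using norm_add_sq_le[of "(F (u x) - F (\<phi> n x)) *\<^sub>R G x" "F (\<phi> n x) *\<^sub>R (G x - grad (\<phi> n) x)"]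
        by (simp only: norm_scaleR power_mult_distrib power2_abs)
      also have "(F (\<phi> n x))\<^sup>2 * (norm (G x - grad (\<phi> n) x))\<^sup>2 \<le> (2 * r)\<^sup>2 * (norm (G x - grad (\<phi> n) x))\<^sup>2"
        by (intro mult_right_mono Fb) simp
      finally show ?thesis by simp
    qed
    then show "AE x in ?M. (norm (F (u x) *\<^sub>R G x - F (\<phi> n x) *\<^sub>R grad (\<phi> n) x))\<^sup>2
        \<le> 2 * ((F (u x) - F (\<phi> n x))\<^sup>2 * (norm (G x))\<^sup>2) + 2 * (2 * r)\<^sup>2 * (norm (G x - grad (\<phi> n) x))\<^sup>2" for n
      by simp
    have Fc: "isCont F s" for s
      using continuous_on_gexp[of UNIV 2] unfolding F_def[abs_def]
      by (auto intro!: continuous_intros isCont_o2[of s _ "gexp 2"] simp: continuous_on_eq_continuous_at)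
    have "(\<lambda>n. LINT x|?M. (F (u x) - F (\<phi> n x))\<^sup>2 * (norm (G x))\<^sup>2) \<longlonglongrightarrow> (LINT x|?M. 0)"
    proof (rule integral_dominated_convergence[OF _ _ i1])
      show "AE x in ?M. (\<lambda>n. (F (u x) - F (\<phi> n x))\<^sup>2 * (norm (G x))\<^sup>2) \<longlonglongrightarrow> 0"
        using ae
      proof eventually_elim
        case (elim x)
        have "(\<lambda>n. (F (u x) - F (\<phi> n x))\<^sup>2 * (norm (G x))\<^sup>2) \<longlonglongrightarrow> (F (u x) - F (u x))\<^sup>2 * (norm (G x))\<^sup>2"
          by (intro tendsto_intros isCont_tendsto_compose[OF Fc] elim)
        then show ?case by simp
      qed
      show "AE x in ?M. norm ((F (u x) - F (\<phi> n x))\<^sup>2 * (norm (G x))\<^sup>2) \<le> 4 * (2 * r)\<^sup>2 * (norm (G x))\<^sup>2" for n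
        using bnd by (simp add: abs_mult)
    qed measurable
    then have "(\<lambda>n. 2 * (LINT x|?M. (F (u x) - F (\<phi> n x))\<^sup>2 * (norm (G x))\<^sup>2)
        + 2 * (2 * r)\<^sup>2 * (LINT x|?M. (norm (G x - grad (\<phi> n) x))\<^sup>2)) \<longlonglongrightarrow> 2 * 0 + 2 * (2 * r)\<^sup>2 * 0"
      using lim(2)[unfolded L2_norm_tendsto_0_iff] by (intro tendsto_intros) simp_all
    then show "(\<lambda>n. LINT x|?M. 2 * ((F (u x) - F (\<phi> n x))\<^sup>2 * (norm (G x))\<^sup>2)
        + 2 * (2 * r)\<^sup>2 * (norm (G x - grad (\<phi> n) x))\<^sup>2) \<longlonglongrightarrow> 0"
      using i2 i3 by (simp add: Bochner_Integration.integral_add)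
  qed measurable
  moreover have "(\<lambda>x. gexp 0 (r * u x)) \<in> L2 ?M"
    by (rule bounded_L2[OF op bd, where C=1]) (use gexp_le_1 gexp_nonneg in \<open>auto simp: abs_of_nonneg\<close>)
  moreover have "(\<lambda>x. F (u x) *\<^sub>R G x) \<in> L2 ?M"
  proof (rule L2_bound)
    show "integrable ?M (\<lambda>x. (2 * r)\<^sup>2 * (norm (G x))\<^sup>2)"
      by (intro integrable_mult_right L2_integrable_sq G)
    show "AE x in ?M. (norm (F (u x) *\<^sub>R G x))\<^sup>2 \<le> (2 * r)\<^sup>2 * (norm (G x))\<^sup>2"
      using Fb by (auto simp: power_mult_distrib intro!: mult_right_mono)
  qed measurable
  ultimately show ?thesis
    unfolding W012_approx_def F_def using test_functions_gexp[OF \<phi>] grad_gexp[OF \<phi>]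
    by (intro conjI exI[of _ "\<lambda>n x. gexp 0 (r * \<phi> n x)"]) auto
qed

end

section \<open>Cut-off functions in time\<close>

text \<open>A Lebesgue set is a Borel set plus a subset of a null set N'. The preimage of N' under
  the projection is a cylinder over N', again a null set, so the decomposition survives in the
  completed product.\<close>

lemma measurable_snd_lebesgue:
  "(snd :: 'a::euclidean_space \<times> 'b::euclidean_space \<Rightarrow> 'b) \<in> lebesgue \<rightarrow>\<^sub>M lebesgue"
proof (rule measurableI)
  fix A :: "'b set" assume "A \<in> sets lebesgue"
  then obtain S N N' where A: "A = S \<union> N" "N \<subseteq> N'" "N' \<in> null_sets lborel" "S \<in> sets lborel"
    by (rule sets_completionE) 
  have e: "snd -` A \<inter> space lebesgue = UNIV \<times> S \<union> UNIV \<times> N"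
    by (auto simp: A(1))
  have "emeasure (lborel \<Otimes>\<^sub>M lborel) ((UNIV :: 'a set) \<times> N') = emeasure lborel (UNIV :: 'a set) * emeasure lborel N'"
    using A(3) by (intro lborel.emeasure_pair_measure_Times) auto
  also have "\<dots> = 0" using A(3) by (simp add: null_sets_def)
  finally have "(UNIV :: 'a set) \<times> N' \<in> null_sets (lborel \<Otimes>\<^sub>M lborel)"
    using A(3) by (auto simp: null_sets_def)
  then have "(UNIV :: 'a set) \<times> N' \<in> null_sets lborel" by (simp add: lborel_prod)
  moreover have "(UNIV :: 'a set) \<times> S \<in> sets lborel"
    using A(4) by (simp add: borel_Times)
  ultimately show "(snd :: 'a \<times> 'b \<Rightarrow> 'b) -` A \<inter> space lebesgue \<in> sets lebesgue"
    unfolding e using A(2) by (intro sets_completionI[of _ "UNIV \<times> S" "UNIV \<times> N" "UNIV \<times> N'"]) auto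
qed simp

lemma measurable_fst_lebesgue:
  "(fst :: 'a::euclidean_space \<times> 'b::euclidean_space \<Rightarrow> 'a) \<in> lebesgue \<rightarrow>\<^sub>M lebesgue"
proof (rule measurableI)
  fix A :: "'a set" assume "A \<in> sets lebesgue"
  then obtain S N N' where A: "A = S \<union> N" "N \<subseteq> N'" "N' \<in> null_sets lborel" "S \<in> sets lborel"
    by (rule sets_completionE) 
  have e: "fst -` A \<inter> space lebesgue = S \<times> UNIV \<union> N \<times> UNIV"
    by (auto simp: A(1))
  have "emeasure (lborel \<Otimes>\<^sub>M lborel) (N' \<times> (UNIV :: 'b set)) = emeasure lborel N' * emeasure lborel (UNIV :: 'b set)"
    using A(3) by (intro lborel.emeasure_pair_measure_Times) auto
  also have "\<dots> = 0" using A(3) by (simp add: null_sets_def)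
  finally have "N' \<times> (UNIV :: 'b set) \<in> null_sets (lborel \<Otimes>\<^sub>M lborel)"
    using A(3) by (auto simp: null_sets_def)
  then have "N' \<times> (UNIV :: 'b set) \<in> null_sets lborel" by (simp add: lborel_prod)
  moreover have "S \<times> (UNIV :: 'b set) \<in> sets lborel"
    using A(4) by (simp add: borel_Times)
  ultimately show "(fst :: 'a \<times> 'b \<Rightarrow> 'a) -` A \<inter> space lebesgue \<in> sets lebesgue"
    unfolding e using A(2) by (intro sets_completionI[of _ "S \<times> UNIV" "N \<times> UNIV" "N' \<times> UNIV"]) auto
qed simp

lemma lebesgue_on_measurable_AE:
  fixes f g :: "'a::euclidean_space \<Rightarrow> 'b::euclidean_space"
  assumes "f \<in> borel_measurable (lebesgue_on S)" "AE x in lebesgue_on S. f x = g x" "S \<in> sets lebesgue"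
  shows "g \<in> borel_measurable (lebesgue_on S)"
proof -
  have "(\<lambda>x. indicator S x *\<^sub>R f x) \<in> borel_measurable lebesgue"
    using assms(1,3) by (subst (asm) borel_measurable_restrict_space_iff) auto
  moreover have "AE x in lebesgue. indicator S x *\<^sub>R f x = indicator S x *\<^sub>R g x"
    using assms(2,3) by (subst (asm) AE_restrict_space_iff) (auto elim!: eventually_mono simp: indicator_def)
  ultimately have "(\<lambda>x. indicator S x *\<^sub>R g x) \<in> borel_measurable lebesgue"
    by (rule borel_measurable_AE)
  then show ?thesis using assms(3) by (subst borel_measurable_restrict_space_iff) auto
qed

text \<open>The nonnegative functions \<open>g' n\<close> act as an approximate identity at the left
  end: their total mass \<open>g n c\<close> tends to 1, and since \<open>g n t\<close> tends to 1
  for every t > a, the mass concentrates at a.\<close>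

lemma tendsto_integral_deriv_left:
  fixes g g' :: "nat \<Rightarrow> real \<Rightarrow> real"
  assumes "a < c" "\<And>n t. (g n has_real_derivative g' n t) (at t)" "\<And>n. continuous_on UNIV (g' n)"
    "\<And>n t. a \<le> t \<Longrightarrow> t \<le> c \<Longrightarrow> g' n t \<ge> 0" "\<And>n. g n a = 0" "\<And>n t. g n t \<le> 1"
    "\<And>t. a < t \<Longrightarrow> t \<le> c \<Longrightarrow> (\<lambda>n. g n t) \<longlonglongrightarrow> 1" "continuous_on {a..c} m"
  shows "(\<lambda>n. integral {a..c} (\<lambda>t. g' n t * m t)) \<longlonglongrightarrow> m a"
proof -
  have FTC: "(g' n has_integral (g n y - g n x)) {x..y}" if "x \<le> y" for n x y
    using that assms(2) by (intro fundamental_theorem_of_calculus)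
      (auto simp: has_real_derivative_iff_has_vector_derivative[symmetric] intro: has_field_derivative_at_within)
  have "bounded (m ` {a..c})" by (intro compact_imp_bounded compact_continuous_image assms) simp
  then obtain B where B: "B > 0" "\<And>t. t \<in> {a..c} \<Longrightarrow> \<bar>m t\<bar> \<le> B" unfolding bounded_pos by auto
  have cont: "continuous_on {x..y} (\<lambda>t. g' n t * (m t - m a))" if "a \<le> x" "y \<le> c" for n x y
    using that by (intro continuous_intros continuous_on_subset[OF assms(3)] continuous_on_subset[OF assms(8)]) auto
  have "(\<lambda>n. integral {a..c} (\<lambda>t. g' n t * (m t - m a))) \<longlonglongrightarrow> 0"
  proof (rule LIMSEQ_I)
    fix e :: real assume e: "e > 0"
    obtain d where d: "d > 0" "\<And>t. t \<in> {a..c} \<Longrightarrow> \<bar>t - a\<bar> < d \<Longrightarrow> \<bar>m t - m a\<bar> < e / 2"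
      using assms(8)[unfolded continuous_on_iff, rule_format, of a "e / 2"] e assms(1)
      by (auto simp: dist_real_def)
    \<comment> \<open>On [a, p] the function m varies by at most e/2. The mass to the right of p is
      the difference of two quantities that both tend to 1.\<close>
    define p where "p = min c (a + d / 2)"
    have p: "a < p" "p \<le> c" "\<And>t. t \<in> {a..p} \<Longrightarrow> \<bar>m t - m a\<bar> \<le> e / 2"
      using d assms(1) by (auto simp: p_def less_imp_le)
    have "(\<lambda>n. 2 * B * (g n c - g n p)) \<longlonglongrightarrow> 2 * B * (1 - 1)"
      using assms(1) p by (intro tendsto_intros assms) auto
    then have "eventually (\<lambda>n. 2 * B * (g n c - g n p) < e / 2) sequentially"
      using e by (intro order_tendstoD(2)) auto
    then obtain N where N: "\<And>n. n \<ge> N \<Longrightarrow> 2 * B * (g n c - g n p) < e / 2"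
      unfolding eventually_sequentially by blast
    have "norm (integral {a..c} (\<lambda>t. g' n t * (m t - m a)) - 0) < e" if "n \<ge> N" for n
    proof -
      have "integral {a..c} (\<lambda>t. g' n t * (m t - m a)) = integral {a..p} (\<lambda>t. g' n t * (m t - m a))
          + integral {p..c} (\<lambda>t. g' n t * (m t - m a))"
        using p cont[of a c n] by (intro Henstock_Kurzweil_Integration.integral_combine[symmetric] integrable_continuous_real) auto
      moreover have "norm (integral {a..p} (\<lambda>t. g' n t * (m t - m a))) \<le> integral {a..p} (\<lambda>t. e / 2 * g' n t)"
      proof (rule Henstock_Kurzweil_Integration.integral_norm_bound_integral)
        show "(\<lambda>t. g' n t * (m t - m a)) integrable_on {a..p}"
          using p cont[of a p n] by (intro integrable_continuous_real) auto
        show "(\<lambda>t. e / 2 * g' n t) integrable_on {a..p}"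
          by (intro integrable_continuous_real continuous_intros continuous_on_subset[OF assms(3)]) auto
        show "norm (g' n t * (m t - m a)) \<le> e / 2 * g' n t" if "t \<in> {a..p}" for t
        proof -
          have "g' n t \<ge> 0" using that p by (intro assms(4)) auto
          then show ?thesis using mult_right_mono[OF p(3)[OF that], of "g' n t"] by (simp add: abs_mult mult.commute)
        qed
      qed
      moreover have "integral {a..p} (\<lambda>t. e / 2 * g' n t) = e / 2 * g n p"
        using FTC[of a p n] p assms(5) by (simp add: integral_unique)
      moreover have "norm (integral {p..c} (\<lambda>t. g' n t * (m t - m a))) \<le> integral {p..c} (\<lambda>t. 2 * B * g' n t)"
      proof (rule Henstock_Kurzweil_Integration.integral_norm_bound_integral)
        show "(\<lambda>t. g' n t * (m t - m a)) integrable_on {p..c}"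
          using p cont[of p c n] by (intro integrable_continuous_real) auto
        show "(\<lambda>t. 2 * B * g' n t) integrable_on {p..c}"
          by (intro integrable_continuous_real continuous_intros continuous_on_subset[OF assms(3)]) auto
        show "norm (g' n t * (m t - m a)) \<le> 2 * B * g' n t" if "t \<in> {p..c}" for t
        proof -
          have "g' n t \<ge> 0" using that p by (intro assms(4)) auto
          moreover have "\<bar>m t - m a\<bar> \<le> 2 * B" using B(2)[of t] B(2)[of a] that p assms(1) by auto
          ultimately show ?thesis using mult_right_mono[of "\<bar>m t - m a\<bar>" "2 * B" "g' n t"]
            by (simp add: abs_mult mult.commute)
        qed
      qed
      moreover have "integral {p..c} (\<lambda>t. 2 * B * g' n t) = 2 * B * (g n c - g n p)"
        using FTC[of p c n] p by (simp add: integral_unique)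
      moreover have "e / 2 * g n p \<le> e / 2" using assms(6)[of n p] e by simp
      ultimately show ?thesis using N[OF that] unfolding real_norm_def by linarith
    qed
    then show "\<exists>no. \<forall>n\<ge>no. norm (integral {a..c} (\<lambda>t. g' n t * (m t - m a)) - 0) < e" by blast
  qed
  moreover have "(\<lambda>n. m a * g n c) \<longlonglongrightarrow> m a * 1"
    using assms(1) by (intro tendsto_intros assms) auto
  ultimately have "(\<lambda>n. integral {a..c} (\<lambda>t. g' n t * (m t - m a)) + m a * g n c) \<longlonglongrightarrow> 0 + m a * 1"
    by (rule tendsto_add)
  moreover have "integral {a..c} (\<lambda>t. g' n t * m t) = integral {a..c} (\<lambda>t. g' n t * (m t - m a)) + m a * g n c" for n
  proof -
    have "integral {a..c} (\<lambda>t. g' n t * (m t - m a) + m a * g' n t)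
        = integral {a..c} (\<lambda>t. g' n t * (m t - m a)) + integral {a..c} (\<lambda>t. m a * g' n t)"
      by (intro Henstock_Kurzweil_Integration.integral_add integrable_continuous_real cont continuous_intros
          continuous_on_subset[OF assms(3)]) auto
    moreover have "integral {a..c} (\<lambda>t. m a * g' n t) = m a * g n c"
      using FTC[of a c n] assms(1,5) by (simp add: integral_unique)
    moreover have "(\<lambda>t. g' n t * (m t - m a) + m a * g' n t) = (\<lambda>t. g' n t * m t)"
      by (auto simp: algebra_simps)
    ultimately show ?thesis by simp
  qed
  ultimately show ?thesis by simp
qed

text \<open>The argument is positive exactly on (a, b), so the functions converge to the indicator
  of that interval, while their derivatives tend to a unit mass at a minus a unit mass at b.\<close>

definition cutoff :: "real \<Rightarrow> real \<Rightarrow> nat \<Rightarrow> real \<Rightarrow> real" where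
  "cutoff a b n t = gexp 0 (real (Suc n) * ((t - a) * (b - t)))"

lemma cutoff_bounds: "0 \<le> cutoff a b n t" "cutoff a b n t \<le> 1"
  by (auto simp: cutoff_def gexp_nonneg gexp_le_1)

lemma cutoff_eq_0: "t \<notin> {a<..<b} \<Longrightarrow> a \<le> b \<Longrightarrow> cutoff a b n t = 0"
proof -
  assume "t \<notin> {a<..<b}" "a \<le> b"
  then have "(t - a) * (b - t) \<le> 0" by (cases "t \<le> a") (auto simp: mult_nonpos_nonneg mult_nonneg_nonpos)
  then show ?thesis by (simp add: cutoff_def gexp_0_eq_0_iff mult_nonneg_nonpos)
qed

lemma cutoff_test:
  assumes "0 < a" "a < b" "b < T"
  shows "cutoff a b n \<in> test_functions {0<..<T}"
proof (rule test_functionsI[of _ "{a..b}"])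
  have "C_diff k (\<lambda>t::real. real (Suc n) * ((t \<bullet> 1 + - a) * (b + - 1 * (t \<bullet> 1))))" for k
    by (intro C_diff_mult C_diff_const C_diff_add C_diff_inner)
  then have *: "C_diff k (\<lambda>t. real (Suc n) * ((t - a) * (b - t)))" for k by (simp add: inner_real_def)
  show "C_diff k (cutoff a b n)" for k unfolding cutoff_def[abs_def]
    by (rule C_diff_gexp) (rule *)
  show "{t. cutoff a b n t \<noteq> 0} \<subseteq> {a..b}"
  proof
    fix t assume "t \<in> {t. cutoff a b n t \<noteq> 0}"
    then have "t \<in> {a<..<b}" using cutoff_eq_0[of t a b n] assms by auto
    then show "t \<in> {a..b}" by simp
  qed
qed (use assms in auto)

definition cutoff' :: "real \<Rightarrow> real \<Rightarrow> nat \<Rightarrow> real \<Rightarrow> real" where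
  "cutoff' a b n t = gexp 2 (real (Suc n) * ((t - a) * (b - t))) * (real (Suc n) * (a + b - 2 * t))"

lemma cutoff_deriv: "(cutoff a b n has_real_derivative cutoff' a b n t) (at t)"
proof -
  have "((\<lambda>t. gexp 0 (real (Suc n) * ((t - a) * (b - t)))) has_real_derivative
      (gexp (0 + 2) (real (Suc n) * ((t - a) * (b - t))) - real 0 * gexp (0 + 1) (real (Suc n) * ((t - a) * (b - t))))
        * (real (Suc n) * (a + b - 2 * t))) (at t)"
    by (rule DERIV_chain2[of "gexp 0" _ "\<lambda>t. real (Suc n) * ((t - a) * (b - t))", OF DERIV_gexp])
      (auto intro!: derivative_eq_intros simp: algebra_simps)
  then show ?thesis unfolding cutoff_def[abs_def] cutoff'_def by (simp add: numeral_2_eq_2)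
qed

lemma continuous_on_cutoff': "continuous_on A (cutoff' a b n)"
  unfolding cutoff'_def[abs_def]
  by (intro continuous_intros continuous_on_compose2[OF continuous_on_gexp[of UNIV]]) auto

lemma cutoff_lim:
  assumes "a < t" "t < b"
  shows "(\<lambda>n. cutoff a b n t) \<longlonglongrightarrow> 1"
  using gexp_tendsto_indicator[of "(t - a) * (b - t)"] assms unfolding cutoff_def by simp

text \<open>The derivative of the cut-off changes sign at the midpoint of the interval. Each half is
  an instance of concentration at one end, the right half after reflection.\<close>

lemma tendsto_integral_cutoff:
  assumes "a < b" "continuous_on {a..b} m"
  shows "(\<lambda>n. integral {a..b} (\<lambda>t. cutoff' a b n t * m t)) \<longlonglongrightarrow> m a - m b"
proof -
  define c where "c = (a + b) / 2"
  have c: "a < c" "c < b" using assms by (auto simp: c_def)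
  have l: "(\<lambda>n. integral {a..c} (\<lambda>t. cutoff' a b n t * m t)) \<longlonglongrightarrow> m a"
  proof (rule tendsto_integral_deriv_left[OF c(1) cutoff_deriv continuous_on_cutoff'])
    show "0 \<le> cutoff' a b n t" if "a \<le> t" "t \<le> c" for n t
      using that by (auto simp: cutoff'_def c_def gexp_nonneg intro!: mult_nonneg_nonneg)
  qed (use c assms in \<open>auto simp: cutoff_bounds cutoff_eq_0 intro!: cutoff_lim elim: continuous_on_subset\<close>)
  \<comment> \<open>The reflection t -> -t turns the right half into a left one: the new left end is
    -b, and the derivative changes sign, which makes it nonnegative there.\<close>
  have r: "(\<lambda>n. integral {-b..-c} (\<lambda>t. - cutoff' a b n (- t) * m (- t))) \<longlonglongrightarrow> m (- (- b))"
  proof (rule tendsto_integral_deriv_left[where m="\<lambda>t. m (- t)" and g="\<lambda>n t. cutoff a b n (- t)"])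
    show "((\<lambda>t. cutoff a b n (- t)) has_real_derivative - cutoff' a b n (- t)) (at t)" for n t
      using DERIV_chain2[of "cutoff a b n" _ uminus, OF cutoff_deriv DERIV_minus[OF DERIV_ident]] by simp
    show "0 \<le> - cutoff' a b n (- t)" if "- b \<le> t" "t \<le> - c" for n t
    proof -
      have "real (Suc n) * (a + b - 2 * - t) \<le> 0"
        using that by (intro mult_nonneg_nonpos) (auto simp: c_def field_simps)
      from mult_nonneg_nonpos[OF gexp_nonneg this] show ?thesis by (simp only: cutoff'_def neg_0_le_iff_le)
    qed
    show "continuous_on UNIV (\<lambda>t. - cutoff' a b n (- t))" for n
      by (intro continuous_intros continuous_on_compose2[OF continuous_on_cutoff'[of UNIV]]) auto
    show "continuous_on {- b..- c} (\<lambda>t. m (- t))"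
      using c by (intro continuous_on_compose2[OF assms(2)] continuous_intros) auto
  qed (use c assms in \<open>auto simp: cutoff_bounds cutoff_eq_0 intro!: cutoff_lim\<close>)
  have r': "integral {-b..-c} (\<lambda>t. - cutoff' a b n (- t) * m (- t)) = - integral {c..b} (\<lambda>t. cutoff' a b n t * m t)" for n
    using Henstock_Kurzweil_Integration.integral_reflect_real[of b c "\<lambda>t. cutoff' a b n t * m t"] by simp
  have "integral {a..b} (\<lambda>t. cutoff' a b n t * m t)
      = integral {a..c} (\<lambda>t. cutoff' a b n t * m t) - integral {-b..-c} (\<lambda>t. - cutoff' a b n (- t) * m (- t))" for n
    unfolding r' using c
    by (subst Henstock_Kurzweil_Integration.integral_combine[of a c b, symmetric])
      (auto intro!: integrable_continuous_real continuous_intros continuous_on_cutoff' assms)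
  then show ?thesis using tendsto_diff[OF l r] by simp
qed

section \<open>Pairing with the time derivative\<close>

lemma L2_norm_scale: "L2_norm M (\<lambda>x. c *\<^sub>R f x) = \<bar>c\<bar> * L2_norm M f"
  by (simp add: L2_norm_def power_mult_distrib real_sqrt_mult)

lemma W12_norm_nonneg: "W12_norm \<Omega> u \<ge> 0"
  by (simp add: W12_norm_def)

text \<open>A quantity that is Lipschitz with respect to the norm of the value space inherits
  continuity in time. It is applied to pairings with bounded functions and to J.\<close>

lemma C_time_continuous_on:
  fixes \<Phi> :: "real \<Rightarrow> real"
  assumes "u \<in> C_time V nrm T" "\<And>s t. s \<in> {0..T} \<Longrightarrow> t \<in> {0..T} \<Longrightarrow> \<bar>\<Phi> s - \<Phi> t\<bar> \<le> C * nrm (u s - u t)"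
  shows "continuous_on {0..T} \<Phi>"
  unfolding continuous_on_def
proof
  fix t assume t: "t \<in> {0..T}"
  then have "((\<lambda>s. nrm (u s - u t)) \<longlongrightarrow> 0) (at t within {0..T})" using assms(1) by (simp add: C_time_def)
  from tendsto_mult_right_zero[OF this, of C]
  have "((\<lambda>s. \<Phi> s - \<Phi> t) \<longlongrightarrow> 0) (at t within {0..T})"
    by (rule Lim_null_comparison[rotated])
      (use t in \<open>auto simp: eventually_at_filter intro!: always_eventually assms(2)\<close>)
  then show "(\<Phi> \<longlongrightarrow> \<Phi> t) (at t within {0..T})" by (simp add: LIM_zero_iff)
qed

lemma deriv_eq_partial_deriv:
  fixes \<eta> :: "real \<Rightarrow> real"
  assumes "\<eta> \<in> test_functions S"
  shows "deriv \<eta> = partial_deriv 1 \<eta>"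
proof
  fix t
  have D: "(\<eta> has_derivative frechet_derivative \<eta> (at t)) (at t)"
    using test_functionsD(4)[OF assms] frechet_derivative_works by blast
  have "frechet_derivative \<eta> (at t) h = partial_deriv 1 \<eta> t * h" for h
    using linear_cmul[OF bounded_linear.linear[OF has_derivative_bounded_linear[OF D]], of h 1]
    by (simp add: partial_deriv_def)
  with D have "(\<eta> has_real_derivative partial_deriv 1 \<eta> t) (at t)"
    by (simp add: has_field_derivative_def fun_eq_iff[symmetric] ext) (metis ext)
  then show "deriv \<eta> t = partial_deriv 1 \<eta> t" by (rule DERIV_imp_deriv)
qed

lemma deriv_cutoff: "deriv (cutoff a b n) = cutoff' a b n"
  using DERIV_imp_deriv[OF cutoff_deriv] by auto

context
  fixes \<Omega> :: "'a::euclidean_space set"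
  assumes op: "open \<Omega>" and bd: "bounded \<Omega>"
begin

lemma W012_approx_zero: "W012_approx \<Omega> (\<lambda>x. 0) (\<lambda>x. 0)"
proof -
  have "grad (\<lambda>x::'a. 0) = (\<lambda>x. 0)"
    by (auto simp: grad_def fun_eq_iff partial_deriv_eqI[of _ "\<lambda>_. 0"] intro!: sum.neutral)
  then show ?thesis unfolding W012_approx_def
    by (intro conjI exI[of _ "\<lambda>n x. 0"] bounded_L2[OF op bd, where C=0]) (auto simp: test_functions_zero)
qed

lemma W012_zero: "(\<lambda>x. 0) \<in> W012 \<Omega>" "W12_norm \<Omega> (\<lambda>x. 0) = 0"
  using W012_approx_W012[OF op bd W012_approx_zero] W012_approx_weak_grad(3)[OF op bd W012_approx_zero]
  by (auto simp: L2_norm_zero)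

lemma W012_scale:
  assumes "u \<in> W012 \<Omega>"
  shows "(\<lambda>x. c * u x) \<in> W012 \<Omega>" "W12_norm \<Omega> (\<lambda>x. c * u x) = \<bar>c\<bar> * W12_norm \<Omega> u"
proof -
  note a = W012_W012_approx[OF op bd assms]
  have b: "W012_approx \<Omega> (\<lambda>x. c * u x) (\<lambda>x. c *\<^sub>R weak_grad \<Omega> u x)"
    using W012_approx_lincomb[OF op bd a W012_approx_zero, of c 0] by simp
  show "(\<lambda>x. c * u x) \<in> W012 \<Omega>" by (rule W012_approx_W012[OF op bd b])
  have "(L2_norm (lebesgue_on \<Omega>) (\<lambda>x. c * u x))\<^sup>2 + (L2_norm (lebesgue_on \<Omega>) (\<lambda>x. c *\<^sub>R weak_grad \<Omega> u x))\<^sup>2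
      = c\<^sup>2 * ((L2_norm (lebesgue_on \<Omega>) u)\<^sup>2 + (L2_norm (lebesgue_on \<Omega>) (weak_grad \<Omega> u))\<^sup>2)"
    using L2_norm_scale[of "lebesgue_on \<Omega>" c u] L2_norm_scale[of "lebesgue_on \<Omega>" c "weak_grad \<Omega> u"]
    by (simp add: power_mult_distrib algebra_simps)
  then show "W12_norm \<Omega> (\<lambda>x. c * u x) = \<bar>c\<bar> * W12_norm \<Omega> u"
    unfolding W012_approx_weak_grad(3)[OF op bd b] W12_norm_def[of \<Omega> u] by (simp add: real_sqrt_mult)
qed

section \<open>Functionals in the dual space and their integrals in time\<close>

lemma Wm12_linear:
  assumes "F \<in> Wm12 \<Omega>" "u \<in> W012 \<Omega>" "w \<in> W012 \<Omega>"
  shows "F (\<lambda>x. a * u x + b * w x) = a * F u + b * F w"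
  using assms by (auto simp: Wm12_def)

lemma Wm12_scale:
  assumes "F \<in> Wm12 \<Omega>" "u \<in> W012 \<Omega>"
  shows "F (\<lambda>x. c * u x) = c * F u"
  using Wm12_linear[OF assms(1,2) W012_zero(1), of c 0] by simp

lemma Wm12_norm_ge:
  assumes "F \<in> Wm12 \<Omega>" "u \<in> W012 \<Omega>" "W12_norm \<Omega> u \<le> 1"
  shows "\<bar>F u\<bar> \<le> Wm12_norm \<Omega> F"
  unfolding Wm12_norm_def
proof (rule cSUP_upper)
  show "u \<in> {u \<in> W012 \<Omega>. W12_norm \<Omega> u \<le> 1}" using assms by simp
  obtain C where C: "\<And>u. u \<in> W012 \<Omega> \<Longrightarrow> \<bar>F u\<bar> \<le> C * W12_norm \<Omega> u"
    using assms(1) unfolding Wm12_def by blast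
  show "bdd_above ((\<lambda>u. \<bar>F u\<bar>) ` {u \<in> W012 \<Omega>. W12_norm \<Omega> u \<le> 1})"
  proof (rule bdd_aboveI2)
    fix u assume "u \<in> {u \<in> W012 \<Omega>. W12_norm \<Omega> u \<le> 1}"
    then have u: "u \<in> W012 \<Omega>" "W12_norm \<Omega> u \<le> 1" by auto
    have "C * W12_norm \<Omega> u \<le> \<bar>C\<bar> * 1"
      using u(2) W12_norm_nonneg[of \<Omega> u] by (intro mult_mono) auto
    with C[OF u(1)] show "\<bar>F u\<bar> \<le> \<bar>C\<bar>" by simp
  qed
qed

lemma Wm12_bound:
  assumes "F \<in> Wm12 \<Omega>" "\<psi> \<in> W012 \<Omega>"
  shows "\<bar>F \<psi>\<bar> \<le> Wm12_norm \<Omega> F * W12_norm \<Omega> \<psi>"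
proof (cases "W12_norm \<Omega> \<psi> = 0")
  \<comment> \<open>The norm is a seminorm on representatives, and a function of norm zero cannot be
    rescaled; here boundedness of the functional forces the value 0.\<close>
  case True
  obtain C where "\<bar>F \<psi>\<bar> \<le> C * W12_norm \<Omega> \<psi>" using assms unfolding Wm12_def by blast
  with True show ?thesis by simp
next
  case False
  then have pos: "W12_norm \<Omega> \<psi> > 0" using W12_norm_nonneg[of \<Omega> \<psi>] by simp
  let ?c = "inverse (W12_norm \<Omega> \<psi>)"
  have "\<bar>F (\<lambda>x. ?c * \<psi> x)\<bar> \<le> Wm12_norm \<Omega> F"
    using assms pos by (intro Wm12_norm_ge) (auto simp: W012_scale)
  then have "inverse (W12_norm \<Omega> \<psi>) * \<bar>F \<psi>\<bar> \<le> Wm12_norm \<Omega> F"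
    unfolding Wm12_scale[OF assms] abs_mult using pos by simp
  then show ?thesis using pos by (simp add: field_simps)
qed

lemma Wm12_diff:
  assumes "F \<in> Wm12 \<Omega>" "G \<in> Wm12 \<Omega>"
  shows "F - G \<in> Wm12 \<Omega>"
proof -
  obtain C where C: "\<And>u. u \<in> W012 \<Omega> \<Longrightarrow> \<bar>F u\<bar> \<le> C * W12_norm \<Omega> u"
    using assms(1) unfolding Wm12_def by blast
  obtain D where D: "\<And>u. u \<in> W012 \<Omega> \<Longrightarrow> \<bar>G u\<bar> \<le> D * W12_norm \<Omega> u"
    using assms(2) unfolding Wm12_def by blast
  have "\<bar>(F - G) u\<bar> \<le> (C + D) * W12_norm \<Omega> u" if "u \<in> W012 \<Omega>" for u
    using C[OF that] D[OF that] by (simp add: distrib_right)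
  moreover have "(F - G) (\<lambda>x. a * u x + b * w x) = a * (F - G) u + b * (F - G) w"
    if "u \<in> W012 \<Omega>" "w \<in> W012 \<Omega>" for u w a b
    using Wm12_linear[OF assms(1) that] Wm12_linear[OF assms(2) that] by (simp add: algebra_simps)
  ultimately show ?thesis unfolding Wm12_def by blast
qed

text \<open>Evaluation at a fixed \<psi> is continuous for the dual norm, so the scalar function is
  almost everywhere the limit of the evaluated simple functions.\<close>

lemma bochner_Wm12_measurable:
  assumes "bochner_measurable (Wm12 \<Omega>) (Wm12_norm \<Omega>) I F" "I \<in> sets lebesgue" "\<psi> \<in> W012 \<Omega>"
  shows "(\<lambda>t. F t \<psi>) \<in> borel_measurable (lebesgue_on I)"
proof -
  from assms(1) obtain s where F: "AE t in lebesgue_on I. F t \<in> Wm12 \<Omega>"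
    and s: "\<And>k::nat. simple_function (lebesgue_on I) (s k)" "\<And>k. s k ` I \<subseteq> Wm12 \<Omega>"
    and lim: "AE t in lebesgue_on I. (\<lambda>k. Wm12_norm \<Omega> (s k t - F t)) \<longlonglongrightarrow> 0"
    unfolding bochner_measurable_def by blast
  have m: "(\<lambda>t. s k t \<psi>) \<in> borel_measurable (lebesgue_on I)" for k
    by (rule borel_measurable_simple_function[OF simple_function_compose1[OF s(1), of "\<lambda>f. f \<psi>"]])
  have "AE t in lebesgue_on I. lim (\<lambda>k. s k t \<psi>) = F t \<psi>"
    using F lim AE_space
  proof eventually_elim
    case (elim t)
    have "(\<lambda>k. s k t \<psi> - F t \<psi>) \<longlonglongrightarrow> 0"
    proof (rule Lim_null_comparison[OF _ tendsto_mult_left_zero[OF elim(2)]])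
      have "s k t \<in> Wm12 \<Omega>" for k using s(2) elim(3) by (auto simp: image_subset_iff)
      then have "\<bar>(s k t - F t) \<psi>\<bar> \<le> Wm12_norm \<Omega> (s k t - F t) * W12_norm \<Omega> \<psi>" for k
        using Wm12_bound[OF Wm12_diff[OF _ elim(1)] assms(3)] by blast
      then show "\<forall>\<^sub>F k in sequentially. norm (s k t \<psi> - F t \<psi>) \<le> Wm12_norm \<Omega> (s k t - F t) * W12_norm \<Omega> \<psi>"
        by simp
    qed
    then show ?case by (intro limI) (simp add: LIM_zero_iff)
  qed
  from lebesgue_on_measurable_AE[OF borel_measurable_lim_metric[OF m] this assms(2)] show ?thesis .
qed

lemma L2_time_Wm12_integrable:
  assumes "F \<in> L2_time (Wm12 \<Omega>) (Wm12_norm \<Omega>) I" "I \<in> lmeasurable" "\<psi> \<in> W012 \<Omega>"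
  shows "integrable (lebesgue_on I) (\<lambda>t. F t \<psi>)"
proof (rule Bochner_Integration.integrable_bound)
  have I: "I \<in> sets lebesgue" using assms(2) by (simp add: fmeasurableD)
  have F: "bochner_measurable (Wm12 \<Omega>) (Wm12_norm \<Omega>) I F"
    "integrable (lebesgue_on I) (\<lambda>t. (Wm12_norm \<Omega> (F t))\<^sup>2)"
    using assms(1) by (auto simp: L2_time_def)
  \<comment> \<open>On an interval of finite measure the estimate n <= 1 + n^2 turns the square
    integrable dual norm into an integrable majorant.\<close>
  show "integrable (lebesgue_on I) (\<lambda>t. (1 + (Wm12_norm \<Omega> (F t))\<^sup>2) * W12_norm \<Omega> \<psi>)"
    using finite_measure.integrable_const[OF finite_measure_lebesgue_on[OF assms(2)]] F(2)
    by (intro integrable_mult_left Bochner_Integration.integrable_add)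
  show "(\<lambda>t. F t \<psi>) \<in> borel_measurable (lebesgue_on I)"
    by (rule bochner_Wm12_measurable[OF F(1) I assms(3)])
  have "AE t in lebesgue_on I. F t \<in> Wm12 \<Omega>" using F(1) by (simp add: bochner_measurable_def)
  then show "AE t in lebesgue_on I. norm (F t \<psi>) \<le> norm ((1 + (Wm12_norm \<Omega> (F t))\<^sup>2) * W12_norm \<Omega> \<psi>)"
  proof eventually_elim
    case (elim t)
    have "\<bar>F t \<psi>\<bar> \<le> Wm12_norm \<Omega> (F t) * W12_norm \<Omega> \<psi>" by (rule Wm12_bound[OF elim assms(3)])
    also have "\<dots> \<le> (1 + (Wm12_norm \<Omega> (F t))\<^sup>2) * W12_norm \<Omega> \<psi>"
    proof (rule mult_right_mono[OF _ W12_norm_nonneg])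
      have "0 \<le> Wm12_norm \<Omega> (F t)" using Wm12_norm_ge[OF elim W012_zero(1)] W012_zero(2) by simp
      with sum_squares_bound[of "Wm12_norm \<Omega> (F t)" 1] show "Wm12_norm \<Omega> (F t) \<le> 1 + (Wm12_norm \<Omega> (F t))\<^sup>2"
        by simp
    qed
    finally show ?case using W12_norm_nonneg[of \<Omega> \<psi>] by (simp add: abs_mult)
  qed
qed

lemma W2_loc_time_deriv:
  assumes "u \<in> W2_loc T \<Omega>"
  shows "time_deriv T \<Omega> u \<in> L2_loc_time (Wm12 \<Omega>) (Wm12_norm \<Omega>) T" "is_time_deriv T \<Omega> u (time_deriv T \<Omega> u)"
proof -
  from assms obtain F where "F \<in> L2_loc_time (Wm12 \<Omega>) (Wm12_norm \<Omega>) T \<and> is_time_deriv T \<Omega> u F"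
    by (auto simp: W2_loc_def)
  then have "time_deriv T \<Omega> u \<in> L2_loc_time (Wm12 \<Omega>) (Wm12_norm \<Omega>) T \<and> is_time_deriv T \<Omega> u (time_deriv T \<Omega> u)"
    unfolding time_deriv_def
    by (rule someI[of "\<lambda>F. F \<in> L2_loc_time (Wm12 \<Omega>) (Wm12_norm \<Omega>) T \<and> is_time_deriv T \<Omega> u F"])
  then show "time_deriv T \<Omega> u \<in> L2_loc_time (Wm12 \<Omega>) (Wm12_norm \<Omega>) T" "is_time_deriv T \<Omega> u (time_deriv T \<Omega> u)"
    by auto
qed

lemma L1_bounded_mult:
  fixes g \<psi> :: "'a \<Rightarrow> real"
  assumes "integrable (lebesgue_on \<Omega>) g" "\<psi> \<in> borel_measurable (lebesgue_on \<Omega>)" "\<And>x. \<bar>\<psi> x\<bar> \<le> C"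
  shows "integrable (lebesgue_on \<Omega>) (\<lambda>x. g x * \<psi> x)"
    "\<bar>LINT x|lebesgue_on \<Omega>. g x * \<psi> x\<bar> \<le> C * L1_norm (lebesgue_on \<Omega>) g"
proof -
  have C: "C \<ge> 0" using assms(3) abs_ge_zero order_trans by blast
  have le: "\<bar>g x * \<psi> x\<bar> \<le> C * \<bar>g x\<bar>" for x
    using mult_left_mono[OF assms(3)[of x] abs_ge_zero[of "g x"]] by (simp add: abs_mult mult.commute)
  have m: "(\<lambda>x. g x * \<psi> x) \<in> borel_measurable (lebesgue_on \<Omega>)"
    using assms(2) borel_measurable_integrable[OF assms(1)] by measurable
  have i: "integrable (lebesgue_on \<Omega>) (\<lambda>x. C * \<bar>g x\<bar>)" using assms(1) by simp
  show j: "integrable (lebesgue_on \<Omega>) (\<lambda>x. g x * \<psi> x)"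
    by (rule Bochner_Integration.integrable_bound[OF i m]) (use le C in \<open>auto simp: abs_mult\<close>)
  have "\<bar>LINT x|lebesgue_on \<Omega>. g x * \<psi> x\<bar> \<le> (LINT x|lebesgue_on \<Omega>. \<bar>g x * \<psi> x\<bar>)"
    by (rule integral_abs_bound)
  also have "\<dots> \<le> (LINT x|lebesgue_on \<Omega>. C * \<bar>g x\<bar>)"
    using j i le by (intro integral_mono) auto
  finally show "\<bar>LINT x|lebesgue_on \<Omega>. g x * \<psi> x\<bar> \<le> C * L1_norm (lebesgue_on \<Omega>) g"
    by (simp add: L1_norm_def)
qed

lemma C_time_pairing_continuous:
  fixes \<psi> :: "'a \<Rightarrow> real"
  assumes "u \<in> C_time (L1 (lebesgue_on \<Omega>)) (L1_norm (lebesgue_on \<Omega>)) T"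
    "\<psi> \<in> borel_measurable (lebesgue_on \<Omega>)" "\<And>x. \<bar>\<psi> x\<bar> \<le> C"
  shows "continuous_on {0..T} (\<lambda>t. LINT x|lebesgue_on \<Omega>. u t x * \<psi> x)"
proof (rule C_time_continuous_on[OF assms(1)])
  fix s t assume "s \<in> {0..T}" "t \<in> {0..T}"
  then have i: "integrable (lebesgue_on \<Omega>) (u s)" "integrable (lebesgue_on \<Omega>) (u t)"
    using assms(1) by (auto simp: C_time_def L1_def)
  have "(LINT x|lebesgue_on \<Omega>. u s x * \<psi> x) - (LINT x|lebesgue_on \<Omega>. u t x * \<psi> x)
      = (LINT x|lebesgue_on \<Omega>. (u s - u t) x * \<psi> x)"
    using L1_bounded_mult(1)[OF i(1) assms(2,3)] L1_bounded_mult(1)[OF i(2) assms(2,3)]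
    by (simp add: left_diff_distrib)
  then show "\<bar>(LINT x|lebesgue_on \<Omega>. u s x * \<psi> x) - (LINT x|lebesgue_on \<Omega>. u t x * \<psi> x)\<bar>
      \<le> C * L1_norm (lebesgue_on \<Omega>) (u s - u t)"
    using L1_bounded_mult(2)[OF _ assms(2,3), of "u s - u t"] i by (simp add: fun_diff_def)
qed

text \<open>The distributional identity is tested with a cut-off of (a, b) times \<psi>, and the
  cut-off is then sharpened. Continuity in L^1 together with boundedness of \<psi> makes t ->
  \<integral> u(t) \<psi> continuous, so the end values appear for every a and b and not merely for
  almost all.\<close>

lemma time_deriv_pairing:
  fixes \<psi> :: "'a \<Rightarrow> real"
  assumes u: "u \<in> C_time (L1 (lebesgue_on \<Omega>)) (L1_norm (lebesgue_on \<Omega>)) T" "u \<in> W2_loc T \<Omega>"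
    and \<psi>: "\<psi> \<in> W012 \<Omega>" "\<And>x. \<bar>\<psi> x\<bar> \<le> C" and ab: "0 < a" "a < b" "b < T"
  shows "(LINT t|lebesgue_on {a..b}. time_deriv T \<Omega> u t \<psi>)
      = (LINT x|lebesgue_on \<Omega>. u b x * \<psi> x) - (LINT x|lebesgue_on \<Omega>. u a x * \<psi> x)"
proof -
  define m where "m t = (LINT x|lebesgue_on \<Omega>. u t x * \<psi> x)" for t
  define F where "F t = time_deriv T \<Omega> u t \<psi>" for t
  have \<psi>m: "\<psi> \<in> borel_measurable (lebesgue_on \<Omega>)"
    using W12_weak_grad(1)[OF op bd] \<psi>(1) by (auto simp: W012_def L2_measurable)
  have m: "continuous_on {0..T} m"
    unfolding m_def by (rule C_time_pairing_continuous[OF u(1) \<psi>m \<psi>(2)])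
  have mab: "continuous_on {a..b} m" using ab by (intro continuous_on_subset[OF m]) auto
  have F: "integrable (lebesgue_on {a..b}) F"
    unfolding F_def using W2_loc_time_deriv(1)[OF u(2)] ab \<psi>(1)
    by (intro L2_time_Wm12_integrable) (auto simp: L2_loc_time_def)
  \<comment> \<open>Cut-offs and their derivatives vanish outside (a, b), so integrals over (0, T)
    shrink to [a, b], where the derivative in time is known to be integrable.\<close>
  have restr: "(LINT t|lebesgue_on {0<..<T}. f t) = (LINT t|lebesgue_on {a..b}. f t)"
    if "\<And>t. t \<notin> {a<..<b} \<Longrightarrow> f t = 0" for f :: "real \<Rightarrow> real"
  proof -
    have "(LINT t|lebesgue_on {0<..<T}. f t) = (LINT t|lebesgue. indicator {0<..<T} t *\<^sub>R f t)"
      by (rule integral_restrict_space) auto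
    also have "(\<lambda>t. indicator {0<..<T} t *\<^sub>R f t) = (\<lambda>t. indicator {a..b} t *\<^sub>R f t)"
      using that ab by (fastforce simp: indicator_def)
    also have "(LINT t|lebesgue. indicator {a..b} t *\<^sub>R f t) = (LINT t|lebesgue_on {a..b}. f t)"
      by (rule integral_restrict_space[symmetric]) auto
    finally show ?thesis .
  qed
  have c'0: "cutoff' a b n t = 0" if "t \<notin> {a<..<b}" for n t
  proof -
    have "(t - a) * (b - t) \<le> 0"
      using that ab by (cases "t \<le> a") (auto simp: mult_nonpos_nonneg mult_nonneg_nonpos)
    then have "gexp 2 (real (Suc n) * ((t - a) * (b - t))) = 0"
      unfolding gexp_0_eq_0_iff by (rule mult_nonneg_nonpos[rotated]) simp
    then show ?thesis by (simp add: cutoff'_def)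
  qed
  have eq: "integral {a..b} (\<lambda>t. cutoff' a b n t * m t) = - (LINT t|lebesgue_on {a..b}. cutoff a b n t * F t)" for n
  proof -
    have "(LINT t|lebesgue_on {0<..<T}. cutoff' a b n t * m t) = - (LINT t|lebesgue_on {0<..<T}. cutoff a b n t * F t)"
      using W2_loc_time_deriv(2)[OF u(2)] cutoff_test[OF ab, of n] \<psi>(1)
      unfolding is_time_deriv_def m_def F_def by (auto simp: deriv_cutoff)
    moreover have "(LINT t|lebesgue_on {0<..<T}. cutoff' a b n t * m t) = (LINT t|lebesgue_on {a..b}. cutoff' a b n t * m t)"
      by (rule restr) (simp add: c'0)
    moreover have "(LINT t|lebesgue_on {0<..<T}. cutoff a b n t * F t) = (LINT t|lebesgue_on {a..b}. cutoff a b n t * F t)"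
      using ab by (intro restr) (simp add: cutoff_eq_0)
    moreover have "(LINT t|lebesgue_on {a..b}. cutoff' a b n t * m t) = integral {a..b} (\<lambda>t. cutoff' a b n t * m t)"
      by (intro lebesgue_integral_eq_integral integrable_continuous_real continuous_imp_integrable_real
          continuous_intros continuous_on_cutoff' mab) simp
    ultimately show ?thesis by simp
  qed
  have "(\<lambda>n. LINT t|lebesgue_on {a..b}. cutoff a b n t * F t) \<longlonglongrightarrow> (LINT t|lebesgue_on {a..b}. F t)"
  proof (rule integral_dominated_convergence[where w="\<lambda>t. \<bar>F t\<bar>"])
    show "integrable (lebesgue_on {a..b}) (\<lambda>t. \<bar>F t\<bar>)" using F by simp
    show "F \<in> borel_measurable (lebesgue_on {a..b})" using F by simp
    have "cutoff a b n \<in> borel_measurable (lebesgue_on {a..b})" for n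
      by (intro continuous_imp_measurable_on_sets_lebesgue)
        (auto intro!: DERIV_continuous_on has_field_derivative_at_within[OF cutoff_deriv])
    then show "(\<lambda>t. cutoff a b n t * F t) \<in> borel_measurable (lebesgue_on {a..b})" for n
      using F by (intro borel_measurable_times) auto
    show "AE t in lebesgue_on {a..b}. norm (cutoff a b n t * F t) \<le> \<bar>F t\<bar>" for n
      using cutoff_bounds[of a b n] by (auto simp: abs_mult intro!: mult_left_le_one_le)
    \<comment> \<open>The cut-offs are 0 at both ends for every n and tend to 1 only in the open
      interval.\<close>
    have "AE t in lborel. t \<noteq> a \<and> t \<noteq> b" using AE_lborel_singleton[of a] AE_lborel_singleton[of b] by auto
    then show "AE t in lebesgue_on {a..b}. (\<lambda>n. cutoff a b n t * F t) \<longlonglongrightarrow> F t"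
    proof (subst AE_lebesgue_on_iff, simp, eventually_elim)
      case (elim t)
      then show ?case using tendsto_mult[OF cutoff_lim[of a t b] tendsto_const[of "F t"]] by auto
    qed
  qed
  then have "(\<lambda>n. integral {a..b} (\<lambda>t. cutoff' a b n t * m t)) \<longlonglongrightarrow> - (LINT t|lebesgue_on {a..b}. F t)"
    unfolding eq by (rule tendsto_minus)
  from LIMSEQ_unique[OF this tendsto_integral_cutoff[OF ab(2) mab]]
  show ?thesis by (simp add: F_def m_def)
qed

lemma constant_in_time_W2:
  fixes \<psi> :: "'a \<Rightarrow> real"
  assumes "\<psi> \<in> W012 \<Omega>" "T > 0"
  shows "(\<lambda>t. \<psi>) \<in> W2 T \<Omega>"
proof -
  have fin: "finite_measure (lebesgue_on {0<..<T})" by (rule finite_measure_lebesgue_on) simp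
  note c = finite_measure.integrable_const[OF fin]
  have \<psi>m: "\<psi> \<in> borel_measurable (lebesgue_on \<Omega>)"
    using W12_weak_grad(1)[OF op bd] assms(1) by (auto simp: W012_def L2_measurable)
  have "(\<lambda>t. \<psi>) \<in> L2_time (W012 \<Omega>) (W12_norm \<Omega>) {0<..<T}"
    unfolding L2_time_def bochner_measurable_def using assms(1) c
    by (auto simp: fun_diff_def W012_zero intro!: exI[of _ "\<lambda>k t. \<psi>"])
  moreover have "case_prod (\<lambda>t::real. \<psi>) \<in> borel_measurable (lebesgue_on (cylinder T \<Omega>))"
  proof -
    have "snd \<in> lebesgue_on (cylinder T \<Omega>) \<rightarrow>\<^sub>M lebesgue_on \<Omega>"
      by (rule measurable_restrict_space3[OF measurable_snd_lebesgue]) (auto simp: cylinder_def)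
    from measurable_compose[OF this \<psi>m] show ?thesis by (simp add: case_prod_unfold)
  qed
  moreover have "(\<lambda>t \<phi>. 0) \<in> L2_time (Wm12 \<Omega>) (Wm12_norm \<Omega>) {0<..<T}"
  proof -
    have z: "(\<lambda>\<phi>. 0) \<in> Wm12 \<Omega>" by (auto simp: Wm12_def intro!: exI[of _ 0])
    have "{u \<in> W012 \<Omega>. W12_norm \<Omega> u \<le> 1} \<noteq> {}" using W012_zero by auto
    then have "Wm12_norm \<Omega> (\<lambda>\<phi>. 0) = 0" by (simp add: Wm12_norm_def)
    with z c show ?thesis unfolding L2_time_def bochner_measurable_def
      by (auto simp: fun_diff_def intro!: exI[of _ "\<lambda>k t \<phi>. 0"])
  qed
  moreover have "is_time_deriv T \<Omega> (\<lambda>t. \<psi>) (\<lambda>t \<phi>. 0)"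
    unfolding is_time_deriv_def
  proof (intro ballI)
    fix \<eta> and \<phi> :: "'a \<Rightarrow> real" assume \<eta>: "\<eta> \<in> test_functions {0<..<T}"
    have 1: "(1::real) \<in> Basis" by simp
    have "(LINT t|lebesgue_on {0<..<T}. deriv \<eta> t) = (LINT t|lborel. deriv \<eta> t)"
      unfolding deriv_eq_partial_deriv[OF \<eta>]
      using borel_measurable_test(2)[OF \<eta> 1] partial_deriv_test_function(1)[OF \<eta> 1] test_functionsD(3)[OF \<eta>]
      by (intro lebesgue_on_integral_support) auto
    also have "\<dots> = 0" unfolding deriv_eq_partial_deriv[OF \<eta>]
      by (rule integral_partial_deriv_test[OF test_functions_subset[OF \<eta>] 1]) simp
    finally show "(LINT t|lebesgue_on {0<..<T}. deriv \<eta> t * (LINT x|lebesgue_on \<Omega>. \<psi> x * \<phi> x))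
        = - (LINT t|lebesgue_on {0<..<T}. \<eta> t * 0)" by simp
  qed
  ultimately show ?thesis unfolding W2_def by blast
qed

end

section \<open>Joint measurability of the gradient\<close>

text \<open>A simple function has finitely many values, each taken on a measurable set of times, so
  joint measurability reduces to measurability in space for each value.\<close>

lemma simple_function_joint_measurable:
  assumes "simple_function A s" "\<And>c. c \<in> s ` space A \<Longrightarrow> f c \<in> borel_measurable B"
  shows "(\<lambda>p. f (s (fst p)) (snd p)) \<in> borel_measurable (A \<Otimes>\<^sub>M B)"
proof (rule measurable_compose_countable'[where g="\<lambda>p. s (fst p)" and I="s ` space A" and f="\<lambda>c p. f c (snd p)"])
  show "countable (s ` space A)" using simple_functionD(1)[OF assms(1)] by (rule countable_finite)
  show "(\<lambda>p. f c (snd p)) \<in> borel_measurable (A \<Otimes>\<^sub>M B)" if "c \<in> s ` space A" for c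
    using measurable_compose[OF measurable_snd assms(2)[OF that]] .
  have "s \<in> A \<rightarrow>\<^sub>M count_space (s ` space A)"
    by (rule measurableI) (auto intro: simple_functionD(2)[OF assms(1)])
  from measurable_compose[OF measurable_fst this]
  show "(\<lambda>p. s (fst p)) \<in> A \<Otimes>\<^sub>M B \<rightarrow>\<^sub>M count_space (s ` space A)" .
qed

lemma summable_min_1:
  fixes a :: "nat \<Rightarrow> real"
  assumes "summable (\<lambda>n. min 1 (a n))" "\<And>n. a n \<ge> 0"
  shows "summable a"
proof -
  have "eventually (\<lambda>n. min 1 (a n) < 1) sequentially"
    using order_tendstoD(2)[OF summable_LIMSEQ_zero[OF assms(1)], of 1] by simp
  then have "eventually (\<lambda>n. min 1 (a n) = a n) sequentially"
    by eventually_elim (auto simp: min_def split: if_splits)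
  from summable_cong[OF this] show ?thesis using assms(1) by simp
qed

text \<open>The truncated mean metrises convergence in measure. Along a rapidly chosen subsequence
  the truncated increments have summable integrals, hence are summable almost everywhere, and the
  partial sums telescope.\<close>

lemma Cauchy_measure_subseq:
  fixes g :: "nat \<Rightarrow> 'a \<Rightarrow> 'b::euclidean_space"
  assumes "finite_measure P" and [measurable]: "\<And>k. g k \<in> borel_measurable P"
    and C: "\<And>e. e > 0 \<Longrightarrow> \<exists>N. \<forall>k\<ge>N. \<forall>l\<ge>N. (LINT p|P. min 1 (norm (g k p - g l p))) < e"
  obtains r where "strict_mono r" "AE p in P. convergent (\<lambda>n. g (r n) p)"
proof -
  interpret finite_measure P by fact
  have "\<exists>N. \<forall>k\<ge>N. \<forall>l\<ge>N. (LINT p|P. min 1 (norm (g k p - g l p))) < (1 / 2) ^ n" for n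
    by (rule C) simp
  then obtain N where N: "\<And>n k l. k \<ge> N n \<Longrightarrow> l \<ge> N n \<Longrightarrow> (LINT p|P. min 1 (norm (g k p - g l p))) < (1 / 2) ^ n"
    by metis
  \<comment> \<open>The sum dominates every \<open>N i\<close> with i <= n, so the indices r n and r
    (n + 1) both exceed \<open>N n\<close>; the added n makes r strictly increasing.\<close>
  define r where "r n = (\<Sum>i\<le>n. N i) + n" for n
  have r: "strict_mono r" by (rule strict_mono_Suc_iff[THEN iffD2]) (auto simp: r_def)
  have rN: "r n \<ge> N n" "r (Suc n) \<ge> N n" for n
    using member_le_sum[of n "{..n}" N] by (auto simp: r_def)
  define d where "d n p = min 1 (norm (g (r n) p - g (r (Suc n)) p))" for n p
  have [measurable]: "d n \<in> borel_measurable P" for n unfolding d_def[abs_def] by measurable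
  have d0: "d n p \<ge> 0" for n p by (simp add: d_def)
  have id: "integrable P (d n)" for n
    by (rule integrable_const_bound[of _ 1]) (auto simp: d_def)
  have "(\<integral>\<^sup>+p. (\<Sum>n. ennreal (d n p)) \<partial>P) = (\<Sum>n. \<integral>\<^sup>+p. ennreal (d n p) \<partial>P)"
    by (rule nn_integral_suminf) measurable
  also have "\<dots> \<le> (\<Sum>n. ennreal ((1 / 2) ^ n))"
  proof (rule suminf_le)
    show "(\<integral>\<^sup>+p. ennreal (d n p) \<partial>P) \<le> ennreal ((1 / 2) ^ n)" for n
    proof -
      have "integral\<^sup>L P (d n) \<le> (1 / 2) ^ n"
        using N[OF rN(1) rN(2), of n] unfolding d_def by simp
      then show ?thesis using id[of n] d0 by (subst nn_integral_eq_integral) (auto intro!: ennreal_leI)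
    qed
  qed auto
  also have "\<dots> < \<infinity>" by (subst suminf_ennreal2) (auto simp: summable_geometric)
  finally have "AE p in P. (\<Sum>n. ennreal (d n p)) \<noteq> \<infinity>"
    by (intro nn_integral_noteq_infinite) auto
  then have "AE p in P. convergent (\<lambda>n. g (r n) p)"
  proof eventually_elim
    case (elim p)
    then have "summable (\<lambda>n. d n p)" using d0 by (intro summable_suminf_not_top) auto
    \<comment> \<open>The terms of a summable sequence are eventually below 1, so the truncation is
      eventually inactive.\<close>
    then have "summable (\<lambda>n. norm (g (r n) p - g (r (Suc n)) p))"
      unfolding d_def by (rule summable_min_1) simp
    then have "summable (\<lambda>n. g (r (Suc n)) p - g (r n) p)"
      by (intro summable_norm_cancel[of "\<lambda>n. g (r (Suc n)) p - g (r n) p"]) (simp add: norm_minus_commute)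
    then have "convergent (\<lambda>n. \<Sum>i<n. g (r (Suc i)) p - g (r i) p)" by (simp add: summable_iff_convergent)
    then have "convergent (\<lambda>n. g (r n) p - g (r 0) p)" by (simp only: sum_lessThan_telescope[of "\<lambda>i. g (r i) p"])
    then show ?case by (simp add: convergent_diff_const_right_iff)
  qed
  with r show thesis by (rule that)
qed

context
  fixes \<Omega> :: "'a::euclidean_space set"
  assumes op: "open \<Omega>" and bd: "bounded \<Omega>"
begin

lemma weak_grad_diff_le:
  assumes "u \<in> W012 \<Omega>" "w \<in> W012 \<Omega>"
  shows "L2_norm (lebesgue_on \<Omega>) (\<lambda>x. weak_grad \<Omega> u x - weak_grad \<Omega> w x) \<le> W12_norm \<Omega> (\<lambda>x. u x - w x)"
proof -
  have a: "W012_approx \<Omega> (\<lambda>x. u x - w x) (\<lambda>x. weak_grad \<Omega> u x - weak_grad \<Omega> w x)"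
    using W012_approx_lincomb[OF op bd W012_W012_approx[OF op bd assms(1)] W012_W012_approx[OF op bd assms(2)], of 1 "-1"]
    by simp
  show ?thesis unfolding W012_approx_weak_grad(3)[OF op bd a] by (rule real_le_rsqrt) simp
qed

lemma weak_grad_L2: "u \<in> W012 \<Omega> \<Longrightarrow> weak_grad \<Omega> u \<in> L2 (lebesgue_on \<Omega>)" "u \<in> W012 \<Omega> \<Longrightarrow> u \<in> L2 (lebesgue_on \<Omega>)"
  using W12_weak_grad[OF op bd] by (auto simp: W012_def)

text \<open>The gradient of u(t) is chosen independently for each t, so joint measurability cannot
  be read off it. Gradients of the approximating simple functions are jointly measurable and
  converge in L^2(\<Omega>) for almost every t. They form a Cauchy sequence in measure on the
  product; a subsequence converges almost everywhere, and its limit is identified slice by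
  slice.\<close>

lemma bochner_weak_grad_joint:
  fixes u :: "real \<Rightarrow> 'a \<Rightarrow> real"
  assumes u: "bochner_measurable (W012 \<Omega>) (W12_norm \<Omega>) I u" and I: "I \<in> lmeasurable"
  obtains V where "V \<in> borel_measurable borel"
    "AE t in lborel. t \<in> I \<longrightarrow> (AE x in lborel. x \<in> \<Omega> \<longrightarrow> weak_grad \<Omega> (u t) x = V (t, x))"
proof -
  let ?A = "lebesgue_on I" and ?B = "lebesgue_on \<Omega>"
  have Is: "I \<in> sets lebesgue" using I by (simp add: fmeasurableD)
  have Os: "\<Omega> \<in> sets lebesgue" using op by auto
  interpret A: finite_measure ?A by (rule finite_measure_lebesgue_on[OF I])
  interpret B: finite_measure ?B by (rule finite_measure_Omega[OF op bd])
  interpret P: pair_sigma_finite ?A ?B ..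
  interpret PF: finite_measure "?A \<Otimes>\<^sub>M ?B"
    by (rule finite_measure_pair_measure) unfold_locales
  from u obtain s where uW: "AE t in ?A. u t \<in> W012 \<Omega>"
    and s: "\<And>k::nat. simple_function ?A (s k)" "\<And>k. s k ` I \<subseteq> W012 \<Omega>"
    and lim: "AE t in ?A. (\<lambda>k. W12_norm \<Omega> (s k t - u t)) \<longlonglongrightarrow> 0"
    unfolding bochner_measurable_def by blast
  define g where "g k p = weak_grad \<Omega> (s k (fst p)) (snd p)" for k p
  have gm[measurable]: "g k \<in> borel_measurable (?A \<Otimes>\<^sub>M ?B)" for k
    unfolding g_def[abs_def] using s(2)[of k]
    by (intro simple_function_joint_measurable[OF s(1)] L2_measurable weak_grad_L2) auto
  have sW: "s k t \<in> W012 \<Omega>" if "t \<in> space ?A" for k t using s(2) that by auto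
  have L2lim: "AE t in ?A. u t \<in> W012 \<Omega> \<and> (\<lambda>k. L2_norm ?B (\<lambda>x. g k (t, x) - weak_grad \<Omega> (u t) x)) \<longlonglongrightarrow> 0"
    using uW lim AE_space
  proof eventually_elim
    case (elim t)
    have "(\<lambda>k. L2_norm ?B (\<lambda>x. g k (t, x) - weak_grad \<Omega> (u t) x)) \<longlonglongrightarrow> 0"
    proof (rule Lim_null_comparison[OF always_eventually elim(2)], rule allI)
      show "norm (L2_norm ?B (\<lambda>x. g k (t, x) - weak_grad \<Omega> (u t) x)) \<le> W12_norm \<Omega> (s k t - u t)" for k
        using weak_grad_diff_le[OF sW[OF elim(3)] elim(1)] by (simp add: g_def fun_diff_def abs_of_nonneg[OF L2_norm_nonneg])
    qed
    with elim(1) show ?case by simp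
  qed
  have L1lim: "AE t in ?A. (\<lambda>k. LINT x|?B. norm (g k (t, x) - weak_grad \<Omega> (u t) x)) \<longlonglongrightarrow> 0"
    using L2lim AE_space
  proof eventually_elim
    case (elim t)
    have m: "(\<lambda>x. g k (t, x) - weak_grad \<Omega> (u t) x) \<in> L2 ?B" for k
      using weak_grad_L2(1)[OF sW[OF elim(2)]] weak_grad_L2(1) elim(1) by (auto simp: g_def intro: L2_diff)
    have n: "(\<lambda>x. norm (g k (t, x) - weak_grad \<Omega> (u t) x)) \<in> L2 ?B" for k
      using L2_measurable[OF m] by (intro L2_bound[OF _ L2_integrable_sq[OF m]]) auto
    have one: "(\<lambda>x. 1::real) \<in> L2 ?B" by (rule bounded_L2[OF op bd, where C=1]) auto
    show ?case
    proof (rule Lim_null_comparison[OF always_eventually])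
      show "(\<lambda>k. L2_norm ?B (\<lambda>x. g k (t, x) - weak_grad \<Omega> (u t) x) * L2_norm ?B (\<lambda>x. 1::real)) \<longlonglongrightarrow> 0"
        by (intro tendsto_mult_left_zero) (use elim in simp)
      show "\<forall>k. norm (LINT x|?B. norm (g k (t, x) - weak_grad \<Omega> (u t) x))
          \<le> L2_norm ?B (\<lambda>x. g k (t, x) - weak_grad \<Omega> (u t) x) * L2_norm ?B (\<lambda>x. 1::real)"
        using L2_Cauchy_Schwarz[OF n one] by (auto simp: L2_norm_def)
    qed
  qed
  \<comment> \<open>Arguing by contradiction replaces the double limit by one sequence of index
    pairs, to which dominated convergence in t applies. Truncation by 1 supplies the majorant, since
    no integrability of the gradients in t is assumed.\<close>
  have C: "\<exists>N. \<forall>k\<ge>N. \<forall>l\<ge>N. (LINT p|(?A \<Otimes>\<^sub>M ?B). min 1 (norm (g k p - g l p))) < e" if e: "e > 0" for e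
  proof (rule ccontr)
    assume "\<not> ?thesis"
    then have "\<forall>N. \<exists>k l. k \<ge> N \<and> l \<ge> N \<and> (LINT p|(?A \<Otimes>\<^sub>M ?B). min 1 (norm (g k p - g l p))) \<ge> e"
      by (meson not_le)
    then obtain k l where kl: "\<And>N. k N \<ge> N" "\<And>N. l N \<ge> N"
      "\<And>N. (LINT p|(?A \<Otimes>\<^sub>M ?B). min 1 (norm (g (k N) p - g (l N) p))) \<ge> e"
      by metis
    have kl_inf: "filterlim k at_top sequentially" "filterlim l at_top sequentially"
      using kl(1,2) by (auto intro: filterlim_at_top_mono[OF filterlim_ident] always_eventually)
    define F where "F N t = (LINT x|?B. min 1 (norm (g (k N) (t, x) - g (l N) (t, x))))" for N t
    have int: "integrable (?A \<Otimes>\<^sub>M ?B) (\<lambda>p. min 1 (norm (g (k N) p - g (l N) p)))" for N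
      by (rule PF.integrable_const_bound[of _ 1]) auto
    have eq: "(LINT p|(?A \<Otimes>\<^sub>M ?B). min 1 (norm (g (k N) p - g (l N) p))) = (LINT t|?A. F N t)" for N
      unfolding F_def using P.integral_fst'[OF int[of N]] by simp
    have "(\<lambda>N. LINT t|?A. F N t) \<longlonglongrightarrow> (LINT t|?A. 0)"
    proof (rule integral_dominated_convergence[where w="\<lambda>t. measure ?B (space ?B)"])
      show "F N \<in> borel_measurable ?A" for N unfolding F_def[abs_def] by measurable
      show "AE t in ?A. norm (F N t) \<le> measure ?B (space ?B)" for N
      proof (rule AE_I2)
        fix t assume t: "t \<in> space ?A"
        have "(LINT x|?B. min 1 (norm (g (k N) (t, x) - g (l N) (t, x)))) \<le> (LINT x|?B. 1)"
          using measurable_compose[OF measurable_Pair1'[OF t] gm]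
          by (intro integral_mono B.integrable_const_bound[of _ 1]) auto
        then show "norm (F N t) \<le> measure ?B (space ?B)" by (simp add: F_def)
      qed
      show "AE t in ?A. (\<lambda>N. F N t) \<longlonglongrightarrow> 0"
        using L1lim L2lim AE_space
      proof eventually_elim
        case (elim t)
        let ?w = "weak_grad \<Omega> (u t)"
        have L1i: "integrable ?B (\<lambda>x. norm (g j (t, x) - ?w x))" for j
          using weak_grad_L2(1)[OF sW[OF elim(3)]] weak_grad_L2(1) elim(2)
          by (intro integrable_norm L2_integrable[OF op bd] L2_diff) (auto simp: g_def)
        have "norm (F N t) \<le> (LINT x|?B. norm (g (k N) (t, x) - ?w x)) + (LINT x|?B. norm (g (l N) (t, x) - ?w x))" for N
        proof -
          have "F N t \<le> (LINT x|?B. norm (g (k N) (t, x) - ?w x) + norm (g (l N) (t, x) - ?w x))"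
            unfolding F_def
          proof (rule integral_mono)
            show "integrable ?B (\<lambda>x. min 1 (norm (g (k N) (t, x) - g (l N) (t, x))))"
              using measurable_compose[OF measurable_Pair1'[OF elim(3)] gm]
              by (intro B.integrable_const_bound[of _ 1]) auto
            show "min 1 (norm (g (k N) (t, x) - g (l N) (t, x))) \<le> norm (g (k N) (t, x) - ?w x) + norm (g (l N) (t, x) - ?w x)" for x
              using norm_triangle_ineq4[of "g (k N) (t, x) - ?w x" "g (l N) (t, x) - ?w x"] by simp
          qed (intro Bochner_Integration.integrable_add L1i)
          then show ?thesis using L1i by (simp add: F_def)
        qed
        moreover have "(\<lambda>N. (LINT x|?B. norm (g (k N) (t, x) - ?w x)) + (LINT x|?B. norm (g (l N) (t, x) - ?w x))) \<longlonglongrightarrow> 0 + 0"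
          by (intro tendsto_add filterlim_compose[OF elim(1)] kl_inf)
        ultimately show ?case
          by (intro Lim_null_comparison[OF always_eventually[OF allI],
              of "\<lambda>N. F N t" "\<lambda>N. (LINT x|?B. norm (g (k N) (t, x) - ?w x)) + (LINT x|?B. norm (g (l N) (t, x) - ?w x))"]) simp_all
      qed
    qed (auto intro: A.integrable_const)
    then have "eventually (\<lambda>N. (LINT t|?A. F N t) < e) sequentially"
      using e by (intro order_tendstoD(2)) auto
    then obtain N where "(LINT t|?A. F N t) < e" unfolding eventually_sequentially by auto
    with kl(3)[of N] show False unfolding eq by simp
  qed
  obtain r where r: "strict_mono r" "AE p in (?A \<Otimes>\<^sub>M ?B). convergent (\<lambda>n. g (r n) p)"
    using Cauchy_measure_subseq[OF PF.finite_measure_axioms gm C] by blast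
  define V0 where "V0 p = lim (\<lambda>n. g (r n) p)" for p
  have V0m: "V0 \<in> borel_measurable (?A \<Otimes>\<^sub>M ?B)" unfolding V0_def[abs_def] by measurable
  have V0: "AE t in ?A. AE x in ?B. weak_grad \<Omega> (u t) x = V0 (t, x)"
    using P.AE_pair[OF r(2)] L1lim L2lim AE_space
  proof eventually_elim
    case (elim t)
    let ?w = "weak_grad \<Omega> (u t)"
    have L1i: "integrable ?B (\<lambda>x. g j (t, x) - ?w x)" for j
      using weak_grad_L2(1)[OF sW[OF elim(4)]] weak_grad_L2(1) elim(3)
      by (intro L2_integrable[OF op bd] L2_diff) (auto simp: g_def)
    \<comment> \<open>In a fixed slice the chosen subsequence converges to the gradient in L^1; a
      further subsequence, depending on t, does so almost everywhere and must have the limit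
      V0.\<close>
    have "(\<lambda>n. LINT x|?B. norm (g (r n) (t, x) - ?w x)) \<longlonglongrightarrow> 0"
      using LIMSEQ_subseq_LIMSEQ[OF elim(2) r(1)] by (simp add: comp_def)
    with tendsto_L1_AE_subseq[of ?B "\<lambda>n x. g (r n) (t, x) - ?w x"] L1i
    obtain q where q: "strict_mono (q :: nat \<Rightarrow> nat)" "AE x in ?B. (\<lambda>n. g (r (q n)) (t, x) - ?w x) \<longlonglongrightarrow> 0" by auto
    show ?case using q(2) elim(1)
    proof eventually_elim
      case (elim x)
      have "(\<lambda>n. g (r (q n)) (t, x)) \<longlonglongrightarrow> V0 (t, x)"
        using LIMSEQ_subseq_LIMSEQ[OF elim(2)[unfolded convergent_LIMSEQ_iff] q(1)] by (simp add: comp_def V0_def)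
      moreover have "(\<lambda>n. g (r (q n)) (t, x)) \<longlonglongrightarrow> ?w x" using elim(1) by (simp add: LIM_zero_iff)
      ultimately show ?case by (rule LIMSEQ_unique[symmetric])
    qed
  qed
  \<comment> \<open>Lebesgue measurability of the projections places the product of the two
    restricted Lebesgue sigma-algebras inside the Lebesgue sigma-algebra of I \<times> \<Omega>;
    only then is a Borel representative available.\<close>
  have "(\<lambda>p. (fst p, snd p)) \<in> lebesgue_on (I \<times> \<Omega>) \<rightarrow>\<^sub>M ?A \<Otimes>\<^sub>M ?B"
    by (intro measurable_Pair measurable_restrict_space3[OF measurable_fst_lebesgue] 
        measurable_restrict_space3[OF measurable_snd_lebesgue]) auto
  from measurable_compose[OF this V0m] have V0m': "V0 \<in> borel_measurable (lebesgue_on (I \<times> \<Omega>))" by simp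
  have "I \<times> \<Omega> = fst -` I \<inter> snd -` \<Omega>" by auto
  also have "\<dots> \<in> sets lebesgue"
    using measurable_sets[OF measurable_fst_lebesgue Is] measurable_sets[OF measurable_snd_lebesgue Os]
    by (intro sets.Int) auto
  finally have IO: "I \<times> \<Omega> \<in> sets lebesgue" .
  obtain V where V: "V \<in> borel_measurable borel" "AE p in lborel. p \<in> I \<times> \<Omega> \<longrightarrow> V0 p = V p"
    using lebesgue_on_ex_borel_measurable[OF V0m' IO] by blast
  have "AE t in lborel. AE x in lborel. (t, x) \<in> I \<times> \<Omega> \<longrightarrow> V0 (t, x) = V (t, x)"
    using V(2) unfolding lborel_prod[symmetric] by (rule lborel_pair.AE_pair)
  moreover have "AE t in lborel. t \<in> I \<longrightarrow> (AE x in lborel. x \<in> \<Omega> \<longrightarrow> weak_grad \<Omega> (u t) x = V0 (t, x))"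
    using V0 unfolding AE_lebesgue_on_iff[OF Is] AE_lebesgue_on_iff[OF Os] .
  ultimately have "AE t in lborel. t \<in> I \<longrightarrow> (AE x in lborel. x \<in> \<Omega> \<longrightarrow> weak_grad \<Omega> (u t) x = V (t, x))"
  proof eventually_elim
    case (elim t)
    show ?case
    proof
      assume t: "t \<in> I"
      from elim(1) elim(2)[rule_format, OF t]
      show "AE x in lborel. x \<in> \<Omega> \<longrightarrow> weak_grad \<Omega> (u t) x = V (t, x)"
        by eventually_elim (use t in auto)
    qed
  qed
  with V(1) show thesis by (rule that)
qed

end

section \<open>Continuity of translations\<close>

lemma lborel_shift:
  fixes f :: "'a::euclidean_space \<Rightarrow> 'b::{banach, second_countable_topology}"
  assumes "f \<in> borel_measurable borel"
  shows "integrable lborel (\<lambda>x. f (x - h)) \<longleftrightarrow> integrable lborel f" "(LINT x|lborel. f (x - h)) = (LINT x|lborel. f x)"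
proof -
  have *: "distr lborel borel ((+) (- h)) = (lborel :: 'a measure)" by (simp add: lborel_distr_plus)
  show "integrable lborel (\<lambda>x. f (x - h)) \<longleftrightarrow> integrable lborel f"
    using integrable_distr_eq[of "(+) (- h)" lborel borel f] assms unfolding * by simp
  show "(LINT x|lborel. f (x - h)) = (LINT x|lborel. f x)"
    using integral_distr[of "(+) (- h)" lborel borel f] assms unfolding * by simp
qed

text \<open>The usual three-term estimate: translation invariance makes the error of approximating
  the shifted f by the shifted g equal to the unshifted one.\<close>

lemma translation_approx:
  fixes f :: "'a::euclidean_space \<Rightarrow> 'b::euclidean_space"
  assumes f: "integrable lborel f" and h: "h \<longlonglongrightarrow> (0::'a)"
    and g: "\<And>e. e > 0 \<Longrightarrow> \<exists>g. integrable lborel g \<and> (LINT x|lborel. norm (f x - g x)) < e \<and>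
        (\<lambda>n. LINT x|lborel. norm (g (x - h n) - g x)) \<longlonglongrightarrow> 0"
  shows "(\<lambda>n. LINT x|lborel. norm (f (x - h n) - f x)) \<longlonglongrightarrow> 0"
proof (rule LIMSEQ_I)
  fix e :: real assume e: "e > 0"
  obtain g where gi: "integrable lborel g" and ge: "(LINT x|lborel. norm (f x - g x)) < e / 3"
    and gl: "(\<lambda>n. LINT x|lborel. norm (g (x - h n) - g x)) \<longlonglongrightarrow> 0"
    using g[of "e / 3"] e by auto
  have fm: "f \<in> borel_measurable borel" "g \<in> borel_measurable borel"
    using borel_measurable_integrable[OF f] borel_measurable_integrable[OF gi] by auto
  obtain N where N: "\<And>n. n \<ge> N \<Longrightarrow> (LINT x|lborel. norm (g (x - h n) - g x)) < e / 3"
    using order_tendstoD(2)[OF gl, of "e / 3"] e unfolding eventually_sequentially by auto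
  have i: "integrable lborel (\<lambda>x. f (x - h n))" "integrable lborel (\<lambda>x. g (x - h n))" for n
    using lborel_shift(1)[OF fm(1)] lborel_shift(1)[OF fm(2)] f gi by auto
  have "norm ((LINT x|lborel. norm (f (x - h n) - f x)) - 0) < e" if n: "n \<ge> N" for n
  proof -
    have "(LINT x|lborel. norm (f (x - h n) - f x))
        \<le> (LINT x|lborel. norm (f (x - h n) - g (x - h n)) + (norm (g (x - h n) - g x) + norm (f x - g x)))"
    proof (rule integral_mono)
      show "norm (f (x - h n) - f x) \<le> norm (f (x - h n) - g (x - h n)) + (norm (g (x - h n) - g x) + norm (f x - g x))" for x
        using norm_triangle_ineq[of "f (x - h n) - g (x - h n)" "(g (x - h n) - g x) - (f x - g x)"]
          norm_triangle_ineq4[of "g (x - h n) - g x" "f x - g x"] by (simp add: algebra_simps)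
    qed (intro Bochner_Integration.integrable_add integrable_norm Bochner_Integration.integrable_diff i f gi)+
    also have "\<dots> = (LINT x|lborel. norm (f (x - h n) - g (x - h n))) + (LINT x|lborel. norm (g (x - h n) - g x))
        + (LINT x|lborel. norm (f x - g x))"
      using i[of n] f gi by simp
    also have "(LINT x|lborel. norm (f (x - h n) - g (x - h n))) = (LINT x|lborel. norm (f x - g x))"
      using lborel_shift(2)[of "\<lambda>x. norm (f x - g x)" "h n"] fm by simp
    finally show ?thesis using ge N[OF n] by simp
  qed
  then show "\<exists>no. \<forall>n\<ge>no. norm ((LINT x|lborel. norm (f (x - h n) - f x)) - 0) < e" by blast
qed

text \<open>For an open set only points leaving the set need control, and openness makes that part
  vanish pointwise. Points entering have the same total measure, because a translation preserves the
  measure of U.\<close>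

lemma translation_indicator_open:
  fixes U :: "'a::euclidean_space set"
  assumes "open U" "emeasure lborel U < \<infinity>" "h \<longlonglongrightarrow> (0::'a)"
  shows "(\<lambda>n. LINT x|lborel. \<bar>indicator U (x - h n) - indicator U x\<bar> :: real) \<longlonglongrightarrow> 0"
proof -
  have [measurable]: "U \<in> sets borel" using assms(1) by simp
  have iU: "integrable lborel (indicator U :: 'a \<Rightarrow> real)" using assms(2) by simp
  have iUh: "integrable lborel (\<lambda>x. indicator U (x - h n) :: real)" for n
    using iU by (subst lborel_shift(1)) auto
  \<comment> \<open>p is the positive part of the difference; it is dominated by the indicator of U,
    whereas the opposite part has no fixed majorant.\<close>
  define p where "p n x = max 0 (indicator U x - indicator U (x - h n) :: real)" for n x
  have ip: "integrable lborel (p n)" for n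
    unfolding p_def using iU iUh by (intro integrable_max) auto
  have "(\<lambda>n. LINT x|lborel. p n x) \<longlonglongrightarrow> (LINT x|(lborel :: 'a measure). 0)"
  proof (rule integral_dominated_convergence[OF _ _ iU])
    show "p n \<in> borel_measurable lborel" for n using ip by simp
    show "AE x in lborel. norm (p n x) \<le> indicator U x" for n
      by (auto simp: p_def indicator_def)
    have "(\<lambda>n. p n x) \<longlonglongrightarrow> 0" for x
    proof (cases "x \<in> U")
      case True
      have "(\<lambda>n. x - h n) \<longlonglongrightarrow> x - 0" by (intro tendsto_intros assms(3))
      then have "eventually (\<lambda>n. x - h n \<in> U) sequentially"
        using topological_tendstoD[OF _ assms(1)] True by simp
      then have "eventually (\<lambda>n. p n x = 0) sequentially"
        by eventually_elim (use True in \<open>auto simp: p_def\<close>)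
      then show ?thesis by (rule tendsto_eventually)
    qed (simp add: p_def)
    then show "AE x in lborel. (\<lambda>n. p n x) \<longlonglongrightarrow> 0" by simp
  qed simp
  then have "(\<lambda>n. 2 * (LINT x|lborel. p n x)) \<longlonglongrightarrow> 0" using tendsto_mult_right_zero by fastforce
  moreover have "(LINT x|lborel. \<bar>indicator U (x - h n) - indicator U x\<bar> :: real) = 2 * (LINT x|lborel. p n x)" for n
  proof -
    have "(LINT x|lborel. \<bar>indicator U (x - h n) - indicator U x\<bar> :: real)
        = (LINT x|lborel. 2 * p n x + indicator U (x - h n) - indicator U x)"
      by (rule Bochner_Integration.integral_cong) (auto simp: p_def indicator_def)
    also have "\<dots> = 2 * (LINT x|lborel. p n x)"
      using ip[of n] iU iUh[of n] lborel_shift(2)[of "indicator U :: 'a \<Rightarrow> real" "h n"] by simp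
    finally show ?thesis .
  qed
  ultimately show ?thesis by simp
qed

text \<open>Induction over integrable functions. Indicators of measurable sets are approximated from
  outside by open sets; sums and dominated limits then follow.\<close>

lemma translation_L1:
  fixes f :: "'a::euclidean_space \<Rightarrow> 'b::euclidean_space"
  assumes "integrable lborel f" "h \<longlonglongrightarrow> (0::'a)"
  shows "(\<lambda>n. LINT x|lborel. norm (f (x - h n) - f x)) \<longlonglongrightarrow> 0"
  using assms(1)
proof (induct rule: integrable_induct)
  case (base A c)
  then have A: "A \<in> sets borel" "emeasure lborel A < \<infinity>" by auto
  have m: "(\<lambda>x. indicator B x *\<^sub>R c) \<in> borel_measurable borel" if "B \<in> sets borel" for B :: "'a set"
    using that by measurable
  have iA: "integrable lborel (\<lambda>x. indicator A x *\<^sub>R c)" using A by (auto simp: integrable_indicator_iff)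
  show ?case
  proof (rule translation_approx[OF iA assms(2)])
    fix e :: real assume e: "e > 0"
    \<comment> \<open>The summand 1 in the denominator covers c = 0 and makes d times the norm of c
      strictly smaller than e.\<close>
    define d where "d = e / (norm c + 1)"
    have d: "d > 0" "d * norm c < e" using e by (auto simp: d_def field_simps add_pos_nonneg)
    obtain U where U: "open U" "A \<subseteq> U" "emeasure lborel (U - A) < ennreal d"
      using outer_regular_lborel[OF A(1) d(1)] by blast
    have "emeasure lborel U \<le> emeasure lborel A + emeasure lborel (U - A)"
      using emeasure_subadditive[of A lborel "U - A"] U(1,2) A(1) by (simp add: Un_absorb1)
    also have "\<dots> < \<infinity>" using A(2) order_less_trans[OF U(3) ennreal_less_top] by simp
    finally have Uf: "emeasure lborel U < \<infinity>" .
    show "\<exists>g. integrable lborel g \<and> (LINT x|lborel. norm (indicator A x *\<^sub>R c - g x)) < e \<and>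
        (\<lambda>n. LINT x|lborel. norm (g (x - h n) - g x)) \<longlonglongrightarrow> 0"
    proof (intro exI[of _ "\<lambda>x. indicator U x *\<^sub>R c"] conjI)
      show "integrable lborel (\<lambda>x. indicator U x *\<^sub>R c)" using U(1) Uf by (auto simp: integrable_indicator_iff)
      have "(LINT x|lborel. norm (indicator A x *\<^sub>R c - indicator U x *\<^sub>R c)) = (LINT x|lborel. indicator (U - A) x * norm c)"
        using U(2) by (intro Bochner_Integration.integral_cong) (auto simp: indicator_def)
      also have "\<dots> = measure lborel (U - A) * norm c" by simp
      also have "\<dots> \<le> d * norm c"
        using U(3) d(1) by (intro mult_right_mono) (auto simp: measure_def enn2real_leI less_imp_le)
      finally show "(LINT x|lborel. norm (indicator A x *\<^sub>R c - indicator U x *\<^sub>R c)) < e" using d(2) by simp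
      have "norm (indicator U (x - h n) *\<^sub>R c - indicator U x *\<^sub>R c) = \<bar>indicator U (x - h n) - indicator U x\<bar> * norm c" for x n
        by (simp add: scaleR_diff_left[symmetric])
      then show "(\<lambda>n. LINT x|lborel. norm (indicator U (x - h n) *\<^sub>R c - indicator U x *\<^sub>R c)) \<longlonglongrightarrow> 0"
        using tendsto_mult_left_zero[OF translation_indicator_open[OF U(1) Uf assms(2)], of "norm c"] by simp
    qed
  qed
next
  case (add f g)
  have fm: "f \<in> borel_measurable borel" "g \<in> borel_measurable borel"
    using add(1,3)[THEN borel_measurable_integrable] by auto
  have i: "integrable lborel (\<lambda>x. f (x - h n))" "integrable lborel (\<lambda>x. g (x - h n))" for n
    using lborel_shift(1)[OF fm(1)] lborel_shift(1)[OF fm(2)] add by auto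
  show ?case
  proof (rule Lim_null_comparison[OF always_eventually])
    show "(\<lambda>n. (LINT x|lborel. norm (f (x - h n) - f x)) + (LINT x|lborel. norm (g (x - h n) - g x))) \<longlonglongrightarrow> 0"
      using tendsto_add[OF add(2,4)] by simp
    show "\<forall>n. norm (LINT x|lborel. norm (f (x - h n) + g (x - h n) - (f x + g x)))
        \<le> (LINT x|lborel. norm (f (x - h n) - f x)) + (LINT x|lborel. norm (g (x - h n) - g x))"
    proof
      fix n
      have "(LINT x|lborel. norm (f (x - h n) + g (x - h n) - (f x + g x)))
          \<le> (LINT x|lborel. norm (f (x - h n) - f x) + norm (g (x - h n) - g x))"
      proof (rule integral_mono)
        show "norm (f (x - h n) + g (x - h n) - (f x + g x)) \<le> norm (f (x - h n) - f x) + norm (g (x - h n) - g x)" for x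
          using norm_triangle_ineq[of "f (x - h n) - f x" "g (x - h n) - g x"] by (simp add: algebra_simps)
      qed (intro Bochner_Integration.integrable_add integrable_norm Bochner_Integration.integrable_diff i add)+
      then show "norm (LINT x|lborel. norm (f (x - h n) + g (x - h n) - (f x + g x)))
        \<le> (LINT x|lborel. norm (f (x - h n) - f x)) + (LINT x|lborel. norm (g (x - h n) - g x))"
        using i[of n] add(1,3) by simp
    qed
  qed
next
  case (lim f s)
  show ?case
  proof (rule translation_approx[OF lim(5) assms(2)])
    fix e :: real assume e: "e > 0"
    have "(\<lambda>i. LINT x|lborel. norm (f x - s i x)) \<longlonglongrightarrow> (LINT x|(lborel :: 'a measure). 0)"
    \<comment> \<open>The induction rule provides simple functions of norm at most 2 |f|, whence the
      factor 3.\<close>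
    proof (rule integral_dominated_convergence[where w="\<lambda>x. 3 * norm (f x)"])
      show "AE x in lborel. (\<lambda>i. norm (f x - s i x)) \<longlonglongrightarrow> 0"
      proof (rule AE_I2)
        fix x :: 'a
        have "(\<lambda>i. norm (f x - s i x)) \<longlonglongrightarrow> norm (f x - f x)"
          by (intro tendsto_intros lim(3)) simp
        then show "(\<lambda>i. norm (f x - s i x)) \<longlonglongrightarrow> 0" by simp
      qed
      show "AE x in lborel. norm (norm (f x - s i x)) \<le> 3 * norm (f x)" for i
      proof (rule AE_I2)
        fix x :: 'a
        show "norm (norm (f x - s i x)) \<le> 3 * norm (f x)"
          using norm_triangle_ineq4[of "f x" "s i x"] lim(4)[of x i] by simp
      qed
      show "(\<lambda>x. norm (f x - s i x)) \<in> borel_measurable lborel" for i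
        by (intro borel_measurable_integrable integrable_norm Bochner_Integration.integrable_diff lim(1) lim(5))
    qed (use lim(5) in auto)
    then have "eventually (\<lambda>i. (LINT x|lborel. norm (f x - s i x)) < e) sequentially"
      using e by (intro order_tendstoD(2)) auto
    then obtain i where "(LINT x|lborel. norm (f x - s i x)) < e" unfolding eventually_sequentially by auto
    then show "\<exists>g. integrable lborel g \<and> (LINT x|lborel. norm (f x - g x)) < e \<and>
        (\<lambda>n. LINT x|lborel. norm (g (x - h n) - g x)) \<longlonglongrightarrow> 0"
      using lim(1)[of i] lim(2)[of i] by blast
  qed
qed

text \<open>Where |g| <= m the statement follows from continuity of translations in L^1. The rest of
  g has small L^2 norm, and there Cauchy-Schwarz is enough, as the shifted f has the same norm as
  f.\<close>

lemma translation_L2_pairing: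
  fixes f g :: "'a::euclidean_space \<Rightarrow> 'b::euclidean_space"
  assumes f: "integrable lborel f" "f \<in> L2 lborel" and g: "g \<in> L2 lborel" and h: "h \<longlonglongrightarrow> (0::'a)"
  shows "(\<lambda>n. LINT x|lborel. norm (f (x - h n) - f x) * norm (g x)) \<longlonglongrightarrow> 0"
proof (rule LIMSEQ_I)
  fix e :: real assume e: "e > 0"
  have [measurable]: "f \<in> borel_measurable borel" "g \<in> borel_measurable borel"
    using f(1) g by (auto simp: L2_def)
  \<comment> \<open>The tail of |g| above the level m. It vanishes at a given point as soon as m
    passes the value there, so its L^2 norm tends to 0.\<close>
  define gm where "gm m x = (if norm (g x) \<le> real m then 0 else norm (g x))" for m x
  have [measurable]: "gm m \<in> borel_measurable borel" for m unfolding gm_def[abs_def] by measurable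
  have gmL2: "gm m \<in> L2 lborel" for m
    by (rule L2_bound[OF _ L2_integrable_sq[OF g]]) (auto simp: gm_def)
  have "(\<lambda>m. L2_norm lborel (gm m)) \<longlonglongrightarrow> 0"
  proof -
    have "(\<lambda>m. LINT x|lborel. (norm (gm m x))\<^sup>2) \<longlonglongrightarrow> (LINT x|(lborel :: 'a measure). 0)"
    proof (rule integral_dominated_convergence[OF _ _ L2_integrable_sq[OF g]])
      show "AE x in lborel. (\<lambda>m. (norm (gm m x))\<^sup>2) \<longlonglongrightarrow> 0"
      proof (rule AE_I2)
        fix x :: 'a
        obtain N :: nat where "norm (g x) \<le> real N" using real_arch_simple by blast
        then have "eventually (\<lambda>m. (norm (gm m x))\<^sup>2 = 0) sequentially"
          unfolding eventually_sequentially gm_def by (intro exI[of _ N]) auto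
        then show "(\<lambda>m. (norm (gm m x))\<^sup>2) \<longlonglongrightarrow> 0" by (rule tendsto_eventually)
      qed
      show "AE x in lborel. norm ((norm (gm m x))\<^sup>2) \<le> (norm (g x))\<^sup>2" for m
        by (auto simp: gm_def)
    qed auto
    then show ?thesis by (simp add: L2_norm_tendsto_0_iff)
  qed
  then have "(\<lambda>m. 2 * L2_norm lborel f * L2_norm lborel (gm m)) \<longlonglongrightarrow> 0" by (rule tendsto_mult_right_zero)
  then have "eventually (\<lambda>m. 2 * L2_norm lborel f * L2_norm lborel (gm m) < e / 2) sequentially"
    using e by (intro order_tendstoD(2)) auto
  then obtain m where m: "2 * L2_norm lborel f * L2_norm lborel (gm m) < e / 2"
    unfolding eventually_sequentially by auto
  have "(\<lambda>n. real m * (LINT x|lborel. norm (f (x - h n) - f x))) \<longlonglongrightarrow> 0"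
    by (rule tendsto_mult_right_zero[OF translation_L1[OF f(1) h]])
  then have "eventually (\<lambda>n. real m * (LINT x|lborel. norm (f (x - h n) - f x)) < e / 2) sequentially"
    using e by (intro order_tendstoD(2)) auto
  then obtain N where N: "\<And>n. n \<ge> N \<Longrightarrow> real m * (LINT x|lborel. norm (f (x - h n) - f x)) < e / 2"
    unfolding eventually_sequentially by auto
  have "norm ((LINT x|lborel. norm (f (x - h n) - f x) * norm (g x)) - 0) < e" if n: "n \<ge> N" for n
  proof -
    have fs: "(\<lambda>x. f (x - h n)) \<in> L2 lborel"
      using lborel_shift(1)[of "\<lambda>x. (norm (f x))\<^sup>2" "h n"] f(2) by (auto simp: L2_def)
    have fsn: "L2_norm lborel (\<lambda>x. f (x - h n)) = L2_norm lborel f"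
      unfolding L2_norm_def using lborel_shift(2)[of "\<lambda>x. (norm (f x))\<^sup>2" "h n"] by simp
    have nL2: "(\<lambda>x. norm (u x)) \<in> L2 lborel" "L2_norm lborel (\<lambda>x. norm (u x)) = L2_norm lborel u"
      if "u \<in> L2 lborel" for u :: "'a \<Rightarrow> 'b"
      using that by (auto simp: L2_def L2_norm_def)
    have i1: "integrable lborel (\<lambda>x. norm (u x) * gm m x)" if "u \<in> L2 lborel" for u :: "'a \<Rightarrow> 'b"
      using L2_integrable_inner[OF nL2(1)[OF that] gmL2] by simp
    have i2: "integrable lborel (\<lambda>x. norm (f (x - h n) - f x))"
      using f(1) lborel_shift(1)[of f "h n"] by (intro integrable_norm Bochner_Integration.integrable_diff) auto
    have c: "(LINT x|lborel. norm (u x) * gm m x) \<le> L2_norm lborel u * L2_norm lborel (gm m)"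
      if "u \<in> L2 lborel" for u :: "'a \<Rightarrow> 'b"
      using L2_Cauchy_Schwarz[OF nL2(1)[OF that] gmL2[of m]] nL2(2)[OF that] by simp
    have "norm (f (x - h n) - f x) * norm (g x) \<le> real m * norm (f (x - h n) - f x) + (norm (f (x - h n)) * gm m x + norm (f x) * gm m x)" for x
    proof (cases "norm (g x) \<le> real m")
      case True
      then show ?thesis using mult_left_mono[OF True norm_ge_zero[of "f (x - h n) - f x"]]
        by (simp add: gm_def mult.commute)
    next
      case False
      have "norm (f (x - h n) - f x) * norm (g x) \<le> (norm (f (x - h n)) + norm (f x)) * norm (g x)"
        by (intro mult_right_mono norm_triangle_ineq4) simp
      moreover have "0 \<le> real m * norm (f (x - h n) - f x)" by simp
      moreover have gm: "gm m x = norm (g x)" using False by (simp add: gm_def)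
      ultimately show ?thesis unfolding gm distrib_right by linarith
    qed
    then have "(LINT x|lborel. norm (f (x - h n) - f x) * norm (g x))
        \<le> (LINT x|lborel. real m * norm (f (x - h n) - f x) + (norm (f (x - h n)) * gm m x + norm (f x) * gm m x))"
      using i1[OF fs] i1[OF f(2)] i2 L2_integrable_inner[OF nL2(1)[OF L2_diff[OF fs f(2)]] nL2(1)[OF g]]
      by (intro integral_mono) auto
    also have "\<dots> = real m * (LINT x|lborel. norm (f (x - h n) - f x)) + ((LINT x|lborel. norm (f (x - h n)) * gm m x) + (LINT x|lborel. norm (f x) * gm m x))"
      using i1[OF fs] i1[OF f(2)] i2 by simp
    finally show ?thesis using N[OF n] m c[OF fs] c[OF f(2)] fsn
      by (simp add: abs_of_nonneg)
  qed
  then show "\<exists>no. \<forall>n\<ge>no. norm ((LINT x|lborel. norm (f (x - h n) - f x) * norm (g x)) - 0) < e" by blast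
qed

section \<open>Steklov averages\<close>

text \<open>After the shift the integrals over the common interval cancel, and what remains is the
  integral of J over [b - h, b] minus that over [a - h, a]. Continuity of J at the two ends does the
  rest.\<close>

lemma integral_increment_average:
  fixes J :: "real \<Rightarrow> real"
  assumes J: "continuous_on {0..T} J" and ab: "0 < a" "a < b" "b < T" and e: "e > 0"
  obtains d where "d > 0" "\<And>h. 0 < h \<Longrightarrow> h < d \<Longrightarrow> integrable lborel (\<lambda>s. indicator {a..b} s * (J s - J (s - h)))"
    "\<And>h. 0 < h \<Longrightarrow> h < d \<Longrightarrow> h * (J b - J a - e) \<le> (LINT s|lborel. indicator {a..b} s * (J s - J (s - h)))"
proof -
  obtain d1 where d1: "d1 > 0" "\<And>t. t \<in> {0..T} \<Longrightarrow> \<bar>t - a\<bar> < d1 \<Longrightarrow> \<bar>J t - J a\<bar> < e / 2"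
    using J[unfolded continuous_on_iff, rule_format, of a "e / 2"] e ab by (auto simp: dist_real_def)
  obtain d2 where d2: "d2 > 0" "\<And>t. t \<in> {0..T} \<Longrightarrow> \<bar>t - b\<bar> < d2 \<Longrightarrow> \<bar>J t - J b\<bar> < e / 2"
    using J[unfolded continuous_on_iff, rule_format, of b "e / 2"] e ab by (auto simp: dist_real_def)
  \<comment> \<open>The entry a keeps a - h inside [0, T], and b - a makes [a, b - h] a genuine
    common interval.\<close>
  define d where "d = min (min d1 d2) (min a (b - a))"
  have "d > 0" using d1 d2 ab by (auto simp: d_def)
  moreover have *: "integrable lborel (\<lambda>s. indicator {a..b} s * (J s - J (s - h)))"
    "h * (J b - J a - e) \<le> (LINT s|lborel. indicator {a..b} s * (J s - J (s - h)))" if h: "0 < h" "h < d" for h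
  proof -
    have h': "h < d1" "h < d2" "h < a" "h < b - a" using h by (auto simp: d_def)
    have c: "continuous_on {x..y} J" if "0 \<le> x" "y \<le> T" for x y
      using that by (intro continuous_on_subset[OF J]) auto
    have ch: "continuous_on {a..b} (\<lambda>s. J (s - h))"
      using h h' ab by (intro continuous_on_compose2[OF J] continuous_intros) auto
    have cd: "continuous_on {a..b} (\<lambda>s. J s - J (s - h))"
      using ab by (intro continuous_intros c ch) auto
    have si: "set_integrable lborel {a..b} (\<lambda>s. J s - J (s - h))"
      by (rule borel_integrable_atLeastAtMost') (rule cd)
    then show "integrable lborel (\<lambda>s. indicator {a..b} s * (J s - J (s - h)))"
      by (simp add: set_integrable_def)
    have "(LINT s|lborel. indicator {a..b} s * (J s - J (s - h))) = integral {a..b} (\<lambda>s. J s - J (s - h))"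
      using set_borel_integral_eq_integral(2)[OF si] by (simp add: set_lebesgue_integral_def)
    also have "\<dots> = integral {a..b} J - integral {a..b} (\<lambda>s. J (s - h))"
      using ab by (intro Henstock_Kurzweil_Integration.integral_diff integrable_continuous_real c ch) auto
    also have "integral {a..b} (\<lambda>s. J (s - h)) = integral {a - h..b - h} J"
      using integral_shift_Icc_real[of a b J "- h"] by (simp add: comp_def)
    also have "integral {a..b} J = integral {a..b - h} J + integral {b - h..b} J"
      using h h' ab by (intro Henstock_Kurzweil_Integration.integral_combine[symmetric] integrable_continuous_real c) auto
    also have "integral {a - h..b - h} J = integral {a - h..a} J + integral {a..b - h} J"
      using h h' ab by (intro Henstock_Kurzweil_Integration.integral_combine[symmetric] integrable_continuous_real c) auto
    finally have eq: "(LINT s|lborel. indicator {a..b} s * (J s - J (s - h)))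
        = integral {b - h..b} J - integral {a - h..a} J" by simp
    have "integral {b - h..b} (\<lambda>s. J b - e / 2) \<le> integral {b - h..b} J"
    proof (rule Henstock_Kurzweil_Integration.integral_le)
      show "J b - e / 2 \<le> J s" if s: "s \<in> {b - h..b}" for s
      proof -
        have "\<bar>J s - J b\<bar> < e / 2" by (rule d2(2)) (use s h h' ab in auto)
        then show ?thesis by linarith
      qed
    qed (use h h' ab in \<open>auto intro!: integrable_continuous_real c\<close>)
    moreover have "integral {a - h..a} J \<le> integral {a - h..a} (\<lambda>s. J a + e / 2)"
    proof (rule Henstock_Kurzweil_Integration.integral_le)
      show "J s \<le> J a + e / 2" if s: "s \<in> {a - h..a}" for s
      proof -
        have "\<bar>J s - J a\<bar> < e / 2" by (rule d1(2)) (use s h h' ab in auto)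
        then show ?thesis by linarith
      qed
    qed (use h h' ab in \<open>auto intro!: integrable_continuous_real c\<close>)
    ultimately have "h * (J b - e / 2) \<le> integral {b - h..b} J" "integral {a - h..a} J \<le> h * (J a + e / 2)"
      using h by auto
    then show "h * (J b - J a - e) \<le> (LINT s|lborel. indicator {a..b} s * (J s - J (s - h)))"
      unfolding eq by (simp add: algebra_simps)
  qed
  ultimately show thesis using that by blast
qed

text \<open>In \<open>q t s x\<close> the variable t is the running time and s the time at which the
  test function is frozen. The increment inequality is integrated over s and divided by h; replacing
  t by s costs an error that the shift continuity \<open>qc\<close> makes small on average, and only
  the diagonal t = s is left.\<close>

lemma steklov_limit:
  fixes q :: "real \<Rightarrow> real \<Rightarrow> 'a::euclidean_space \<Rightarrow> real" and J :: "real \<Rightarrow> real"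
  assumes J: "continuous_on {0..T} J" and ab: "0 < a" "a < b" "b < T" and h0: "h0 > 0"
    and qm: "(\<lambda>p. q (fst p) (fst (snd p)) (snd (snd p))) \<in> borel_measurable borel"
    and qi: "integrable (lborel \<Otimes>\<^sub>M lborel) (\<lambda>p. q (fst p) (fst p) (snd p))"
    and q0: "\<And>s x. s \<notin> {a..b} \<Longrightarrow> q s s x = 0"
    and qc: "\<And>h. h \<longlonglongrightarrow> 0 \<Longrightarrow> (\<lambda>n. \<integral>\<^sup>+s. \<integral>\<^sup>+x. ennreal \<bar>q (s - h n) s x - q s s x\<bar> \<partial>lborel \<partial>lborel) \<longlonglongrightarrow> 0"
    and ineq: "\<And>h. 0 < h \<Longrightarrow> h < h0 \<Longrightarrow> AE s in lborel. s \<in> {a..b} \<longrightarrow>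
      J s - J (s - h) \<le> (LINT t|lborel. indicator {s - h..s} t * (LINT x|lborel. q t s x))"
  shows "J b - J a \<le> (LINT s|lborel. LINT x|lborel. q s s x)"
proof (rule field_le_epsilon)
  fix e :: real assume e: "e > 0"
  have qmeas: "(\<lambda>p. q (f p) (g p) (k p)) \<in> borel_measurable N"
    if "f \<in> borel_measurable N" "g \<in> borel_measurable N" "k \<in> borel_measurable N"
    for f g and k :: "'z \<Rightarrow> 'a" and N
  proof -
    have "(\<lambda>p. (f p, g p, k p)) \<in> borel_measurable N" using that by (intro borel_measurable_Pair)
    from measurable_compose[OF this qm] show ?thesis by simp
  qed
  define D where "D r s = (\<integral>\<^sup>+x. ennreal \<bar>q (s - r) s x - q s s x\<bar> \<partial>lborel)" for r s
  define A where "A t s = (LINT x|lborel. q t s x)" for t s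
  have Dm: "(\<lambda>p. D (f p) (g p)) \<in> borel_measurable N"
    if [measurable]: "f \<in> borel_measurable N" "g \<in> borel_measurable N" for f g and N :: "'z measure"
    unfolding D_def
    by (rule lborel.borel_measurable_nn_integral, unfold case_prod_beta,
        intro measurable_compose[OF _ measurable_ennreal] borel_measurable_abs borel_measurable_diff qmeas) measurable
  have Am: "(\<lambda>p. A (f p) (g p)) \<in> borel_measurable N"
    if [measurable]: "f \<in> borel_measurable N" "g \<in> borel_measurable N" for f g and N :: "'z measure"
    unfolding A_def
    by (rule lborel.borel_measurable_lebesgue_integral, unfold case_prod_beta, intro qmeas) measurable
  \<comment> \<open>Continuity is assumed along sequences, but the average over r in [0, h] needs a
    bound uniform in r; a violating sequence of shifts would contradict the hypothesis.\<close>
  have "\<exists>d>0. \<forall>r. 0 \<le> r \<and> r < d \<longrightarrow> (\<integral>\<^sup>+s. D r s \<partial>lborel) \<le> ennreal (e / 2)"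
  proof (rule ccontr)
    assume "\<not> ?thesis"
    then have "\<forall>n. \<exists>r. 0 \<le> r \<and> r < inverse (real (Suc n)) \<and> (\<integral>\<^sup>+s. D r s \<partial>lborel) > ennreal (e / 2)"
      by (metis inverse_positive_iff_positive not_le of_nat_0_less_iff zero_less_Suc)
    then obtain h where h: "\<And>n. 0 \<le> h n" "\<And>n. h n < inverse (real (Suc n))"
      "\<And>n. (\<integral>\<^sup>+s. D (h n) s \<partial>lborel) > ennreal (e / 2)" by metis
    have "h \<longlonglongrightarrow> 0"
      by (rule Lim_null_comparison[OF always_eventually LIMSEQ_inverse_real_of_nat]) (use h(1,2) in \<open>auto simp: less_imp_le\<close>)
    from qc[OF this] have "(\<lambda>n. \<integral>\<^sup>+s. D (h n) s \<partial>lborel) \<longlonglongrightarrow> 0" by (simp add: D_def)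
    then have "eventually (\<lambda>n. (\<integral>\<^sup>+s. D (h n) s \<partial>lborel) < ennreal (e / 2)) sequentially"
      using e by (intro order_tendstoD(2)) auto
    then obtain n where "(\<integral>\<^sup>+s. D (h n) s \<partial>lborel) < ennreal (e / 2)" unfolding eventually_sequentially by auto
    with h(3)[of n] show False by simp
  qed
  then obtain d1 where d1: "d1 > 0" "\<And>r. 0 \<le> r \<Longrightarrow> r < d1 \<Longrightarrow> (\<integral>\<^sup>+s. D r s \<partial>lborel) \<le> ennreal (e / 2)" by blast
  obtain d2 where d2: "d2 > 0" "\<And>h. 0 < h \<Longrightarrow> h < d2 \<Longrightarrow> integrable lborel (\<lambda>s. indicator {a..b} s * (J s - J (s - h)))"
    "\<And>h. 0 < h \<Longrightarrow> h < d2 \<Longrightarrow> h * (J b - J a - e / 2) \<le> (LINT s|lborel. indicator {a..b} s * (J s - J (s - h)))"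
    using integral_increment_average[OF J ab, of "e / 2"] e by auto
  define h where "h = min (min d1 d2) h0 / 2"
  have h: "0 < h" "h < d1" "h < d2" "h < h0" using d1(1) d2(1) h0 by (auto simp: h_def)
  define Err where "Err s = (\<integral>\<^sup>+r. indicator {0..h} r * D r s \<partial>lborel)" for s
  have Errm[measurable]: "Err \<in> borel_measurable lborel"
    unfolding Err_def[abs_def]
    by (rule lborel.borel_measurable_nn_integral, unfold case_prod_beta, intro borel_measurable_times_ennreal Dm) measurable
  have Err: "(\<integral>\<^sup>+s. Err s \<partial>lborel) \<le> ennreal (h * (e / 2))"
  proof -
    have "(\<integral>\<^sup>+s. Err s \<partial>lborel) = (\<integral>\<^sup>+r. \<integral>\<^sup>+s. indicator {0..h} r * D r s \<partial>lborel \<partial>lborel)"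
      unfolding Err_def
      by (rule lborel_pair.Fubini', unfold case_prod_beta, intro borel_measurable_times_ennreal Dm) measurable
    also have "\<dots> = (\<integral>\<^sup>+r. indicator {0..h} r * (\<integral>\<^sup>+s. D r s \<partial>lborel) \<partial>lborel)"
      by (intro nn_integral_cong nn_integral_cmult Dm) auto
    also have "\<dots> \<le> (\<integral>\<^sup>+r. ennreal (e / 2) * indicator {0..h} r \<partial>lborel)"
      using h by (intro nn_integral_mono) (auto simp: indicator_def intro!: d1(2))
    also have "\<dots> = ennreal (h * (e / 2))"
      by (subst nn_integral_cmult_indicator) (use h e in \<open>auto simp: ennreal_mult'[symmetric] mult.commute\<close>)
    finally show ?thesis .
  qed
  have Errfin: "AE s in lborel. Err s < \<infinity>"
    using nn_integral_PInf_AE[OF Errm] le_less_trans[OF Err ennreal_less_top] by (auto simp: less_top)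
  have Qi: "AE s in lborel. integrable lborel (q s s)"
    using lborel_pair.AE_integrable_fst'[OF qi] by simp
  have AQi: "integrable lborel (\<lambda>s. A s s)"
    using lborel_pair.integrable_fst'[OF qi] by (simp add: A_def)
  \<comment> \<open>The inequality involves integrals over t for a fixed s; it is turned into one in
    s alone, with the diagonal value weighted by the length h.\<close>
  have key: "AE s in lborel. indicator {a..b} s * (J s - J (s - h)) \<le> h * A s s + enn2real (Err s)"
    using ineq[OF h(1,4)] Errfin Qi
  proof eventually_elim
    case (elim s)
    show ?case
    proof (cases "s \<in> {a..b}")
      case False
      have "q s s = (\<lambda>_. 0)" using q0[OF False] by auto
      then have "A s s = 0" by (simp add: A_def)
      with False show ?thesis by simp
    next
      case True
      have Dfin: "AE r in lborel. indicator {0..h} r * D r s \<noteq> \<infinity>"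
        using elim(2) unfolding Err_def
        by (intro nn_integral_PInf_AE) (auto intro!: borel_measurable_times_ennreal Dm)
      have EI: "(\<integral>\<^sup>+r. ennreal (indicator {0..h} r * enn2real (D r s)) \<partial>lborel) = Err s"
        unfolding Err_def
      proof (rule nn_integral_cong_AE, use Dfin in eventually_elim)
        case (elim r)
        then show ?case by (cases "r \<in> {0..h}") (auto simp: less_top)
      qed
      have Em: "(\<lambda>r. indicator {0..h} r * enn2real (D r s)) \<in> borel_measurable lborel"
        by (intro borel_measurable_times measurable_compose[OF Dm borel_measurable_enn2real]) auto
      have Ei: "integrable lborel (\<lambda>r. indicator {0..h} r * enn2real (D r s))"
        using elim(2) EI by (intro integrableI_nonneg Em) auto
      have Ev: "(LINT r|lborel. indicator {0..h} r * enn2real (D r s)) = enn2real (Err s)"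
        unfolding EI[symmetric] by (intro integral_eq_nn_integral Em) auto
      have bnd: "AE r in lborel. \<bar>indicator {0..h} r * (A (s - r) s - A s s)\<bar> \<le> indicator {0..h} r * enn2real (D r s)"
        using Dfin
      proof eventually_elim
        case (elim r)
        show ?case
        proof (cases "r \<in> {0..h}")
          case True
          then have Df: "D r s < \<infinity>" using elim by (simp add: less_top)
          have m: "(\<lambda>x. q (s - r) s x - q s s x) \<in> borel_measurable lborel"
            by (intro borel_measurable_diff qmeas) auto
          have i: "integrable lborel (\<lambda>x. q (s - r) s x - q s s x)"
            using Df m by (simp add: integrable_iff_bounded D_def)
          have i2: "integrable lborel (q (s - r) s)"
            using Bochner_Integration.integrable_add[OF i \<open>integrable lborel (q s s)\<close>] by simp
          have "\<bar>A (s - r) s - A s s\<bar> = \<bar>LINT x|lborel. q (s - r) s x - q s s x\<bar>"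
            unfolding A_def using i2 \<open>integrable lborel (q s s)\<close> by simp
          also have "\<dots> \<le> (LINT x|lborel. \<bar>q (s - r) s x - q s s x\<bar>)" by (rule integral_abs_bound)
          also have "\<dots> = enn2real (D r s)"
            unfolding D_def using m by (intro integral_eq_nn_integral) auto
          finally show ?thesis using True by simp
        qed simp
      qed
      have di: "integrable lborel (\<lambda>r. indicator {0..h} r * (A (s - r) s - A s s))"
      proof (rule Bochner_Integration.integrable_bound[OF Ei])
        show "(\<lambda>r. indicator {0..h} r * (A (s - r) s - A s s)) \<in> borel_measurable lborel"
          by (intro borel_measurable_times borel_measurable_diff Am) auto
        show "AE r in lborel. norm (indicator {0..h} r * (A (s - r) s - A s s)) \<le> norm (indicator {0..h} r * enn2real (D r s))"
          using bnd by eventually_elim simp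
      qed
      have ci: "integrable lborel (\<lambda>r. indicator {0..h} r * A s s)"
        using h(1) by (intro integrable_mult_left integrable_real_indicator) auto
      have "J s - J (s - h) \<le> (LINT t|lborel. indicator {s - h..s} t * A t s)"
        using elim(1) True by (simp add: A_def)
      \<comment> \<open>The substitution t = s - r moves the window [s - h, s] to [0, h], which no
        longer depends on s.\<close>
      also have "\<dots> = (LINT r|lborel. indicator {s - h..s} (s + (-1) * r) * A (s + (-1) * r) s)"
        by (subst lborel_integral_real_affine[of "-1" _ s]) auto
      also have "\<dots> = (LINT r|lborel. indicator {0..h} r * (A (s - r) s - A s s) + indicator {0..h} r * A s s)"
        by (intro Bochner_Integration.integral_cong) (auto simp: indicator_def algebra_simps)
      also have "\<dots> = (LINT r|lborel. indicator {0..h} r * (A (s - r) s - A s s)) + h * A s s"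
        using di ci h(1) by simp
      also have "(LINT r|lborel. indicator {0..h} r * (A (s - r) s - A s s)) \<le> (LINT r|lborel. indicator {0..h} r * enn2real (D r s))"
        using bnd by (intro integral_mono_AE di Ei) (auto elim!: eventually_mono)
      finally show ?thesis using True Ev by simp
    qed
  qed
  have EE: "(\<integral>\<^sup>+s. ennreal (enn2real (Err s)) \<partial>lborel) \<le> ennreal (h * (e / 2))"
    using Err by (subst nn_integral_cong_AE[of _ Err]) (use Errfin in \<open>auto elim!: eventually_mono\<close>)
  have Ei: "integrable lborel (\<lambda>s. enn2real (Err s))"
    using EE by (intro integrableI_nonneg) (auto simp: le_less_trans)
  have Eb: "(LINT s|lborel. enn2real (Err s)) \<le> h * (e / 2)"
  proof -
    have "(LINT s|lborel. enn2real (Err s)) = enn2real (\<integral>\<^sup>+s. ennreal (enn2real (Err s)) \<partial>lborel)"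
      by (rule integral_eq_nn_integral) auto
    also have "\<dots> \<le> h * (e / 2)" by (rule enn2real_leI[OF _ EE]) (use h e in simp)
    finally show ?thesis .
  qed
  have "h * (J b - J a - e / 2) \<le> (LINT s|lborel. indicator {a..b} s * (J s - J (s - h)))"
    by (rule d2(3)[OF h(1,3)])
  also have "\<dots> \<le> (LINT s|lborel. h * A s s + enn2real (Err s))"
    by (intro integral_mono_AE d2(2)[OF h(1,3)] key Bochner_Integration.integrable_add integrable_mult_right AQi Ei)
  also have "\<dots> = h * (LINT s|lborel. A s s) + (LINT s|lborel. enn2real (Err s))"
    using AQi Ei by simp
  also have "\<dots> \<le> h * ((LINT s|lborel. A s s) + e / 2)" using Eb by (simp add: algebra_simps)
  finally have "J b - J a - e / 2 \<le> (LINT s|lborel. A s s) + e / 2" using h(1) by simp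
  then show "J b - J a \<le> (LINT s|lborel. LINT x|lborel. q s s x) + e" by (simp add: A_def)
qed

section \<open>Iterated integrals over the cylinder\<close>

lemma AE_lborel_pair:
  fixes P :: "'a::euclidean_space \<times> 'b::euclidean_space \<Rightarrow> bool"
  assumes "AE p in lborel. P p"
  shows "AE t in lborel. AE x in lborel. P (t, x)"
  using assms unfolding lborel_prod[symmetric] by (rule lborel_pair.AE_pair)

lemma cylinder_sets: "open \<Omega> \<Longrightarrow> cylinder T \<Omega> \<in> sets borel"
  by (auto simp: cylinder_def intro!: borel_Times)

lemma AE_cylinder:
  fixes \<Omega> :: "'a::euclidean_space set"
  assumes "open \<Omega>" "AE (t, x) in lebesgue_on (cylinder T \<Omega>). P t x"
  shows "AE p in lborel. p \<in> cylinder T \<Omega> \<longrightarrow> P (fst p) (snd p)"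
proof -
  have L: "cylinder T \<Omega> \<in> sets lebesgue" using cylinder_sets[OF assms(1)] by simp
  show ?thesis using assms(2) unfolding AE_lebesgue_on_iff[OF L] by (simp add: case_prod_unfold)
qed

lemma cylinder_borel_rep:
  fixes f :: "real \<Rightarrow> 'a::euclidean_space \<Rightarrow> 'b::euclidean_space"
  assumes "open \<Omega>" "case_prod f \<in> borel_measurable (lebesgue_on (cylinder T \<Omega>))"
  obtains f' where "f' \<in> borel_measurable borel" "AE p in lborel. p \<in> cylinder T \<Omega> \<longrightarrow> case_prod f p = f' p"
    "AE t in lborel. t \<in> {0<..<T} \<longrightarrow> (AE x in lborel. x \<in> \<Omega> \<longrightarrow> f t x = f' (t, x))"
proof -
  have L: "cylinder T \<Omega> \<in> sets lebesgue" using cylinder_sets[OF assms(1)] by simp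
  obtain f' where f': "f' \<in> borel_measurable borel" "AE p in lborel. p \<in> cylinder T \<Omega> \<longrightarrow> case_prod f p = f' p"
    using lebesgue_on_ex_borel_measurable[OF assms(2) L] by blast
  have "AE t in lborel. t \<in> {0<..<T} \<longrightarrow> (AE x in lborel. x \<in> \<Omega> \<longrightarrow> f t x = f' (t, x))"
    using AE_lborel_pair[OF f'(2)] by eventually_elim (auto simp: cylinder_def elim!: eventually_mono)
  with f' show thesis by (rule that)
qed

lemma borel_measurable_section:
  fixes f :: "'a::euclidean_space \<times> 'b::euclidean_space \<Rightarrow> 'c::euclidean_space"
  assumes "f \<in> borel_measurable borel"
  shows "(\<lambda>x. f (t, x)) \<in> borel_measurable borel"
proof -
  have "(\<lambda>x. (t, x)) \<in> (borel :: 'b measure) \<rightarrow>\<^sub>M borel" by (intro borel_measurable_Pair) auto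
  from measurable_compose[OF this assms] show ?thesis .
qed

lemma lborel_integral_fst:
  fixes f :: "'a::euclidean_space \<times> 'b::euclidean_space \<Rightarrow> 'c::euclidean_space"
  assumes "integrable lborel f"
  shows "integrable lborel (\<lambda>t. LINT x|lborel. f (t, x))"
    "(LINT t|lborel. LINT x|lborel. f (t, x)) = (LINT p|lborel. f p)"
proof -
  have i: "integrable (lborel \<Otimes>\<^sub>M lborel) f" using assms by (simp add: lborel_prod)
  show "integrable lborel (\<lambda>t. LINT x|lborel. f (t, x))" by (rule lborel_pair.integrable_fst'[OF i])
  show "(LINT t|lborel. LINT x|lborel. f (t, x)) = (LINT p|lborel. f p)"
    using lborel_pair.integral_fst'[OF i] by (simp add: lborel_prod)
qed

text \<open>The integrand is controlled only for almost every t, and for such t only up to a null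
  set in x. Replacing the inner integrals by those of the Borel representative makes the outer
  integrand measurable, and Fubini applies.\<close>

lemma iterated_integral_rep:
  fixes F :: "real \<Rightarrow> 'a::euclidean_space \<Rightarrow> real"
  assumes "open \<Omega>" "F' \<in> borel_measurable borel"
    "AE t in lborel. t \<in> {c..d} \<longrightarrow> (AE x in lborel. x \<in> \<Omega> \<longrightarrow> F t x = F' (t, x))"
    "integrable lborel (\<lambda>p. indicator ({c..d} \<times> \<Omega>) p * F' p)"
  shows "(LINT t|lebesgue_on {c..d}. LINT x|lebesgue_on \<Omega>. F t x) = (LINT p|lborel. indicator ({c..d} \<times> \<Omega>) p * F' p)"
proof -
  have \<Omega>: "\<Omega> \<in> sets borel" using assms(1) by simp
  define A where "A t = (LINT x|lborel. indicator ({c..d} \<times> \<Omega>) (t, x) * F' (t, x))" for t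
  have A: "A \<in> borel_measurable borel"
    using borel_measurable_integrable[OF lborel_integral_fst(1)[OF assms(4)]] unfolding A_def by simp
  have "AE t in lborel. t \<in> {c..d} \<longrightarrow> (LINT x|lebesgue_on \<Omega>. F t x) = A t"
    using assms(3)
  proof eventually_elim
    case (elim t)
    show ?case
    proof
      assume t: "t \<in> {c..d}"
      have "(LINT x|lebesgue_on \<Omega>. F t x) = (LINT x|lborel. indicator \<Omega> x *\<^sub>R F' (t, x))"
        by (rule lebesgue_on_lborel_integral[OF \<Omega> borel_measurable_section[OF assms(2)]]) (use elim t in simp)
      then show "(LINT x|lebesgue_on \<Omega>. F t x) = A t" using t by (simp add: A_def indicator_times)
    qed
  qed
  then have "(LINT t|lebesgue_on {c..d}. LINT x|lebesgue_on \<Omega>. F t x) = (LINT t|lborel. indicator {c..d} t *\<^sub>R A t)"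
    by (intro lebesgue_on_lborel_integral A) auto
  also have "(\<lambda>t. indicator {c..d} t *\<^sub>R A t) = A"
  proof
    show "indicator {c..d} t *\<^sub>R A t = A t" for t by (cases "t \<in> {c..d}") (simp_all add: A_def indicator_times)
  qed
  also have "(LINT t|lborel. A t) = (LINT p|lborel. indicator ({c..d} \<times> \<Omega>) p * F' p)"
    unfolding A_def by (rule lborel_integral_fst(2)[OF assms(4)])
  finally show ?thesis .
qed

text \<open>Tonelli for the square: slicewise L^2 bounds with an integrable majorant in time give
  square integrability on the product, once joint measurability is known.\<close>

lemma L2_joint:
  fixes u :: "real \<times> 'a::euclidean_space \<Rightarrow> 'b::euclidean_space"
  assumes "open \<Omega>" "u \<in> borel_measurable borel" "integrable (lebesgue_on {c..d}) N"
    "AE t in lborel. t \<in> {c..d} \<longrightarrow> integrable lborel (\<lambda>x. indicator \<Omega> x * (norm (u (t, x)))\<^sup>2) \<and>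
       (LINT x|lborel. indicator \<Omega> x * (norm (u (t, x)))\<^sup>2) \<le> N t"
  shows "(\<lambda>p. indicator ({c..d} \<times> \<Omega>) p *\<^sub>R u p) \<in> L2 lborel"
proof -
  have [measurable]: "\<Omega> \<in> sets borel" "u \<in> borel_measurable borel" using assms(1,2) by simp_all
  have [measurable]: "{c..d} \<times> \<Omega> \<in> sets borel" by (intro borel_Times) auto
  define R where "R p = ennreal (indicator ({c..d} \<times> \<Omega>) p * (norm (u p))\<^sup>2)" for p
  have [measurable]: "R \<in> borel_measurable borel" unfolding R_def[abs_def] by measurable
  obtain N' where N': "N' \<in> borel_measurable borel" "AE t in lborel. t \<in> {c..d} \<longrightarrow> N t = N' t"
    using lebesgue_on_ex_borel_measurable[OF borel_measurable_integrable[OF assms(3)], of thesis] by simp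
  have N'i: "integrable lborel (\<lambda>t. indicator {c..d} t *\<^sub>R N' t)"
    using lebesgue_on_lborel_integrable[OF _ N', of] assms(3) by simp
  have "(\<integral>\<^sup>+p. R p \<partial>lborel) = (\<integral>\<^sup>+t. \<integral>\<^sup>+x. R (t, x) \<partial>lborel \<partial>lborel)"
    using lborel.nn_integral_fst[of R "lborel :: real measure"] by (simp add: lborel_prod borel_prod)
  also have "\<dots> \<le> (\<integral>\<^sup>+t. ennreal (indicator {c..d} t *\<^sub>R N' t) \<partial>lborel)"
  proof (rule nn_integral_mono_AE, use assms(4) N'(2) in eventually_elim)
    case (elim t)
    show ?case
    proof (cases "t \<in> {c..d}")
      case True
      with elim have i: "integrable lborel (\<lambda>x. indicator \<Omega> x * (norm (u (t, x)))\<^sup>2)"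
        and le: "(LINT x|lborel. indicator \<Omega> x * (norm (u (t, x)))\<^sup>2) \<le> N' t" by auto
      have "(\<integral>\<^sup>+x. R (t, x) \<partial>lborel) = (\<integral>\<^sup>+x. ennreal (indicator \<Omega> x * (norm (u (t, x)))\<^sup>2) \<partial>lborel)"
        using True by (simp add: R_def indicator_times)
      also have "\<dots> = ennreal (LINT x|lborel. indicator \<Omega> x * (norm (u (t, x)))\<^sup>2)"
        by (rule nn_integral_eq_integral[OF i]) simp
      finally show ?thesis using le True by (simp add: ennreal_leI)
    qed (simp add: R_def indicator_times)
  qed
  also have "\<dots> < \<infinity>" using N'i by (auto simp: real_integrable_def less_top)
  finally have fin: "(\<integral>\<^sup>+p. R p \<partial>lborel) < \<infinity>" .
  have e: "(norm (indicator ({c..d} \<times> \<Omega>) p *\<^sub>R u p))\<^sup>2 = indicator ({c..d} \<times> \<Omega>) p * (norm (u p))\<^sup>2" for p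
    by (simp add: indicator_def)
  show ?thesis unfolding L2_def
  proof (intro CollectI conjI)
    show "(\<lambda>p. indicator ({c..d} \<times> \<Omega>) p *\<^sub>R u p) \<in> borel_measurable lborel" by measurable
    show "integrable lborel (\<lambda>p. (norm (indicator ({c..d} \<times> \<Omega>) p *\<^sub>R u p))\<^sup>2)"
      unfolding e by (rule integrableI_nonneg) (use fin in \<open>auto simp: R_def\<close>)
  qed
qed

lemma emeasure_Icc_times_finite:
  fixes \<Omega> :: "'a::euclidean_space set"
  assumes "open \<Omega>" "bounded \<Omega>"
  shows "emeasure lborel ({c..d::real} \<times> \<Omega>) < \<infinity>"
  by (rule emeasure_bounded_finite) (intro bounded_Times assms bounded_closed_interval)

lemma L2_support_integrable:
  fixes u :: "'a::euclidean_space \<Rightarrow> 'b::euclidean_space"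
  assumes "u \<in> L2 lborel" "\<And>x. x \<notin> A \<Longrightarrow> u x = 0" "A \<in> sets borel" "emeasure lborel A < \<infinity>"
  shows "integrable lborel u"
proof (rule Bochner_Integration.integrable_bound)
  show "integrable lborel (\<lambda>x. indicator A x + (norm (u x))\<^sup>2)"
    using assms L2_integrable_sq by (intro Bochner_Integration.integrable_add) auto
  have "norm (u x) \<le> norm (indicator A x + (norm (u x))\<^sup>2)" for x
  proof (cases "x \<in> A")
    case True
    then show ?thesis using sum_squares_bound[of "norm (u x)" 1] norm_ge_zero[of "u x"] by (simp del: norm_ge_zero)
  qed (simp add: assms(2))
  then show "AE x in lborel. norm (u x) \<le> norm (indicator A x + (norm (u x))\<^sup>2)" by simp
qed (use L2_measurable[OF assms(1)] in simp)

text \<open>The time shift acts only on the factors \<open>k0\<close> and \<open>G0\<close>. The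
  source term is merely in L^1 and is paired with a bounded function; the flux is in L^2 and is
  paired with an L^2 gradient. These are the two kinds of translation continuity established
  above.\<close>

lemma steklov_pairing:
  fixes G0 H0 :: "real \<times> 'a::euclidean_space \<Rightarrow> 'a" and k0 K0 :: "real \<times> 'a \<Rightarrow> real" and J :: "real \<Rightarrow> real"
  assumes J: "continuous_on {0..T} J" and ab: "0 < a" "a < b" "b < T" and h0: "h0 > 0"
    and G: "integrable lborel G0" "G0 \<in> L2 lborel" and H: "H0 \<in> L2 lborel"
    and k: "integrable lborel k0" and K: "K0 \<in> borel_measurable borel" "\<And>p. \<bar>K0 p\<bar> \<le> 1"
    and supp: "\<And>s x. s \<notin> {a..b} \<Longrightarrow> H0 (s, x) = 0" "\<And>s x. s \<notin> {a..b} \<Longrightarrow> K0 (s, x) = 0"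
    and ineq: "\<And>h. 0 < h \<Longrightarrow> h < h0 \<Longrightarrow> AE s in lborel. s \<in> {a..b} \<longrightarrow>
      J s - J (s - h) \<le> (LINT t|lborel. indicator {s - h..s} t * (LINT x|lborel. k0 (t, x) * K0 (s, x) - G0 (t, x) \<bullet> H0 (s, x)))"
  shows "J b - J a \<le> (LINT p|lborel. k0 p * K0 p - G0 p \<bullet> H0 p)"
proof -
  have [measurable]: "G0 \<in> borel_measurable borel" "H0 \<in> borel_measurable borel" "k0 \<in> borel_measurable borel" "K0 \<in> borel_measurable borel"
    using borel_measurable_integrable[OF G(1)] L2_measurable[OF H] borel_measurable_integrable[OF k] K(1) by auto
  define q where "q t s x = k0 (t, x) * K0 (s, x) - G0 (t, x) \<bullet> H0 (s, x)" for t s x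
  have kK: "integrable lborel (\<lambda>p. k0 p * K0 p)"
    by (rule Bochner_Integration.integrable_bound[OF k])
      (auto simp: abs_mult intro!: mult_right_le_one_le K(2))
  have qi: "integrable lborel (\<lambda>p. k0 p * K0 p - G0 p \<bullet> H0 p)"
    by (intro Bochner_Integration.integrable_diff kK L2_integrable_inner G(2) H)
  have m: "(\<lambda>p. F (f p, g p)) \<in> borel_measurable N"
    if "f \<in> borel_measurable N" "g \<in> borel_measurable N" "F \<in> borel_measurable borel"
    for f and g :: "'z \<Rightarrow> 'a" and N and F :: "real \<times> 'a \<Rightarrow> 'c::euclidean_space"
  proof -
    have "(\<lambda>p. (f p, g p)) \<in> borel_measurable N" using that by (intro borel_measurable_Pair)
    from measurable_compose[OF this that(3)] show ?thesis .
  qed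
  have "J b - J a \<le> (LINT s|lborel. LINT x|lborel. q s s x)"
  proof (rule steklov_limit[where q=q, OF J ab h0])
    have 1: "fst \<in> borel_measurable (borel :: (real \<times> real \<times> 'a) measure)"
      "(\<lambda>p. fst (snd p)) \<in> borel_measurable (borel :: (real \<times> real \<times> 'a) measure)"
      "(\<lambda>p. snd (snd p)) \<in> borel_measurable (borel :: (real \<times> real \<times> 'a) measure)"
      by (intro borel_measurable_continuous_onI continuous_intros)+
    show "(\<lambda>p. q (fst p) (fst (snd p)) (snd (snd p))) \<in> borel_measurable borel"
      unfolding q_def by (intro borel_measurable_diff borel_measurable_times borel_measurable_inner m 1) measurable
    show "integrable (lborel \<Otimes>\<^sub>M lborel) (\<lambda>p. q (fst p) (fst p) (snd p))"
      using qi by (simp add: lborel_prod q_def)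
    show "q s s x = 0" if "s \<notin> {a..b}" for s x using supp that by (simp add: q_def)
    show "AE s in lborel. s \<in> {a..b} \<longrightarrow> J s - J (s - h) \<le> (LINT t|lborel. indicator {s - h..s} t * (LINT x|lborel. q t s x))"
      if "0 < h" "h < h0" for h unfolding q_def by (rule ineq[OF that])
    fix h :: "nat \<Rightarrow> real" assume h: "h \<longlonglongrightarrow> 0"
    \<comment> \<open>The shift is in the time direction only, viewed as a translation of
      space-time.\<close>
    define h' :: "nat \<Rightarrow> real \<times> 'a" where "h' n = (h n, 0)" for n
    have h': "h' \<longlonglongrightarrow> 0" using tendsto_Pair[OF h tendsto_const[of "0::'a"]] by (simp add: h'_def[abs_def] zero_prod_def)
    define B where "B n p = norm (G0 (p - h' n) - G0 p) * norm (H0 p) + norm (k0 (p - h' n) - k0 p)" for n p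
    have G0s: "(\<lambda>p. G0 (p - h' n)) \<in> L2 lborel" for n
      using lborel_shift(1)[of "\<lambda>x. (norm (G0 x))\<^sup>2" "h' n"] G(2) by (auto simp: L2_def)
    have L2n: "(\<lambda>p. norm (F p)) \<in> L2 lborel" if "F \<in> L2 lborel" for F :: "real \<times> 'a \<Rightarrow> 'a"
      using that by (auto simp: L2_def)
    have i1: "integrable lborel (\<lambda>p. norm (G0 (p - h' n) - G0 p) * norm (H0 p))" for n
      using L2_integrable_inner[OF L2n[OF L2_diff[OF G0s G(2)]] L2n[OF H]] by simp
    have i2: "integrable lborel (\<lambda>p. norm (k0 (p - h' n) - k0 p))" for n
      using k lborel_shift(1)[of k0 "h' n"] by (intro integrable_norm Bochner_Integration.integrable_diff) auto
    have Bi: "integrable lborel (B n)" for n unfolding B_def by (intro Bochner_Integration.integrable_add i1 i2)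
    have "(\<lambda>n. (LINT p|lborel. norm (G0 (p - h' n) - G0 p) * norm (H0 p)) + (LINT p|lborel. norm (k0 (p - h' n) - k0 p))) \<longlonglongrightarrow> 0 + 0"
      by (intro tendsto_add translation_L2_pairing translation_L1 G H k h')
    then have "(\<lambda>n. LINT p|lborel. B n p) \<longlonglongrightarrow> 0" using i1 i2 by (simp add: B_def)
    from tendsto_ennrealI[OF this] have lim: "(\<lambda>n. ennreal (LINT p|lborel. B n p)) \<longlonglongrightarrow> 0" by simp
    show "(\<lambda>n. \<integral>\<^sup>+s. \<integral>\<^sup>+x. ennreal \<bar>q (s - h n) s x - q s s x\<bar> \<partial>lborel \<partial>lborel) \<longlonglongrightarrow> 0"
    proof (rule tendsto_sandwich[OF _ _ tendsto_const lim])
      have "(\<integral>\<^sup>+s. \<integral>\<^sup>+x. ennreal \<bar>q (s - h n) s x - q s s x\<bar> \<partial>lborel \<partial>lborel) \<le> ennreal (LINT p|lborel. B n p)" for n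
      proof -
        have le: "\<bar>q (s - h n) s x - q s s x\<bar> \<le> B n (s, x)" for s x
        proof -
          have "q (s - h n) s x - q s s x = (k0 ((s, x) - h' n) - k0 (s, x)) * K0 (s, x) - (G0 ((s, x) - h' n) - G0 (s, x)) \<bullet> H0 (s, x)"
            by (simp add: q_def h'_def algebra_simps inner_diff_left)
          also have "\<bar>\<dots>\<bar> \<le> \<bar>(k0 ((s, x) - h' n) - k0 (s, x)) * K0 (s, x)\<bar> + \<bar>(G0 ((s, x) - h' n) - G0 (s, x)) \<bullet> H0 (s, x)\<bar>"
            by (rule abs_triangle_ineq4)
          also have "\<dots> \<le> \<bar>k0 ((s, x) - h' n) - k0 (s, x)\<bar> + norm (G0 ((s, x) - h' n) - G0 (s, x)) * norm (H0 (s, x))"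
            by (intro add_mono Cauchy_Schwarz_ineq2) (auto simp: abs_mult intro!: mult_right_le_one_le K(2))
          finally show ?thesis by (simp add: B_def)
        qed
        have "(\<integral>\<^sup>+s. \<integral>\<^sup>+x. ennreal \<bar>q (s - h n) s x - q s s x\<bar> \<partial>lborel \<partial>lborel) \<le> (\<integral>\<^sup>+s. \<integral>\<^sup>+x. ennreal (B n (s, x)) \<partial>lborel \<partial>lborel)"
          by (intro nn_integral_mono ennreal_leI le)
        also have "\<dots> = (\<integral>\<^sup>+p. ennreal (B n p) \<partial>lborel)"
          using lborel.nn_integral_fst[of "\<lambda>p. ennreal (B n p)" "lborel :: real measure"]
            borel_measurable_integrable[OF Bi[of n]] by (simp add: lborel_prod)
        also have "\<dots> = ennreal (LINT p|lborel. B n p)"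
          by (rule nn_integral_eq_integral[OF Bi]) (simp add: B_def)
        finally show ?thesis .
      qed
      then show "\<forall>\<^sub>F n in sequentially. (\<integral>\<^sup>+s. \<integral>\<^sup>+x. ennreal \<bar>q (s - h n) s x - q s s x\<bar> \<partial>lborel \<partial>lborel) \<le> ennreal (LINT p|lborel. B n p)"
        by simp
    qed simp
  qed
  also have "\<dots> = (LINT p|lborel. k0 p * K0 p - G0 p \<bullet> H0 p)"
    unfolding q_def by (rule lborel_integral_fst(2)[OF qi])
  finally show ?thesis .
qed

section \<open>Scalar inequalities\<close>

text \<open>The primitive S_r of F_r vanishing at 0. For y < 0 the interval is empty and the
  integral is 0, the correct value because F_r vanishes on the negative axis.\<close>

definition Sg :: "real \<Rightarrow> real \<Rightarrow> real" where
  "Sg r y = integral {0..y} (\<lambda>s. gexp 0 (r * s))"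

text \<open>The increment is an integral of the nondecreasing function F_r, which lies between its
  values at the two ends. The case split is due to the empty interval for negative
  arguments.\<close>

lemma Sg_diff:
  assumes "r > 0" "y \<le> y'"
  shows "(y' - y) * gexp 0 (r * y) \<le> Sg r y' - Sg r y" "Sg r y' - Sg r y \<le> (y' - y) * gexp 0 (r * y')"
proof -
  have c: "(\<lambda>s. gexp 0 (r * s)) integrable_on {l..u}" for l u
    by (intro integrable_continuous_real continuous_on_compose2[OF continuous_on_gexp[of UNIV]] continuous_intros) auto
  have bounds: "(u - l) * gexp 0 (r * l) \<le> integral {l..u} (\<lambda>s. gexp 0 (r * s))"
    "integral {l..u} (\<lambda>s. gexp 0 (r * s)) \<le> (u - l) * gexp 0 (r * u)" if "l \<le> u" for l u
  proof -
    have "integral {l..u} (\<lambda>s. gexp 0 (r * l)) \<le> integral {l..u} (\<lambda>s. gexp 0 (r * s))"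
      using assms(1) by (intro Henstock_Kurzweil_Integration.integral_le c gexp_0_mono) auto
    then show "(u - l) * gexp 0 (r * l) \<le> integral {l..u} (\<lambda>s. gexp 0 (r * s))" using that by simp
    have "integral {l..u} (\<lambda>s. gexp 0 (r * s)) \<le> integral {l..u} (\<lambda>s. gexp 0 (r * u))"
      using assms(1) by (intro Henstock_Kurzweil_Integration.integral_le c gexp_0_mono) auto
    then show "integral {l..u} (\<lambda>s. gexp 0 (r * s)) \<le> (u - l) * gexp 0 (r * u)" using that by simp
  qed
  have neg: "gexp 0 (r * t) = 0" if "t \<le> 0" for t
    using assms(1) that by (simp add: gexp_0_eq_0_iff mult_nonneg_nonpos)
  consider "0 \<le> y" | "y < 0" "0 \<le> y'" | "y' < 0" using assms by linarith
  then have "(y' - y) * gexp 0 (r * y) \<le> Sg r y' - Sg r y \<and> Sg r y' - Sg r y \<le> (y' - y) * gexp 0 (r * y')"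
  proof cases
    case 1
    have "Sg r y' - Sg r y = integral {y..y'} (\<lambda>s. gexp 0 (r * s))"
      unfolding Sg_def using Henstock_Kurzweil_Integration.integral_combine[of 0 y y' "\<lambda>s. gexp 0 (r * s)", OF 1 assms(2) c] by simp
    with bounds[OF assms(2)] show ?thesis by simp
  next
    case 2
    have "Sg r y = 0" using 2 by (simp add: Sg_def)
    moreover have "y' * gexp 0 (r * y') \<le> (y' - y) * gexp 0 (r * y')"
      using 2 gexp_nonneg by (intro mult_right_mono) auto
    moreover have "0 \<le> 0 * gexp 0 (r * 0)" by simp
    ultimately show ?thesis using bounds[OF 2(2)] neg[of y] 2 neg[of 0] by (simp add: Sg_def)
  next
    case 3
    then show ?thesis using assms neg by (simp add: Sg_def)
  qed
  then show "(y' - y) * gexp 0 (r * y) \<le> Sg r y' - Sg r y" "Sg r y' - Sg r y \<le> (y' - y) * gexp 0 (r * y')" by auto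
qed

text \<open>The tangent inequality of a convex function at y, valid on both sides of y. With y the
  later value it produces the test function frozen at the right end of the time window.\<close>

lemma Sg_convex:
  assumes "r > 0"
  shows "Sg r y - Sg r y' \<le> (y - y') * gexp 0 (r * y)"
proof (cases "y' \<le> y")
  case False
  then show ?thesis using Sg_diff(1)[OF assms, of y y'] by (simp add: algebra_simps)
qed (rule Sg_diff(2)[OF assms])

lemma Sg_lipschitz:
  assumes "r > 0"
  shows "\<bar>Sg r y - Sg r y'\<bar> \<le> \<bar>y - y'\<bar>"
proof -
  have *: "\<bar>Sg r u - Sg r l\<bar> \<le> \<bar>u - l\<bar>" if "l \<le> u" for l u
  proof -
    have "0 \<le> (u - l) * gexp 0 (r * l)" using that gexp_nonneg by simp
    moreover have "(u - l) * gexp 0 (r * u) \<le> (u - l) * 1" using that gexp_le_1 by (intro mult_left_mono) auto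
    ultimately show ?thesis using Sg_diff[OF assms that] that by simp
  qed
  show ?thesis using *[of y y'] *[of y' y] by (cases "y \<le> y'") (auto simp: abs_minus_commute)
qed

lemma Sg_bounds:
  assumes "r > 0"
  shows "0 \<le> Sg r y" "Sg r y \<le> max y 0"
proof -
  have z: "Sg r 0 = 0" by (simp add: Sg_def)
  have "0 \<le> Sg r y \<and> Sg r y \<le> max y 0"
  proof (cases "y \<ge> 0")
    case True
    have "0 \<le> (y - 0) * gexp 0 (r * 0)" using True gexp_nonneg by simp
    then show ?thesis using Sg_diff(1)[OF assms True] Sg_lipschitz[OF assms, of y 0] True z by simp
  next
    case False
    then have "Sg r y = 0" by (simp add: Sg_def)
    then show ?thesis by simp
  qed
  then show "0 \<le> Sg r y" "Sg r y \<le> max y 0" by auto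
qed

text \<open>The upper bound is immediate. From below, S_r(y) is at least (y - d) F_r(d), and d is
  sent to 0 slowly enough that F_r(d) still tends to 1.\<close>

lemma Sg_tendsto: "(\<lambda>n. Sg (real (Suc n)) y) \<longlonglongrightarrow> max y 0"
proof (cases "y \<ge> 0")
  case True
  \<comment> \<open>With r = n + 1 this d tends to 0 while r d = \<open>sqrt r\<close> tends to
    infinity.\<close>
  define d where "d n = inverse (sqrt (real (Suc n)))" for n
  have sq: "filterlim (\<lambda>n. sqrt (real (Suc n))) at_top sequentially"
    by (rule filterlim_compose[OF sqrt_at_top filterlim_compose[OF filterlim_real_sequentially filterlim_Suc]])
  have d: "d \<longlonglongrightarrow> 0" unfolding d_def by (rule filterlim_compose[OF tendsto_inverse_0_at_top[OF filterlim_ident] sq])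
  have "real (Suc n) * d n = sqrt (real (Suc n))" for n
    by (simp add: d_def divide_inverse[symmetric] real_div_sqrt)
  then have l: "(\<lambda>n. gexp 0 (real (Suc n) * d n)) \<longlonglongrightarrow> 1" using gexp_0_tendsto_1[OF sq] by simp
  have low: "(y - d n) * gexp 0 (real (Suc n) * d n) \<le> Sg (real (Suc n)) y" for n
  proof (cases "d n \<le> y")
    case True
    have "(y - d n) * gexp 0 (real (Suc n) * d n) \<le> Sg (real (Suc n)) y - Sg (real (Suc n)) (d n)"
      using True by (intro Sg_diff) simp
    then show ?thesis using Sg_bounds(1)[of "real (Suc n)" "d n"] by simp
  next
    case False
    then have "(y - d n) * gexp 0 (real (Suc n) * d n) \<le> 0" by (intro mult_nonpos_nonneg gexp_nonneg) simp
    then show ?thesis using Sg_bounds(1)[of "real (Suc n)" y] by simp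
  qed
  have "(\<lambda>n. (y - d n) * gexp 0 (real (Suc n) * d n)) \<longlonglongrightarrow> (y - 0) * 1"
    by (intro tendsto_intros d l)
  then have l2: "(\<lambda>n. (y - d n) * gexp 0 (real (Suc n) * d n)) \<longlonglongrightarrow> max y 0" using True by simp
  show ?thesis
    by (rule tendsto_sandwich[OF _ _ l2 tendsto_const]) (use low Sg_bounds(2) in auto)
next
  case False
  then show ?thesis by (simp add: Sg_def)
qed

text \<open>For arguments of equal sign this is the mean value theorem for u^(\<theta> + 1), whose
  derivative is (\<theta> + 1) u^\<theta>. For opposite signs no cancellation occurs, and each term
  is bounded separately because |v| and |w| are both at most |v - w|.\<close>

lemma powr_mult_diff_le:
  fixes \<theta> v w :: real
  assumes "\<theta> > 0"
  shows "\<bar>\<bar>v\<bar> powr \<theta> * v - \<bar>w\<bar> powr \<theta> * w\<bar> \<le> (\<theta> + 1) * (\<bar>v\<bar> powr \<theta> + \<bar>w\<bar> powr \<theta>) * \<bar>v - w\<bar>"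
proof -
  have pos: "\<bar>x powr \<theta> * x - y powr \<theta> * y\<bar> \<le> (\<theta> + 1) * (x powr \<theta> + y powr \<theta>) * \<bar>x - y\<bar>"
    if "0 \<le> y" "y \<le> x" for x y :: real
  proof (cases "y = 0")
    \<comment> \<open>A zero end point is treated directly; the derivative formula for the power is
      used at positive points only.\<close>
    case True
    have "1 * (x powr \<theta> * x) \<le> (\<theta> + 1) * (x powr \<theta> * x)"
      using assms that by (intro mult_right_mono) auto
    then show ?thesis using True that assms by (simp add: abs_mult mult.assoc)
  next
    case False
    have y: "y > 0" using that False by simp
    have e: "u powr (\<theta> + 1) = u powr \<theta> * u" if "u > 0" for u
      using that by (simp add: powr_add)
    show ?thesis
    proof (cases "x = y")
      case False
      then have "y < x" using that by simp
      moreover have "((\<lambda>u. u powr (\<theta> + 1)) has_real_derivative (\<theta> + 1) * u powr \<theta>) (at u)" if "y \<le> u" "u \<le> x" for u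
        using that y by (auto intro!: derivative_eq_intros)
      ultimately obtain u where u: "y < u" "u < x" "x powr (\<theta> + 1) - y powr (\<theta> + 1) = (x - y) * ((\<theta> + 1) * u powr \<theta>)"
        using MVT2[of y x "\<lambda>u. u powr (\<theta> + 1)" "\<lambda>u. (\<theta> + 1) * u powr \<theta>"] by blast
      have "0 \<le> (x - y) * ((\<theta> + 1) * u powr \<theta>)" using u assms by simp
      moreover have "(x - y) * ((\<theta> + 1) * u powr \<theta>) \<le> (x - y) * ((\<theta> + 1) * (x powr \<theta> + y powr \<theta>))"
        using u assms y powr_mono2[of \<theta> u x] by (intro mult_left_mono) (auto intro: add_increasing2)
      ultimately show ?thesis using u(3) e[of x] e[of y] y u by (simp add: mult_ac)
    qed simp
  qed
  have sym: "\<bar>\<bar>v\<bar> powr \<theta> * v - \<bar>w\<bar> powr \<theta> * w\<bar> \<le> (\<theta> + 1) * (\<bar>v\<bar> powr \<theta> + \<bar>w\<bar> powr \<theta>) * \<bar>v - w\<bar>"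
    if "w \<le> v" for v w
  proof -
    consider "0 \<le> w" | "w < 0" "0 \<le> v" | "v < 0" using that by linarith
    then show ?thesis
    proof cases
      case 1
      then show ?thesis using pos[of w v] that by simp
    next
      case 2
      define A where "A = v powr \<theta> * v + (- w) powr \<theta> * (- w)"
      define B where "B = (v powr \<theta> + (- w) powr \<theta>) * (v - w)"
      have e: "\<bar>v\<bar> powr \<theta> * v - \<bar>w\<bar> powr \<theta> * w = A" using 2 by (simp add: A_def)
      have "0 \<le> v powr \<theta> * v" by (rule mult_nonneg_nonneg) (use 2 in auto)
      moreover have "0 \<le> (- w) powr \<theta> * (- w)" by (rule mult_nonneg_nonneg) (use 2 in auto)
      ultimately have A0: "0 \<le> A" unfolding A_def by linarith
      have "v powr \<theta> * v \<le> v powr \<theta> * (v - w)" by (rule mult_left_mono) (use 2 in auto)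
      moreover have "(- w) powr \<theta> * (- w) \<le> (- w) powr \<theta> * (v - w)" by (rule mult_left_mono) (use 2 in auto)
      ultimately have AB: "A \<le> B" unfolding A_def B_def distrib_right by linarith
      then have "1 * B \<le> (\<theta> + 1) * B" using assms A0 by (intro mult_right_mono) auto
      with AB A0 have "\<bar>A\<bar> \<le> (\<theta> + 1) * B" by linarith
      then show ?thesis unfolding e B_def using 2 by (simp add: mult.assoc)
    next
      case 3
      then show ?thesis using pos[of "- v" "- w"] that by (simp add: abs_minus_commute add.commute)
    qed
  qed
  show ?thesis
    using sym[of w v] sym[of v w] by (cases "w \<le> v") (auto simp: abs_minus_commute add.commute)
qed

text \<open>The drift is at most L |z| |D| by Cauchy-Schwarz, and Young's inequality lets
  ellipticity absorb |D|, leaving L^2 z^2 / (4 \<alpha>). The weight r \<open>gexp 2 (r * z)\<close>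
  is the derivative F_r'(z), and z^2 F_r'(z) <= 1/r converts the remainder into the stated
  bound.\<close>

lemma flux_lower_bound:
  fixes MD D e :: "'a::real_inner"
  assumes \<alpha>: "\<alpha> > 0" and r: "r > 0" and M: "\<alpha> * (norm D)\<^sup>2 \<le> MD \<bullet> D"
    and c: "\<bar>c\<bar> * norm e \<le> L * \<bar>z\<bar>" and L: "L \<ge> 0"
  shows "- ((MD + c *\<^sub>R e) \<bullet> ((r * gexp 2 (r * z)) *\<^sub>R D)) \<le> L\<^sup>2 / (4 * \<alpha> * r)"
proof -
  define g where "g = gexp 2 (r * z)"
  have g: "g \<ge> 0" by (simp add: g_def gexp_nonneg)
  \<comment> \<open>For positive y the product of \<open>gexp 2 y\<close> and y^2 is
    \<open>gexp 0 y\<close>, hence at most 1; this cancellation is the origin of the decay in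
    r.\<close>
  have gz: "g * (r * z)\<^sup>2 \<le> 1"
  proof (cases "r * z > 0")
    case True
    define y where "y = r * z"
    have "y > 0" using True by (simp add: y_def)
    then have "gexp 2 y * y\<^sup>2 = gexp 0 y" by (simp add: gexp_def power2_eq_square field_simps)
    then have "g * (r * z)\<^sup>2 = gexp 0 (r * z)" by (simp add: g_def y_def)
    then show ?thesis using gexp_le_1 by simp
  next
    case False
    then show ?thesis by (simp add: g_def gexp_def)
  qed
  have "\<bar>c * (e \<bullet> D)\<bar> \<le> \<bar>c\<bar> * (norm e * norm D)"
    unfolding abs_mult by (intro mult_left_mono Cauchy_Schwarz_ineq2) simp
  also have "\<dots> \<le> L * \<bar>z\<bar> * norm D" using c by (simp add: mult.assoc[symmetric] mult_right_mono)
  finally have ce: "\<bar>c * (e \<bullet> D)\<bar> \<le> L * \<bar>z\<bar> * norm D" .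
  \<comment> \<open>Completing the square is Young's inequality with the weight that cancels the
    elliptic term exactly.\<close>
  have "0 \<le> (2 * \<alpha> * norm D - L * \<bar>z\<bar>)\<^sup>2" by simp
  then have "4 * \<alpha> * (L * \<bar>z\<bar> * norm D - \<alpha> * (norm D)\<^sup>2) \<le> L\<^sup>2 * z\<^sup>2"
    by (simp add: power2_eq_square algebra_simps)
  then have "L * \<bar>z\<bar> * norm D - \<alpha> * (norm D)\<^sup>2 \<le> L\<^sup>2 * z\<^sup>2 / (4 * \<alpha>)"
    using \<alpha> by (simp add: field_simps)
  then have "- (MD \<bullet> D + c * (e \<bullet> D)) \<le> L\<^sup>2 * z\<^sup>2 / (4 * \<alpha>)" using M ce by linarith
  then have "r * g * - (MD \<bullet> D + c * (e \<bullet> D)) \<le> r * g * (L\<^sup>2 * z\<^sup>2 / (4 * \<alpha>))"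
    using r g by (intro mult_left_mono) auto
  also have "\<dots> = (g * (r * z)\<^sup>2) * (L\<^sup>2 / (4 * \<alpha> * r))" using r \<alpha> by (simp add: field_simps power2_eq_square)
  also have "\<dots> \<le> 1 * (L\<^sup>2 / (4 * \<alpha> * r))" using gz r \<alpha> by (intro mult_right_mono) auto
  finally show ?thesis by (simp add: g_def inner_add_left algebra_simps)
qed

text \<open>The norm of a matrix is the Euclidean norm of its row norms, so Cauchy-Schwarz in each
  row suffices.\<close>

lemma norm_matrix_vector_le: "norm ((A :: real^'n^'m) *v x) \<le> norm A * norm x"
proof -
  have "norm (A *v x) = L2_set (\<lambda>i. norm ((A *v x) $ i)) UNIV" by (simp add: norm_vec_def)
  also have "\<dots> \<le> L2_set (\<lambda>i. norm (A $ i) * norm x) UNIV"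
    by (intro L2_set_mono) (auto simp: matrix_vector_mul_component Cauchy_Schwarz_ineq2)
  also have "\<dots> = norm A * norm x" by (simp add: norm_vec_def L2_set_right_distrib[symmetric] L2_set_left_distrib)
  finally show ?thesis .
qed

lemma borel_measurable_matrix_vector:
  fixes A :: "'z \<Rightarrow> real^'n^'m"
  assumes "A \<in> borel_measurable N" "x \<in> borel_measurable N"
  shows "(\<lambda>p. A p *v x p) \<in> borel_measurable N"
proof (subst borel_measurable_euclidean_space, rule ballI)
  fix b :: "real^'m" assume "b \<in> Basis"
  then obtain i where b: "b = axis i 1" by (auto simp: Basis_vec_def)
  have "(\<lambda>A::real^'n^'m. A $ i $ j) \<in> borel_measurable borel" "(\<lambda>x::real^'n. x $ j) \<in> borel_measurable borel" for j
    by (intro borel_measurable_continuous_onI continuous_intros)+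
  then have "(\<lambda>p. A p $ i $ j) \<in> borel_measurable N" "(\<lambda>p. x p $ j) \<in> borel_measurable N" for j
    using measurable_compose[OF assms(1)] measurable_compose[OF assms(2)] by blast+
  then have "(\<lambda>p. \<Sum>j\<in>UNIV. A p $ i $ j * x p $ j) \<in> borel_measurable N"
    by (intro borel_measurable_sum borel_measurable_times)
  then show "(\<lambda>p. (A p *v x p) \<bullet> b) \<in> borel_measurable N"
    by (simp add: b inner_axis matrix_vector_mult_def)
qed

section \<open>The weak formulation for test functions constant in time\<close>

lemma AE_on_subinterval:
  assumes "AE t in lborel. t \<in> {0<..<T} \<longrightarrow> P t" "0 < c" "d < (T::real)"
  shows "AE t in lborel. t \<in> {c..d} \<longrightarrow> P t"
  using assms(1) by eventually_elim (use assms(2,3) in auto)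

lemma AE_lborel_snd:
  assumes "AE x in lborel. P x"
  shows "AE p in (lborel :: ('a::euclidean_space \<times> 'b::euclidean_space) measure). P (snd p)"
proof -
  obtain N where N: "N \<in> null_sets lborel" "{x. \<not> P x} \<subseteq> N"
    using assms by (auto simp: eventually_ae_filter)
  have "emeasure (lborel \<Otimes>\<^sub>M lborel) ((UNIV :: 'a set) \<times> N) = emeasure lborel (UNIV :: 'a set) * emeasure lborel N"
    using N(1) by (intro lborel.emeasure_pair_measure_Times) auto
  then have "(UNIV :: 'a set) \<times> N \<in> null_sets (lborel \<Otimes>\<^sub>M lborel)"
    using N(1) by (auto simp: null_sets_def)
  then have "(UNIV :: 'a set) \<times> N \<in> null_sets lborel" by (simp add: lborel_prod)
  from AE_not_in[OF this] show ?thesis by eventually_elim (use N(2) in auto)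
qed

lemma AE_lborel_fst:
  assumes "AE x in lborel. P x"
  shows "AE p in (lborel :: ('a::euclidean_space \<times> 'b::euclidean_space) measure). P (fst p)"
proof -
  obtain N where N: "N \<in> null_sets lborel" "{x. \<not> P x} \<subseteq> N"
    using assms by (auto simp: eventually_ae_filter)
  have "emeasure (lborel \<Otimes>\<^sub>M lborel) (N \<times> (UNIV :: 'b set)) = emeasure lborel N * emeasure lborel (UNIV :: 'b set)"
    using N(1) by (intro lborel.emeasure_pair_measure_Times) auto
  then have "N \<times> (UNIV :: 'b set) \<in> null_sets (lborel \<Otimes>\<^sub>M lborel)"
    using N(1) by (auto simp: null_sets_def)
  then have "N \<times> (UNIV :: 'b set) \<in> null_sets lborel" by (simp add: lborel_prod)
  from AE_not_in[OF this] show ?thesis by eventually_elim (use N(2) in auto)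
qed

lemma L2_section_lborel:
  fixes \<Omega> :: "'a::euclidean_space set" and h :: "'a \<Rightarrow> 'b::euclidean_space"
  assumes "open \<Omega>" "h \<in> L2 (lebesgue_on \<Omega>)" "h' \<in> borel_measurable borel" "AE x in lborel. x \<in> \<Omega> \<longrightarrow> h x = h' x"
  shows "integrable lborel (\<lambda>x. indicator \<Omega> x * (norm (h' x))\<^sup>2)"
    "(LINT x|lborel. indicator \<Omega> x * (norm (h' x))\<^sup>2) = (L2_norm (lebesgue_on \<Omega>) h)\<^sup>2"
proof -
  have \<Omega>: "\<Omega> \<in> sets borel" using assms(1) by simp
  have m: "(\<lambda>x. (norm (h' x))\<^sup>2) \<in> borel_measurable borel" using assms(3) by measurable
  have ae: "AE x in lborel. x \<in> \<Omega> \<longrightarrow> (norm (h x))\<^sup>2 = (norm (h' x))\<^sup>2"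
    using assms(4) by eventually_elim auto
  show "integrable lborel (\<lambda>x. indicator \<Omega> x * (norm (h' x))\<^sup>2)"
    using lebesgue_on_lborel_integrable[OF \<Omega> m ae] L2_integrable_sq[OF assms(2)] by simp
  show "(LINT x|lborel. indicator \<Omega> x * (norm (h' x))\<^sup>2) = (L2_norm (lebesgue_on \<Omega>) h)\<^sup>2"
    unfolding L2_norm_sq using lebesgue_on_lborel_integral[OF \<Omega> m ae] by simp
qed

text \<open>The majorant Q is controlled only slice by slice, without joint measurability. The Borel
  field b supplies the measurability on space-time, and Q only supplies the integrable bound in
  t.\<close>

lemma L2_time_majorant:
  fixes \<Omega> :: "'a::euclidean_space set" and b :: "real \<times> 'a \<Rightarrow> 'b::euclidean_space"
  assumes op: "open \<Omega>" and Q: "Q \<in> L2_loc_time (L2 (lebesgue_on \<Omega>)) (L2_norm (lebesgue_on \<Omega>)) T"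
    and b: "b \<in> borel_measurable borel"
    and le: "AE t in lborel. t \<in> {0<..<T} \<longrightarrow> (AE x in lborel. x \<in> \<Omega> \<longrightarrow> norm (b (t, x)) \<le> \<bar>Q t x\<bar>)"
    and cd: "0 < c" "c \<le> d" "d < T"
  shows "(\<lambda>p. indicator ({c..d} \<times> \<Omega>) p *\<^sub>R b p) \<in> L2 lborel"
proof (rule L2_joint[OF op b])
  have Qt: "Q \<in> L2_time (L2 (lebesgue_on \<Omega>)) (L2_norm (lebesgue_on \<Omega>)) {c..d}"
    using Q cd by (auto simp: L2_loc_time_def)
  then show "integrable (lebesgue_on {c..d}) (\<lambda>t. (L2_norm (lebesgue_on \<Omega>) (Q t))\<^sup>2)" by (simp add: L2_time_def)
  have "AE t in lebesgue_on {c..d}. Q t \<in> L2 (lebesgue_on \<Omega>)"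
    using Qt by (simp add: L2_time_def bochner_measurable_def)
  then have "AE t in lborel. t \<in> {c..d} \<longrightarrow> Q t \<in> L2 (lebesgue_on \<Omega>)"
    by (subst (asm) AE_lebesgue_on_iff) auto
  then show "AE t in lborel. t \<in> {c..d} \<longrightarrow> integrable lborel (\<lambda>x. indicator \<Omega> x * (norm (b (t, x)))\<^sup>2) \<and>
       (LINT x|lborel. indicator \<Omega> x * (norm (b (t, x)))\<^sup>2) \<le> (L2_norm (lebesgue_on \<Omega>) (Q t))\<^sup>2"
    using AE_on_subinterval[OF le cd(1,3)]
  proof eventually_elim
    case (elim t)
    show ?case
    proof
      assume t: "t \<in> {c..d}"
      with elim have Qt: "Q t \<in> L2 (lebesgue_on \<Omega>)" by simp
      have bm: "(\<lambda>x. b (t, x)) \<in> borel_measurable borel" by (rule borel_measurable_section[OF b])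
      have "AE x in lebesgue_on \<Omega>. norm (b (t, x)) \<le> \<bar>Q t x\<bar>"
        using elim t op by (subst AE_lebesgue_on_iff) auto
      then have le2: "AE x in lebesgue_on \<Omega>. (norm (b (t, x)))\<^sup>2 \<le> (norm (Q t x))\<^sup>2"
      proof eventually_elim
        case (elim x)
        from power_mono[OF elim norm_ge_zero, of 2] show ?case by simp
      qed
      have bL2: "(\<lambda>x. b (t, x)) \<in> L2 (lebesgue_on \<Omega>)"
      proof (rule L2_bound[OF _ L2_integrable_sq[OF Qt] le2])
        show "(\<lambda>x. b (t, x)) \<in> borel_measurable (lebesgue_on \<Omega>)"
          using op by (intro lebesgue_on_lborel_measurable[OF _ bm]) auto
      qed
      have "(L2_norm (lebesgue_on \<Omega>) (\<lambda>x. b (t, x)))\<^sup>2 \<le> (L2_norm (lebesgue_on \<Omega>) (Q t))\<^sup>2"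
        unfolding L2_norm_sq by (intro integral_mono_AE L2_integrable_sq bL2 Qt le2)
      then show "integrable lborel (\<lambda>x. indicator \<Omega> x * (norm (b (t, x)))\<^sup>2) \<and>
         (LINT x|lborel. indicator \<Omega> x * (norm (b (t, x)))\<^sup>2) \<le> (L2_norm (lebesgue_on \<Omega>) (Q t))\<^sup>2"
        using L2_section_lborel[OF op bL2 bm] by simp
    qed
  qed
qed

lemma integrable_cylinder_rep:
  fixes \<Omega> :: "'a::euclidean_space set"
  assumes op: "open \<Omega>" and f: "case_prod f \<in> L1 (lebesgue_on (cylinder T \<Omega>))" and f': "f' \<in> borel_measurable borel"
    "AE p in lborel. p \<in> cylinder T \<Omega> \<longrightarrow> case_prod f p = f' p"
  shows "integrable lborel (\<lambda>p. indicator (cylinder T \<Omega>) p * (f' p :: real))"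
  using f lebesgue_on_lborel_integrable[OF cylinder_sets[OF op] f'] by (simp add: L1_def)

lemma integrable_indicator_subset:
  fixes f :: "'a \<Rightarrow> real"
  assumes "integrable M (\<lambda>p. indicator B p * f p)" "A \<subseteq> B" "A \<in> sets M"
  shows "integrable M (\<lambda>p. indicator A p * f p)"
proof -
  have "(\<lambda>p. indicator A p * f p) = (\<lambda>p. indicator A p *\<^sub>R (indicator B p * f p))"
    using assms(2) by (auto simp: fun_eq_iff indicator_def)
  then show ?thesis using integrable_mult_indicator[OF assms(3,1)] by simp
qed

context
  fixes \<Omega> :: "'a::euclidean_space set"
  assumes op: "open \<Omega>" and bd: "bounded \<Omega>"
begin

lemma grad_rep:
  assumes u: "u \<in> L2_loc_time (W012 \<Omega>) (W12_norm \<Omega>) T"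
  obtains U where "U \<in> borel_measurable borel"
    "AE t in lborel. t \<in> {0..T} \<longrightarrow> u t \<in> W012 \<Omega> \<and> (AE x in lborel. x \<in> \<Omega> \<longrightarrow> weak_grad \<Omega> (u t) x = U (t, x))"
    "\<And>c d. 0 < c \<Longrightarrow> c \<le> d \<Longrightarrow> d < T \<Longrightarrow> (\<lambda>p. indicator ({c..d} \<times> \<Omega>) p *\<^sub>R U p) \<in> L2 lborel"
proof -
  have B: "bochner_measurable (W012 \<Omega>) (W12_norm \<Omega>) {0..T} u" using u by (simp add: L2_loc_time_def)
  obtain U where U: "U \<in> borel_measurable borel"
    "AE t in lborel. t \<in> {0..T} \<longrightarrow> (AE x in lborel. x \<in> \<Omega> \<longrightarrow> weak_grad \<Omega> (u t) x = U (t, x))"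
    by (rule bochner_weak_grad_joint[OF op bd B]) auto
  have "AE t in lebesgue_on {0..T}. u t \<in> W012 \<Omega>" using B by (simp add: bochner_measurable_def)
  then have "AE t in lborel. t \<in> {0..T} \<longrightarrow> u t \<in> W012 \<Omega>" by (subst (asm) AE_lebesgue_on_iff) auto
  with U(2) have ae: "AE t in lborel. t \<in> {0..T} \<longrightarrow> u t \<in> W012 \<Omega> \<and> (AE x in lborel. x \<in> \<Omega> \<longrightarrow> weak_grad \<Omega> (u t) x = U (t, x))"
    by eventually_elim auto
  have "(\<lambda>p. indicator ({c..d} \<times> \<Omega>) p *\<^sub>R U p) \<in> L2 lborel" if cd: "0 < c" "c \<le> d" "d < T" for c d
  proof (rule L2_joint[OF op U(1)])
    have "u \<in> L2_time (W012 \<Omega>) (W12_norm \<Omega>) {c..d}" using u cd by (auto simp: L2_loc_time_def)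
    then show "integrable (lebesgue_on {c..d}) (\<lambda>t. (W12_norm \<Omega> (u t))\<^sup>2)" by (simp add: L2_time_def)
    show "AE t in lborel. t \<in> {c..d} \<longrightarrow> integrable lborel (\<lambda>x. indicator \<Omega> x * (norm (U (t, x)))\<^sup>2) \<and>
       (LINT x|lborel. indicator \<Omega> x * (norm (U (t, x)))\<^sup>2) \<le> (W12_norm \<Omega> (u t))\<^sup>2"
      using ae
    proof eventually_elim
      case (elim t)
      show ?case
      proof
        assume "t \<in> {c..d}"
        with elim cd have W: "u t \<in> W012 \<Omega>" and e: "AE x in lborel. x \<in> \<Omega> \<longrightarrow> weak_grad \<Omega> (u t) x = U (t, x)" by auto
        have "(L2_norm (lebesgue_on \<Omega>) (weak_grad \<Omega> (u t)))\<^sup>2 \<le> (W12_norm \<Omega> (u t))\<^sup>2"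
          by (simp add: W12_norm_def)
        then show "integrable lborel (\<lambda>x. indicator \<Omega> x * (norm (U (t, x)))\<^sup>2) \<and>
          (LINT x|lborel. indicator \<Omega> x * (norm (U (t, x)))\<^sup>2) \<le> (W12_norm \<Omega> (u t))\<^sup>2"
          using L2_section_lborel[OF op weak_grad_L2(1)[OF op bd W] borel_measurable_section[OF U(1)] e] by simp
      qed
    qed
  qed
  with U(1) ae show thesis by (rule that)
qed

lemma constant_in_time_L2:
  assumes "h \<in> L2 (lebesgue_on \<Omega>)" "h' \<in> borel_measurable borel" "AE x in lborel. x \<in> \<Omega> \<longrightarrow> h x = h' x"
  shows "(\<lambda>p. indicator ({c..d::real} \<times> \<Omega>) p *\<^sub>R (h' (snd p) :: 'b::euclidean_space)) \<in> L2 lborel"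
proof (rule L2_joint[OF op])
  have "snd \<in> borel_measurable (borel :: (real \<times> 'a) measure)"
    by (intro borel_measurable_continuous_onI continuous_intros)
  from measurable_compose[OF this assms(2)] show "(\<lambda>p. h' (snd p)) \<in> borel_measurable (borel :: (real \<times> 'a) measure)" .
  show "integrable (lebesgue_on {c..d}) (\<lambda>t. (L2_norm (lebesgue_on \<Omega>) h)\<^sup>2)"
    by (rule finite_measure.integrable_const[OF finite_measure_lebesgue_on]) simp
qed (use L2_section_lborel[OF op assms] in simp)

lemma integrable_pairing:
  fixes G :: "real \<times> 'a \<Rightarrow> 'b::euclidean_space"
  assumes "(\<lambda>p. indicator ({c..d} \<times> \<Omega>) p *\<^sub>R G p) \<in> L2 lborel"
    "h \<in> L2 (lebesgue_on \<Omega>)" "h' \<in> borel_measurable borel" "AE x in lborel. x \<in> \<Omega> \<longrightarrow> h x = h' x"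
  shows "integrable lborel (\<lambda>p. indicator ({c..d} \<times> \<Omega>) p * (G p \<bullet> h' (snd p)))"
proof -
  have "(\<lambda>p. indicator ({c..d} \<times> \<Omega>) p * (G p \<bullet> h' (snd p)))
      = (\<lambda>p. (indicator ({c..d} \<times> \<Omega>) p *\<^sub>R G p) \<bullet> (indicator ({c..d} \<times> \<Omega>) p *\<^sub>R h' (snd p)))"
    by (auto simp: fun_eq_iff indicator_def)
  then show ?thesis using L2_integrable_inner[OF assms(1) constant_in_time_L2[OF assms(2-4)]] by simp
qed

end

text \<open>For a frozen test function the duality term integrates to a difference of end values.
  Diffusion and drift merge into one Borel flux field, so the rest becomes a single integral over
  space-time.\<close>

lemma weak_form_rep:
  fixes \<Omega> :: "(real^'n) set" and G :: "real \<times> (real^'n) \<Rightarrow> real^'n"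
  assumes op: "open \<Omega>" and bd: "bounded \<Omega>"
    and u: "u \<in> C_time (L1 (lebesgue_on \<Omega>)) (L1_norm (lebesgue_on \<Omega>)) T" "u \<in> W2_loc T \<Omega>"
    and \<psi>: "\<psi> \<in> W012 \<Omega>" "\<And>x. \<bar>\<psi> x\<bar> \<le> C" and cd: "0 < c" "c < d" "d < T"
    and \<Psi>: "\<Psi> \<in> borel_measurable borel" "AE x in lborel. x \<in> \<Omega> \<longrightarrow> weak_grad \<Omega> \<psi> x = \<Psi> x"
    and G: "G \<in> borel_measurable borel"
      "AE t in lborel. t \<in> {0<..<T} \<longrightarrow> (AE x in lborel. x \<in> \<Omega> \<longrightarrow>
        M t x *v weak_grad \<Omega> (u t) x + (\<bar>u t x\<bar> powr \<theta> * u t x) *\<^sub>R E t x = G (t, x))"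
      "(\<lambda>p. indicator ({c..d} \<times> \<Omega>) p *\<^sub>R G p) \<in> L2 lborel"
  shows "weak_form T \<Omega> M E \<theta> c d u (\<lambda>t. \<psi>)
    = (LINT x|lebesgue_on \<Omega>. u d x * \<psi> x) - (LINT x|lebesgue_on \<Omega>. u c x * \<psi> x)
      + (LINT p|lborel. indicator ({c..d} \<times> \<Omega>) p * (G p \<bullet> \<Psi> (snd p)))"
proof -
  have "(LINT t|lebesgue_on {c..d}. LINT x|lebesgue_on \<Omega>.
        (M t x *v weak_grad \<Omega> (u t) x) \<bullet> weak_grad \<Omega> \<psi> x + ((\<bar>u t x\<bar> powr \<theta> * u t x) *\<^sub>R E t x) \<bullet> weak_grad \<Omega> \<psi> x)
      = (LINT p|lborel. indicator ({c..d} \<times> \<Omega>) p * (G p \<bullet> \<Psi> (snd p)))"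
  proof (rule iterated_integral_rep[OF op])
    have s: "snd \<in> borel_measurable (borel :: (real \<times> (real^'n)) measure)"
      by (intro borel_measurable_continuous_onI continuous_intros)
    show "(\<lambda>p. G p \<bullet> \<Psi> (snd p)) \<in> borel_measurable borel"
      by (intro borel_measurable_inner G(1) measurable_compose[OF s \<Psi>(1)])
    show "integrable lborel (\<lambda>p. indicator ({c..d} \<times> \<Omega>) p * (G p \<bullet> \<Psi> (snd p)))"
      by (rule integrable_pairing[OF op bd G(3) weak_grad_L2(1)[OF op bd \<psi>(1)] \<Psi>])
    show "AE t in lborel. t \<in> {c..d} \<longrightarrow> (AE x in lborel. x \<in> \<Omega> \<longrightarrow>
        (M t x *v weak_grad \<Omega> (u t) x) \<bullet> weak_grad \<Omega> \<psi> x + ((\<bar>u t x\<bar> powr \<theta> * u t x) *\<^sub>R E t x) \<bullet> weak_grad \<Omega> \<psi> x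
        = G (t, x) \<bullet> \<Psi> (snd (t, x)))"
      using AE_on_subinterval[OF G(2) cd(1,3)]
    proof eventually_elim
      case (elim t)
      show ?case
      proof
        assume "t \<in> {c..d}"
        with elim have "AE x in lborel. x \<in> \<Omega> \<longrightarrow>
          M t x *v weak_grad \<Omega> (u t) x + (\<bar>u t x\<bar> powr \<theta> * u t x) *\<^sub>R E t x = G (t, x)" by simp
        with \<Psi>(2) show "AE x in lborel. x \<in> \<Omega> \<longrightarrow>
          (M t x *v weak_grad \<Omega> (u t) x) \<bullet> weak_grad \<Omega> \<psi> x + ((\<bar>u t x\<bar> powr \<theta> * u t x) *\<^sub>R E t x) \<bullet> weak_grad \<Omega> \<psi> x
          = G (t, x) \<bullet> \<Psi> (snd (t, x))"
        proof eventually_elim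
          case (elim x)
          show ?case
          proof
            assume x: "x \<in> \<Omega>"
            show "(M t x *v weak_grad \<Omega> (u t) x) \<bullet> weak_grad \<Omega> \<psi> x
                + ((\<bar>u t x\<bar> powr \<theta> * u t x) *\<^sub>R E t x) \<bullet> weak_grad \<Omega> \<psi> x = G (t, x) \<bullet> \<Psi> (snd (t, x))"
              unfolding inner_add_left[symmetric] elim(1)[rule_format, OF x] elim(2)[rule_format, OF x] by simp
          qed
        qed
      qed
    qed
  qed
  then show ?thesis
    unfolding weak_form_def by (simp add: time_deriv_pairing[OF op bd u \<psi> cd])
qed

lemma source_rep:
  fixes \<Omega> :: "'a::euclidean_space set" and f :: "real \<Rightarrow> 'a \<Rightarrow> real"
  assumes op: "open \<Omega>" and f': "f' \<in> borel_measurable borel" "integrable lborel (\<lambda>p. indicator (cylinder T \<Omega>) p * f' p)"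
    "AE t in lborel. t \<in> {0<..<T} \<longrightarrow> (AE x in lborel. x \<in> \<Omega> \<longrightarrow> f t x = f' (t, x))"
    and \<psi>': "\<psi>' \<in> borel_measurable borel" "AE x in lborel. x \<in> \<Omega> \<longrightarrow> \<psi> x = \<psi>' x"
    and \<psi>: "\<And>x. \<bar>\<psi> x\<bar> \<le> 1" and cd: "0 < c" "d < T"
  shows "integrable lborel (\<lambda>p. indicator ({c..d} \<times> \<Omega>) p * (f' p * \<psi>' (snd p)))"
    "(LINT t|lebesgue_on {c..d}. LINT x|lebesgue_on \<Omega>. f t x * \<psi> x)
      = (LINT p|lborel. indicator ({c..d} \<times> \<Omega>) p * (f' p * \<psi>' (snd p)))"
proof -
  have s: "snd \<in> borel_measurable (borel :: (real \<times> 'a) measure)"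
    by (intro borel_measurable_continuous_onI continuous_intros)
  have [measurable]: "\<Omega> \<in> sets borel" "{c..d} \<times> \<Omega> \<in> sets borel" using op by (auto intro!: borel_Times)
  have m: "(\<lambda>p. f' p * \<psi>' (snd p)) \<in> borel_measurable borel"
    by (intro borel_measurable_times f'(1) measurable_compose[OF s \<psi>'(1)])
  have i: "integrable lborel (\<lambda>p. indicator ({c..d} \<times> \<Omega>) p * f' p)"
    by (rule integrable_indicator_subset[OF f'(2)]) (use cd in \<open>auto simp: cylinder_def\<close>)
  have ae: "AE p in (lborel :: (real \<times> 'a) measure). snd p \<in> \<Omega> \<longrightarrow> \<psi> (snd p) = \<psi>' (snd p)"
    by (rule AE_lborel_snd[OF \<psi>'(2)])
  show int: "integrable lborel (\<lambda>p. indicator ({c..d} \<times> \<Omega>) p * (f' p * \<psi>' (snd p)))"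
  proof (rule Bochner_Integration.integrable_bound[OF i])
    show "(\<lambda>p. indicator ({c..d} \<times> \<Omega>) p * (f' p * \<psi>' (snd p))) \<in> borel_measurable lborel"
      using m by measurable
    show "AE p in lborel. norm (indicator ({c..d} \<times> \<Omega>) p * (f' p * \<psi>' (snd p))) \<le> norm (indicator ({c..d} \<times> \<Omega>) p * f' p)"
      using ae
    proof eventually_elim
      case (elim p)
      show ?case
      proof (cases "p \<in> {c..d} \<times> \<Omega>")
        case True
        then have "\<bar>\<psi>' (snd p)\<bar> \<le> 1" using elim \<psi>[of "snd p"] by (auto simp: mem_Times_iff)
        then show ?thesis using True by (simp add: abs_mult mult_right_le_one_le)
      qed simp
    qed
  qed
  show "(LINT t|lebesgue_on {c..d}. LINT x|lebesgue_on \<Omega>. f t x * \<psi> x)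
      = (LINT p|lborel. indicator ({c..d} \<times> \<Omega>) p * (f' p * \<psi>' (snd p)))"
  proof (rule iterated_integral_rep[OF op m _ int])
    show "AE t in lborel. t \<in> {c..d} \<longrightarrow> (AE x in lborel. x \<in> \<Omega> \<longrightarrow> f t x * \<psi> x = f' (t, x) * \<psi>' (snd (t, x)))"
      using AE_on_subinterval[OF f'(3) cd]
    proof eventually_elim
      case (elim t)
      show ?case
      proof
        assume "t \<in> {c..d}"
        with elim have "AE x in lborel. x \<in> \<Omega> \<longrightarrow> f t x = f' (t, x)" by simp
        with \<psi>'(2) show "AE x in lborel. x \<in> \<Omega> \<longrightarrow> f t x * \<psi> x = f' (t, x) * \<psi>' (snd (t, x))"
          by eventually_elim simp
      qed
    qed
  qed
qed

section \<open>The comparison estimate\<close>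

lemma C_time_L1_diff:
  fixes \<Omega> :: "'a::euclidean_space set"
  assumes v: "v \<in> C_time (L1 (lebesgue_on \<Omega>)) (L1_norm (lebesgue_on \<Omega>)) T"
    and w: "w \<in> C_time (L1 (lebesgue_on \<Omega>)) (L1_norm (lebesgue_on \<Omega>)) T"
  shows "(\<lambda>t x. v t x - w t x :: real) \<in> C_time (L1 (lebesgue_on \<Omega>)) (L1_norm (lebesgue_on \<Omega>)) T"
  unfolding C_time_def mem_Collect_eq
proof (intro conjI ballI)
  have i: "integrable (lebesgue_on \<Omega>) (v t)" "integrable (lebesgue_on \<Omega>) (w t)" if "t \<in> {0..T}" for t
    using v w that by (auto simp: C_time_def L1_def)
  show "(\<lambda>x. v t x - w t x) \<in> L1 (lebesgue_on \<Omega>)" if "t \<in> {0..T}" for t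
    using i[OF that] by (simp add: L1_def)
  fix t assume t: "t \<in> {0..T}"
  have "((\<lambda>s. L1_norm (lebesgue_on \<Omega>) (v s - v t) + L1_norm (lebesgue_on \<Omega>) (w s - w t)) \<longlongrightarrow> 0 + 0) (at t within {0..T})"
    using v w t by (intro tendsto_add) (auto simp: C_time_def)
  then have "((\<lambda>s. L1_norm (lebesgue_on \<Omega>) (v s - v t) + L1_norm (lebesgue_on \<Omega>) (w s - w t)) \<longlongrightarrow> 0) (at t within {0..T})"
    by simp
  then show "((\<lambda>s. L1_norm (lebesgue_on \<Omega>) ((\<lambda>x. v s x - w s x) - (\<lambda>x. v t x - w t x))) \<longlongrightarrow> 0) (at t within {0..T})"
  proof (rule Lim_null_comparison[rotated])
    show "\<forall>\<^sub>F s in at t within {0..T}. norm (L1_norm (lebesgue_on \<Omega>) ((\<lambda>x. v s x - w s x) - (\<lambda>x. v t x - w t x)))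
        \<le> L1_norm (lebesgue_on \<Omega>) (v s - v t) + L1_norm (lebesgue_on \<Omega>) (w s - w t)"
      unfolding eventually_at_filter
    proof (rule always_eventually, intro allI impI)
      fix s assume s: "s \<in> {0..T}"
      have "(LINT x|lebesgue_on \<Omega>. norm (v s x - w s x - (v t x - w t x)))
          \<le> (LINT x|lebesgue_on \<Omega>. norm (v s x - v t x) + norm (w s x - w t x))"
        using i[OF s] i[OF t] by (intro integral_mono) auto
      also have "\<dots> = (LINT x|lebesgue_on \<Omega>. norm (v s x - v t x)) + (LINT x|lebesgue_on \<Omega>. norm (w s x - w t x))"
        using i[OF s] i[OF t] by simp
      finally show "norm (L1_norm (lebesgue_on \<Omega>) ((\<lambda>x. v s x - w s x) - (\<lambda>x. v t x - w t x)))
        \<le> L1_norm (lebesgue_on \<Omega>) (v s - v t) + L1_norm (lebesgue_on \<Omega>) (w s - w t)"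
        by (simp add: L1_norm_def)
    qed
  qed
qed

lemma integrable_lipschitz:
  fixes S :: "real \<Rightarrow> real"
  assumes "integrable M z" "\<And>y y'. \<bar>S y - S y'\<bar> \<le> \<bar>y - y'\<bar>" "S 0 = 0"
  shows "integrable M (\<lambda>x. S (z x))"
proof (rule Bochner_Integration.integrable_bound[OF assms(1)])
  have "continuous_on UNIV S"
    unfolding continuous_on_iff dist_real_def using assms(2) le_less_trans by blast
  then have "S \<in> borel_measurable borel" by (rule borel_measurable_continuous_onI)
  from measurable_compose[OF borel_measurable_integrable[OF assms(1)] this]
  show "(\<lambda>x. S (z x)) \<in> borel_measurable M" .
  show "AE x in M. norm (S (z x)) \<le> norm (z x)" using assms(2)[of _ 0] assms(3) by simp
qed

lemma lipschitz_integral_diff: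
  fixes S :: "real \<Rightarrow> real"
  assumes "integrable M z" "integrable M y" "\<And>y y'. \<bar>S y - S y'\<bar> \<le> \<bar>y - y'\<bar>" "S 0 = 0"
  shows "\<bar>(LINT x|M. S (z x)) - (LINT x|M. S (y x))\<bar> \<le> L1_norm M (z - y)"
proof -
  note i = integrable_lipschitz[OF assms(1,3,4)] integrable_lipschitz[OF assms(2,3,4)]
  have "\<bar>(LINT x|M. S (z x)) - (LINT x|M. S (y x))\<bar> = \<bar>LINT x|M. S (z x) - S (y x)\<bar>" using i by simp
  also have "\<dots> \<le> (LINT x|M. \<bar>S (z x) - S (y x)\<bar>)" by (rule integral_abs_bound)
  also have "\<dots> \<le> (LINT x|M. \<bar>z x - y x\<bar>)" using assms i by (intro integral_mono) auto
  finally show ?thesis by (simp add: L1_norm_def)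
qed

text \<open>The estimate for one fixed r on an interval away from 0 and T. Primed functions, V and W
  are Borel representatives of the data and of the gradients. The error is integrated over the whole
  cylinder, so its bound does not depend on a and b.\<close>

lemma interior_comparison:
  fixes \<Omega> :: "(real^'n) set" and v w f g :: "real \<Rightarrow> real^'n \<Rightarrow> real"
    and V W E' :: "real \<times> (real^'n) \<Rightarrow> real^'n" and M' :: "real \<times> (real^'n) \<Rightarrow> real^'n^'n"
    and v' w' f' g' hh :: "real \<times> (real^'n) \<Rightarrow> real"
  assumes op: "open \<Omega>" and bd: "bounded \<Omega>" and T: "T > 0" and \<alpha>: "\<alpha> > 0" and r: "r > 0" and ab: "0 < a" "a < b" "b < T"
    and v: "v \<in> C_time (L1 (lebesgue_on \<Omega>)) (L1_norm (lebesgue_on \<Omega>)) T" "v \<in> W2_loc T \<Omega>"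
    and w: "w \<in> C_time (L1 (lebesgue_on \<Omega>)) (L1_norm (lebesgue_on \<Omega>)) T" "w \<in> W2_loc T \<Omega>"
    and subsol: "\<And>t1 t2 \<phi>. \<lbrakk>0 < t1; t1 < t2; t2 < T; \<phi> \<in> W2 T \<Omega>;
             case_prod \<phi> \<in> Linf (lebesgue_on (cylinder T \<Omega>));
             AE (t, x) in lebesgue_on (cylinder T \<Omega>). \<phi> t x \<ge> 0\<rbrakk>
           \<Longrightarrow> weak_form T \<Omega> M E \<theta> t1 t2 v \<phi>
                 \<le> (LINT t|lebesgue_on {t1..t2}. LINT x|lebesgue_on \<Omega>. f t x * \<phi> t x)"
    and supersol: "\<And>t1 t2 \<phi>. \<lbrakk>0 < t1; t1 < t2; t2 < T; \<phi> \<in> W2 T \<Omega>;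
             case_prod \<phi> \<in> Linf (lebesgue_on (cylinder T \<Omega>));
             AE (t, x) in lebesgue_on (cylinder T \<Omega>). \<phi> t x \<ge> 0\<rbrakk>
           \<Longrightarrow> weak_form T \<Omega> M E \<theta> t1 t2 w \<phi>
                 \<ge> (LINT t|lebesgue_on {t1..t2}. LINT x|lebesgue_on \<Omega>. g t x * \<phi> t x)"
    and meas: "v' \<in> borel_measurable borel" "w' \<in> borel_measurable borel" "V \<in> borel_measurable borel" "W \<in> borel_measurable borel"
      "E' \<in> borel_measurable borel" "M' \<in> borel_measurable borel" "f' \<in> borel_measurable borel" "g' \<in> borel_measurable borel"
    and f': "integrable lborel (\<lambda>p. indicator (cylinder T \<Omega>) p * f' p)"
      "AE t in lborel. t \<in> {0<..<T} \<longrightarrow> (AE x in lborel. x \<in> \<Omega> \<longrightarrow> f t x = f' (t, x))"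
    and g': "integrable lborel (\<lambda>p. indicator (cylinder T \<Omega>) p * g' p)"
      "AE t in lborel. t \<in> {0<..<T} \<longrightarrow> (AE x in lborel. x \<in> \<Omega> \<longrightarrow> g t x = g' (t, x))"
    and vV: "AE t in lborel. t \<in> {0<..<T} \<longrightarrow> v t \<in> W012 \<Omega> \<and> (AE x in lborel. x \<in> \<Omega> \<longrightarrow> v t x = v' (t, x) \<and> weak_grad \<Omega> (v t) x = V (t, x))"
    and wW: "AE t in lborel. t \<in> {0<..<T} \<longrightarrow> w t \<in> W012 \<Omega> \<and> (AE x in lborel. x \<in> \<Omega> \<longrightarrow> w t x = w' (t, x) \<and> weak_grad \<Omega> (w t) x = W (t, x))"
    and ME: "AE t in lborel. t \<in> {0<..<T} \<longrightarrow> (AE x in lborel. x \<in> \<Omega> \<longrightarrow> M t x = M' (t, x) \<and> E t x = E' (t, x))"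
    and L2V: "\<And>c d. 0 < c \<Longrightarrow> c \<le> d \<Longrightarrow> d < T \<Longrightarrow> (\<lambda>p. indicator ({c..d} \<times> \<Omega>) p *\<^sub>R V p) \<in> L2 lborel"
    and L2W: "\<And>c d. 0 < c \<Longrightarrow> c \<le> d \<Longrightarrow> d < T \<Longrightarrow> (\<lambda>p. indicator ({c..d} \<times> \<Omega>) p *\<^sub>R W p) \<in> L2 lborel"
    and L2Gv: "\<And>c d. 0 < c \<Longrightarrow> c \<le> d \<Longrightarrow> d < T \<Longrightarrow>
      (\<lambda>p. indicator ({c..d} \<times> \<Omega>) p *\<^sub>R (M' p *v V p + (\<bar>v' p\<bar> powr \<theta> * v' p) *\<^sub>R E' p)) \<in> L2 lborel"
    and L2Gw: "\<And>c d. 0 < c \<Longrightarrow> c \<le> d \<Longrightarrow> d < T \<Longrightarrow>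
      (\<lambda>p. indicator ({c..d} \<times> \<Omega>) p *\<^sub>R (M' p *v W p + (\<bar>w' p\<bar> powr \<theta> * w' p) *\<^sub>R E' p)) \<in> L2 lborel"
    and ell: "AE p in lborel. p \<in> cylinder T \<Omega> \<longrightarrow> (\<forall>\<xi>. \<alpha> * (norm \<xi>)\<^sup>2 \<le> (M' p *v \<xi>) \<bullet> \<xi>)"
    and hh: "integrable lborel (\<lambda>p. indicator (cylinder T \<Omega>) p * (hh p)\<^sup>2)" "\<And>p. hh p \<ge> 0"
      "\<And>p. \<bar>\<bar>v' p\<bar> powr \<theta> * v' p - \<bar>w' p\<bar> powr \<theta> * w' p\<bar> * norm (E' p) \<le> hh p * \<bar>v' p - w' p\<bar>"
  shows "(LINT x|lebesgue_on \<Omega>. Sg r (v b x - w b x)) - (LINT x|lebesgue_on \<Omega>. Sg r (v a x - w a x))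
    \<le> (LINT p|lborel. indicator ({a..b} \<times> \<Omega>) p * ((f' p - g' p) * gexp 0 (r * (v' p - w' p))))
      + (LINT p|lborel. indicator (cylinder T \<Omega>) p * (hh p)\<^sup>2) / (4 * \<alpha> * r)"
proof -
  note [measurable] = meas
  have \<Omega>[measurable]: "\<Omega> \<in> sets borel" using op by simp
  have box[measurable]: "{c..d::real} \<times> \<Omega> \<in> sets borel" for c d by (intro borel_Times) auto
  define Gv where "Gv p = M' p *v V p + (\<bar>v' p\<bar> powr \<theta> * v' p) *\<^sub>R E' p" for p
  define Gw where "Gw p = M' p *v W p + (\<bar>w' p\<bar> powr \<theta> * w' p) *\<^sub>R E' p" for p
  define G where "G p = Gv p - Gw p" for p
  define k where "k p = f' p - g' p" for p
  define K where "K p = gexp 0 (r * (v' p - w' p))" for p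
  define H where "H p = (r * gexp 2 (r * (v' p - w' p))) *\<^sub>R (V p - W p)" for p
  have Gvm[measurable]: "Gv \<in> borel_measurable borel" "Gw \<in> borel_measurable borel"
    unfolding Gv_def[abs_def] Gw_def[abs_def] by (intro borel_measurable_add borel_measurable_matrix_vector; measurable)+
  have [measurable]: "G \<in> borel_measurable borel" "k \<in> borel_measurable borel"
    unfolding G_def[abs_def] k_def[abs_def] by measurable
  have Km[measurable]: "K \<in> borel_measurable borel" unfolding K_def[abs_def] by measurable
  have Hm[measurable]: "H \<in> borel_measurable borel" unfolding H_def[abs_def] by measurable
  have K01: "0 \<le> K p" "K p \<le> 1" for p by (auto simp: K_def gexp_nonneg gexp_le_1)
  have L2G: "(\<lambda>p. indicator ({c..d} \<times> \<Omega>) p *\<^sub>R G p) \<in> L2 lborel" if "0 < c" "c \<le> d" "d < T" for c d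
    using L2_diff[OF L2Gv[OF that] L2Gw[OF that]]
    by (simp add: G_def Gv_def Gw_def scaleR_diff_right)
  have ki: "integrable lborel (\<lambda>p. indicator (cylinder T \<Omega>) p * k p)"
    using Bochner_Integration.integrable_diff[OF f'(1) g'(1)] by (simp add: k_def right_diff_distrib)
  have zi: "integrable (lebesgue_on \<Omega>) (v t)" "integrable (lebesgue_on \<Omega>) (w t)" if "t \<in> {0..T}" for t
    using v(1) w(1) that by (auto simp: C_time_def L1_def)
  have GvE: "AE t in lborel. t \<in> {0<..<T} \<longrightarrow> (AE x in lborel. x \<in> \<Omega> \<longrightarrow>
        M t x *v weak_grad \<Omega> (v t) x + (\<bar>v t x\<bar> powr \<theta> * v t x) *\<^sub>R E t x = Gv (t, x))"
    using vV ME
  proof eventually_elim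
    case (elim t)
    show ?case
    proof
      assume t: "t \<in> {0<..<T}"
      from elim(1)[rule_format, OF t, THEN conjunct2] elim(2)[rule_format, OF t]
      show "AE x in lborel. x \<in> \<Omega> \<longrightarrow>
        M t x *v weak_grad \<Omega> (v t) x + (\<bar>v t x\<bar> powr \<theta> * v t x) *\<^sub>R E t x = Gv (t, x)"
        by eventually_elim (simp add: Gv_def)
    qed
  qed
  have GwE: "AE t in lborel. t \<in> {0<..<T} \<longrightarrow> (AE x in lborel. x \<in> \<Omega> \<longrightarrow>
        M t x *v weak_grad \<Omega> (w t) x + (\<bar>w t x\<bar> powr \<theta> * w t x) *\<^sub>R E t x = Gw (t, x))"
    using wW ME
  proof eventually_elim
    case (elim t)
    show ?case
    proof
      assume t: "t \<in> {0<..<T}"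
      from elim(1)[rule_format, OF t, THEN conjunct2] elim(2)[rule_format, OF t]
      show "AE x in lborel. x \<in> \<Omega> \<longrightarrow>
        M t x *v weak_grad \<Omega> (w t) x + (\<bar>w t x\<bar> powr \<theta> * w t x) *\<^sub>R E t x = Gw (t, x)"
        by eventually_elim (simp add: Gw_def)
    qed
  qed
  \<comment> \<open>Subtracting the supersolution inequality from the subsolution inequality for a
    common nonnegative frozen \<psi> bounds the increment of the pairing of v - w with
    \<psi>.\<close>
  have step: "integrable lborel (\<lambda>p. indicator ({c..d} \<times> \<Omega>) p * (k p * \<psi>' (snd p) - G p \<bullet> \<Psi> (snd p)))"
    "(LINT x|lebesgue_on \<Omega>. ((v d x - w d x) - (v c x - w c x)) * \<psi> x)
      \<le> (LINT p|lborel. indicator ({c..d} \<times> \<Omega>) p * (k p * \<psi>' (snd p) - G p \<bullet> \<Psi> (snd p)))"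
    if \<psi>: "\<psi> \<in> W012 \<Omega>" "\<And>x. 0 \<le> \<psi> x" "\<And>x. \<psi> x \<le> 1" and cd: "0 < c" "c < d" "d < T"
      and \<psi>': "\<psi>' \<in> borel_measurable borel" "AE x in lborel. x \<in> \<Omega> \<longrightarrow> \<psi> x = \<psi>' x"
      and \<Psi>: "\<Psi> \<in> borel_measurable borel" "AE x in lborel. x \<in> \<Omega> \<longrightarrow> weak_grad \<Omega> \<psi> x = \<Psi> x"
    for \<psi> \<psi>' \<Psi> c d
  proof -
    have \<psi>1: "\<bar>\<psi> x\<bar> \<le> 1" for x using \<psi>(2,3)[of x] by simp
    have cd': "c \<le> d" using cd by simp
    have adm: "(\<lambda>t. \<psi>) \<in> W2 T \<Omega>" by (rule constant_in_time_W2[OF op bd \<psi>(1) T])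
    then have "case_prod (\<lambda>t. \<psi>) \<in> borel_measurable (lebesgue_on (cylinder T \<Omega>))" by (simp add: W2_def)
    then have Linf: "case_prod (\<lambda>t. \<psi>) \<in> Linf (lebesgue_on (cylinder T \<Omega>))"
      unfolding Linf_def using \<psi>1 by (auto intro!: exI[of _ 1])
    have pos: "AE (t, x) in lebesgue_on (cylinder T \<Omega>). \<psi> x \<ge> 0" using \<psi>(2) by simp
    note wfv = weak_form_rep[OF op bd v \<psi>(1) \<psi>1 cd \<Psi> Gvm(1) GvE L2Gv[OF cd(1) cd' cd(3), folded Gv_def]]
    note wfw = weak_form_rep[OF op bd w \<psi>(1) \<psi>1 cd \<Psi> Gvm(2) GwE L2Gw[OF cd(1) cd' cd(3), folded Gw_def]]
    note sf = source_rep[OF op meas(7) f' \<psi>' \<psi>1 cd(1,3)]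
    note sg = source_rep[OF op meas(8) g' \<psi>' \<psi>1 cd(1,3)]
    note wg = weak_grad_L2(1)[OF op bd \<psi>(1)]
    note iv = integrable_pairing[OF op bd L2Gv[OF cd(1) cd' cd(3), folded Gv_def] wg \<Psi>]
    note iw = integrable_pairing[OF op bd L2Gw[OF cd(1) cd' cd(3), folded Gw_def] wg \<Psi>]
    have e: "indicator ({c..d} \<times> \<Omega>) p * (k p * \<psi>' (snd p) - G p \<bullet> \<Psi> (snd p))
      = (indicator ({c..d} \<times> \<Omega>) p * (f' p * \<psi>' (snd p)) - indicator ({c..d} \<times> \<Omega>) p * (g' p * \<psi>' (snd p)))
       - (indicator ({c..d} \<times> \<Omega>) p * (Gv p \<bullet> \<Psi> (snd p)) - indicator ({c..d} \<times> \<Omega>) p * (Gw p \<bullet> \<Psi> (snd p)))" for p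
      by (simp add: k_def G_def inner_diff_left algebra_simps)
    show "integrable lborel (\<lambda>p. indicator ({c..d} \<times> \<Omega>) p * (k p * \<psi>' (snd p) - G p \<bullet> \<Psi> (snd p)))"
      unfolding e by (intro Bochner_Integration.integrable_diff sf(1) sg(1) iv iw)
    have \<psi>m: "\<psi> \<in> borel_measurable (lebesgue_on \<Omega>)" by (rule L2_measurable[OF weak_grad_L2(2)[OF op bd \<psi>(1)]])
    have c0: "c \<in> {0..T}" "d \<in> {0..T}" using cd by auto
    have "(LINT x|lebesgue_on \<Omega>. ((v d x - w d x) - (v c x - w c x)) * \<psi> x)
      = ((LINT x|lebesgue_on \<Omega>. v d x * \<psi> x) - (LINT x|lebesgue_on \<Omega>. v c x * \<psi> x))
       - ((LINT x|lebesgue_on \<Omega>. w d x * \<psi> x) - (LINT x|lebesgue_on \<Omega>. w c x * \<psi> x))"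
      using L1_bounded_mult(1)[OF op bd zi(1)[OF c0(1)] \<psi>m \<psi>1] L1_bounded_mult(1)[OF op bd zi(2)[OF c0(1)] \<psi>m \<psi>1]
        L1_bounded_mult(1)[OF op bd zi(1)[OF c0(2)] \<psi>m \<psi>1] L1_bounded_mult(1)[OF op bd zi(2)[OF c0(2)] \<psi>m \<psi>1]
      by (simp add: left_diff_distrib)
    also have "\<dots> \<le> ((LINT p|lborel. indicator ({c..d} \<times> \<Omega>) p * (f' p * \<psi>' (snd p)))
        - (LINT p|lborel. indicator ({c..d} \<times> \<Omega>) p * (Gv p \<bullet> \<Psi> (snd p))))
       - ((LINT p|lborel. indicator ({c..d} \<times> \<Omega>) p * (g' p * \<psi>' (snd p)))
        - (LINT p|lborel. indicator ({c..d} \<times> \<Omega>) p * (Gw p \<bullet> \<Psi> (snd p))))"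
      using subsol[OF cd adm Linf pos] supersol[OF cd adm Linf pos] unfolding wfv wfw sf(2) sg(2) by linarith
    also have "\<dots> = (LINT p|lborel. indicator ({c..d} \<times> \<Omega>) p * (k p * \<psi>' (snd p) - G p \<bullet> \<Psi> (snd p)))"
      unfolding e using sf(1) sg(1) iv iw by simp
    finally show "(LINT x|lebesgue_on \<Omega>. ((v d x - w d x) - (v c x - w c x)) * \<psi> x)
      \<le> (LINT p|lborel. indicator ({c..d} \<times> \<Omega>) p * (k p * \<psi>' (snd p) - G p \<bullet> \<Psi> (snd p)))" .
  qed
  define J where "J t = (LINT x|lebesgue_on \<Omega>. Sg r (v t x - w t x))" for t
  have Sg0: "Sg r 0 = 0" by (simp add: Sg_def)
  have Jc: "continuous_on {0..T} J"
  proof (rule C_time_continuous_on[OF C_time_L1_diff[OF v(1) w(1)]])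
    show "\<bar>J s - J t\<bar> \<le> 1 * L1_norm (lebesgue_on \<Omega>) ((\<lambda>x. v s x - w s x) - (\<lambda>x. v t x - w t x))"
      if "s \<in> {0..T}" "t \<in> {0..T}" for s t
      unfolding J_def mult_1 using zi[OF that(1)] zi[OF that(2)]
      by (intro lipschitz_integral_diff[of _ _ _ "Sg r"] Sg_lipschitz r Sg0) auto
  qed
  \<comment> \<open>The window [s - h, s] reaches below a. Half of a leaves room for h < a - a'
    while keeping the fluxes on an interval where they are square integrable.\<close>
  define a' where "a' = a / 2"
  have a': "0 < a'" "a' < a" "a' \<le> b" using ab by (auto simp: a'_def)
  define G0 where "G0 p = indicator ({a'..b} \<times> \<Omega>) p *\<^sub>R G p" for p
  define k0 where "k0 p = indicator ({a'..b} \<times> \<Omega>) p * k p" for p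
  define H0 where "H0 p = indicator ({a..b} \<times> \<Omega>) p *\<^sub>R H p" for p
  define K0 where "K0 p = indicator ({a..b} \<times> \<Omega>) p * K p" for p
  have G0L2: "G0 \<in> L2 lborel" unfolding G0_def using L2G[OF a'(1,3) ab(3)] .
  have G0i: "integrable lborel G0"
    by (rule L2_support_integrable[OF G0L2, of "{a'..b} \<times> \<Omega>"])
      (use emeasure_Icc_times_finite[OF op bd] in \<open>auto simp: G0_def box\<close>)
  have H0L2: "H0 \<in> L2 lborel"
  proof (rule L2_bound)
    have VW: "(\<lambda>p. indicator ({a..b} \<times> \<Omega>) p *\<^sub>R (V p - W p)) \<in> L2 lborel"
      using L2_diff[OF L2V[OF ab(1) less_imp_le[OF ab(2)] ab(3)] L2W[OF ab(1) less_imp_le[OF ab(2)] ab(3)]]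
      by (simp add: scaleR_diff_right)
    show "integrable lborel (\<lambda>p. (2 * r)\<^sup>2 * (norm (indicator ({a..b} \<times> \<Omega>) p *\<^sub>R (V p - W p)))\<^sup>2)"
      by (intro integrable_mult_right L2_integrable_sq VW)
    show "H0 \<in> borel_measurable lborel" unfolding H0_def[abs_def] by measurable
    have "(norm (H0 p))\<^sup>2 \<le> (2 * r)\<^sup>2 * (norm (indicator ({a..b} \<times> \<Omega>) p *\<^sub>R (V p - W p)))\<^sup>2" for p
    proof -
      have "norm (H0 p) = r * gexp 2 (r * (v' p - w' p)) * norm (indicator ({a..b} \<times> \<Omega>) p *\<^sub>R (V p - W p))"
        using r gexp_nonneg[of 2] by (simp add: H0_def H_def abs_mult)
      also have "\<dots> \<le> (2 * r) * norm (indicator ({a..b} \<times> \<Omega>) p *\<^sub>R (V p - W p))"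
        using r gexp_2_le by (intro mult_right_mono) (auto simp: mult.commute)
      finally show ?thesis by (metis norm_ge_zero power_mono power_mult_distrib)
    qed
    then show "AE p in lborel. (norm (H0 p))\<^sup>2 \<le> (2 * r)\<^sup>2 * (norm (indicator ({a..b} \<times> \<Omega>) p *\<^sub>R (V p - W p)))\<^sup>2" by simp
  qed
  have k0i: "integrable lborel k0" unfolding k0_def
    by (rule integrable_indicator_subset[OF ki]) (use a' ab in \<open>auto simp: cylinder_def box\<close>)
  have K0m: "K0 \<in> borel_measurable borel" unfolding K0_def[abs_def] by measurable
  have K01': "\<bar>K0 p\<bar> \<le> 1" for p using K01[of p] by (simp add: K0_def indicator_def)
  have kK2: "indicator ({a..b} \<times> \<Omega>) p * (k p * K p) = k0 p * K0 p" for p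
    using a' by (auto simp: k0_def K0_def indicator_def)
  have kK: "integrable lborel (\<lambda>p. k0 p * K0 p)"
    by (rule Bochner_Integration.integrable_bound[OF k0i])
      (use K0m borel_measurable_integrable[OF k0i] in \<open>auto simp: abs_mult intro!: mult_right_le_one_le K01'\<close>)
  have "J b - J a \<le> (LINT p|lborel. k0 p * K0 p - G0 p \<bullet> H0 p)"
  proof (rule steklov_pairing[OF Jc ab _ G0i G0L2 H0L2 k0i K0m K01'])
    show "0 < a - a'" using a' by simp
    show "H0 (s, x) = 0" "K0 (s, x) = 0" if "s \<notin> {a..b}" for s x
      using that by (auto simp: H0_def K0_def)
    fix h assume h: "0 < h" "h < a - a'"
    show "AE s in lborel. s \<in> {a..b} \<longrightarrow> J s - J (s - h)
      \<le> (LINT t|lborel. indicator {s - h..s} t * (LINT x|lborel. k0 (t, x) * K0 (s, x) - G0 (t, x) \<bullet> H0 (s, x)))"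
      using vV wW
    proof eventually_elim
      case (elim s)
      show ?case
      proof
        assume s: "s \<in> {a..b}"
        then have sT: "s \<in> {0<..<T}" using ab by auto
        have cd: "0 < s - h" "s - h < s" "s < T" using s h a' ab by auto
        from elim(1)[rule_format, OF sT] elim(2)[rule_format, OF sT]
        have vs: "v s \<in> W012 \<Omega>" "AE x in lborel. x \<in> \<Omega> \<longrightarrow> v s x = v' (s, x) \<and> weak_grad \<Omega> (v s) x = V (s, x)"
          and ws: "w s \<in> W012 \<Omega>" "AE x in lborel. x \<in> \<Omega> \<longrightarrow> w s x = w' (s, x) \<and> weak_grad \<Omega> (w s) x = W (s, x)" by auto
        \<comment> \<open>The test function frozen at time s. The inequality is claimed for almost
          every s only, which allows v(s) and w(s) to be taken in W_0^{1,2} with known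
          gradients.\<close>
        define \<psi> where "\<psi> x = gexp 0 (r * (v s x - w s x))" for x
        have ap: "W012_approx \<Omega> (\<lambda>x. v s x - w s x) (\<lambda>x. weak_grad \<Omega> (v s) x - weak_grad \<Omega> (w s) x)"
          using W012_approx_lincomb[OF op bd W012_W012_approx[OF op bd vs(1)] W012_W012_approx[OF op bd ws(1)], of 1 "-1"]
          by simp
        note ap2 = W012_approx_gexp[OF op bd ap, of r]
        have \<psi>W: "\<psi> \<in> W012 \<Omega>" unfolding \<psi>_def[abs_def] by (rule W012_approx_W012[OF op bd ap2])
        have "AE x in lebesgue_on \<Omega>. weak_grad \<Omega> \<psi> x = (r * gexp 2 (r * (v s x - w s x))) *\<^sub>R (weak_grad \<Omega> (v s) x - weak_grad \<Omega> (w s) x)"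
          unfolding \<psi>_def[abs_def] by (rule W012_approx_weak_grad(1)[OF op bd ap2])
        then have "AE x in lborel. x \<in> \<Omega> \<longrightarrow> weak_grad \<Omega> \<psi> x = (r * gexp 2 (r * (v s x - w s x))) *\<^sub>R (weak_grad \<Omega> (v s) x - weak_grad \<Omega> (w s) x)"
          using op by (subst (asm) AE_lebesgue_on_iff) auto
        with vs(2) ws(2) have \<Psi>: "AE x in lborel. x \<in> \<Omega> \<longrightarrow> weak_grad \<Omega> \<psi> x = H (s, x)"
          by eventually_elim (simp add: H_def)
        from vs(2) ws(2) have \<psi>': "AE x in lborel. x \<in> \<Omega> \<longrightarrow> \<psi> x = K (s, x)"
          by eventually_elim (simp add: K_def \<psi>_def)
        have \<psi>01: "0 \<le> \<psi> x" "\<psi> x \<le> 1" for x by (auto simp: \<psi>_def gexp_nonneg gexp_le_1)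
        note st = step[OF \<psi>W \<psi>01 cd borel_measurable_section[OF Km] \<psi>' borel_measurable_section[OF Hm] \<Psi>]
        have sh: "s \<in> {0..T}" "s - h \<in> {0..T}" using cd by auto
        have zs: "integrable (lebesgue_on \<Omega>) (\<lambda>x. v t x - w t x)" if "t \<in> {0..T}" for t using zi[OF that] by simp
        have Si: "integrable (lebesgue_on \<Omega>) (\<lambda>x. Sg r (v t x - w t x))" if "t \<in> {0..T}" for t
          by (rule integrable_lipschitz[OF zs[OF that] Sg_lipschitz[OF r] Sg0])
        have "J s - J (s - h) = (LINT x|lebesgue_on \<Omega>. Sg r (v s x - w s x) - Sg r (v (s - h) x - w (s - h) x))"
          unfolding J_def using Si[OF sh(1)] Si[OF sh(2)] by simp
        \<comment> \<open>Convexity of S_r, with the slope taken at the later time s.\<close>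
        also have "\<dots> \<le> (LINT x|lebesgue_on \<Omega>. ((v s x - w s x) - (v (s - h) x - w (s - h) x)) * \<psi> x)"
        proof (rule integral_mono)
          show "integrable (lebesgue_on \<Omega>) (\<lambda>x. ((v s x - w s x) - (v (s - h) x - w (s - h) x)) * \<psi> x)"
            by (rule L1_bounded_mult(1)[OF op bd Bochner_Integration.integrable_diff[OF zs[OF sh(1)] zs[OF sh(2)]]
                  L2_measurable[OF weak_grad_L2(2)[OF op bd \<psi>W]], of 1])
              (use \<psi>01 in \<open>simp add: abs_of_nonneg\<close>)
          show "Sg r (v s x - w s x) - Sg r (v (s - h) x - w (s - h) x) \<le> ((v s x - w s x) - (v (s - h) x - w (s - h) x)) * \<psi> x" for x
            unfolding \<psi>_def by (rule Sg_convex[OF r])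
        qed (intro Bochner_Integration.integrable_diff Si sh)
        also have "\<dots> \<le> (LINT p|lborel. indicator ({s - h..s} \<times> \<Omega>) p * (k p * K (s, snd p) - G p \<bullet> H (s, snd p)))"
          by (rule st(2))
        also have "\<dots> = (LINT t|lborel. LINT x|lborel. indicator ({s - h..s} \<times> \<Omega>) (t, x) * (k (t, x) * K (s, x) - G (t, x) \<bullet> H (s, x)))"
          using lborel_integral_fst(2)[OF st(1)] by simp
        \<comment> \<open>For s in [a, b] and t in the window, t lies in [a', b], so all time
          restrictions in \<open>k0\<close>, \<open>K0\<close>, \<open>G0\<close> and
          \<open>H0\<close> are satisfied and only the restriction to \<Omega> is felt.\<close>
        also have "\<dots> = (LINT t|lborel. indicator {s - h..s} t * (LINT x|lborel. k0 (t, x) * K0 (s, x) - G0 (t, x) \<bullet> H0 (s, x)))"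
        proof (rule Bochner_Integration.integral_cong[OF refl])
          fix t
          show "(LINT x|lborel. indicator ({s - h..s} \<times> \<Omega>) (t, x) * (k (t, x) * K (s, x) - G (t, x) \<bullet> H (s, x)))
            = indicator {s - h..s} t * (LINT x|lborel. k0 (t, x) * K0 (s, x) - G0 (t, x) \<bullet> H0 (s, x))"
          proof (cases "t \<in> {s - h..s}")
            case True
            then have "t \<in> {a'..b}" using s h by auto
            with True s show ?thesis
              by (auto simp: k0_def K0_def G0_def H0_def indicator_times indicator_def intro!: Bochner_Integration.integral_cong)
          qed (simp add: indicator_times)
        qed
        finally show "J s - J (s - h) \<le> (LINT t|lborel. indicator {s - h..s} t * (LINT x|lborel. k0 (t, x) * K0 (s, x) - G0 (t, x) \<bullet> H0 (s, x)))" .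
      qed
    qed
  qed
  also have "\<dots> \<le> (LINT p|lborel. indicator ({a..b} \<times> \<Omega>) p * (k p * K p) + indicator (cylinder T \<Omega>) p * (hh p)\<^sup>2 / (4 * \<alpha> * r))"
  proof (rule integral_mono_AE)
    show "integrable lborel (\<lambda>p. k0 p * K0 p - G0 p \<bullet> H0 p)"
      by (intro Bochner_Integration.integrable_diff kK L2_integrable_inner G0L2 H0L2)
    show "integrable lborel (\<lambda>p. indicator ({a..b} \<times> \<Omega>) p * (k p * K p) + indicator (cylinder T \<Omega>) p * (hh p)\<^sup>2 / (4 * \<alpha> * r))"
      unfolding kK2 by (intro Bochner_Integration.integrable_add kK integrable_divide hh(1))
    show "AE p in lborel. k0 p * K0 p - G0 p \<bullet> H0 p
        \<le> indicator ({a..b} \<times> \<Omega>) p * (k p * K p) + indicator (cylinder T \<Omega>) p * (hh p)\<^sup>2 / (4 * \<alpha> * r)"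
      using ell
    proof eventually_elim
      case (elim p)
      show ?case
      proof (cases "p \<in> {a..b} \<times> \<Omega>")
        case False
        then show ?thesis using \<alpha> r by (auto simp: K0_def H0_def indicator_def)
      next
        case True
        then have p: "p \<in> cylinder T \<Omega>" "p \<in> {a'..b} \<times> \<Omega>" using ab a' by (auto simp: cylinder_def)
        \<comment> \<open>Linearity of the diffusion leaves M' applied to the gradient of the
          difference, and the nonlinearity enters only through a scalar coefficient of E'; this is
          the shape required by the flux estimate.\<close>
        have Ge: "G p = M' p *v (V p - W p) + (\<bar>v' p\<bar> powr \<theta> * v' p - \<bar>w' p\<bar> powr \<theta> * w' p) *\<^sub>R E' p"
          by (simp add: G_def Gv_def Gw_def matrix_vector_mult_diff_distrib algebra_simps)
        have "- (G p \<bullet> H p) \<le> (hh p)\<^sup>2 / (4 * \<alpha> * r)"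
          unfolding Ge H_def using elim p(1) by (intro flux_lower_bound \<alpha> r hh(2,3)) auto
        then show ?thesis using True p by (simp add: k0_def K0_def G0_def H0_def)
      qed
    qed
  qed
  also have "\<dots> = (LINT p|lborel. indicator ({a..b} \<times> \<Omega>) p * (k p * K p))
      + (LINT p|lborel. indicator (cylinder T \<Omega>) p * (hh p)\<^sup>2) / (4 * \<alpha> * r)"
    unfolding kK2 by (subst Bochner_Integration.integral_add) (use kK hh(1) in auto)
  finally show ?thesis by (simp add: J_def k_def K_def)
qed

text \<open>All S_r are 1-Lipschitz, so moving the time from \<open>s n\<close> to \<sigma> costs at
  most the L^1 distance, uniformly in r. At the fixed time \<sigma> dominated convergence applies,
  with |z(\<sigma>)| as majorant.\<close>

lemma tendsto_integral_Sg:
  fixes \<Omega> :: "'a::euclidean_space set" and z :: "real \<Rightarrow> 'a \<Rightarrow> real"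
  assumes z: "z \<in> C_time (L1 (lebesgue_on \<Omega>)) (L1_norm (lebesgue_on \<Omega>)) T"
    and s: "\<And>n. s n \<in> {0..T}" "s \<longlonglongrightarrow> \<sigma>" and \<sigma>: "\<sigma> \<in> {0..T}"
  shows "(\<lambda>n. LINT x|lebesgue_on \<Omega>. Sg (real (Suc n)) (z (s n) x)) \<longlonglongrightarrow> (LINT x|lebesgue_on \<Omega>. max (z \<sigma> x) 0)"
proof -
  have zi: "integrable (lebesgue_on \<Omega>) (z t)" if "t \<in> {0..T}" for t
    using z that by (auto simp: C_time_def L1_def)
  have Sg0: "Sg r 0 = 0" for r by (simp add: Sg_def)
  note lip = Sg_lipschitz[of "real (Suc n)" for n]
  have "(\<lambda>n. L1_norm (lebesgue_on \<Omega>) (z (s n) - z \<sigma>)) \<longlonglongrightarrow> L1_norm (lebesgue_on \<Omega>) (z \<sigma> - z \<sigma>)"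
  proof (rule continuous_within_tendsto_compose[of \<sigma> "{0..T}" "\<lambda>t. L1_norm (lebesgue_on \<Omega>) (z t - z \<sigma>)"])
    show "continuous (at \<sigma> within {0..T}) (\<lambda>t. L1_norm (lebesgue_on \<Omega>) (z t - z \<sigma>))"
      unfolding continuous_within using z \<sigma> by (simp add: C_time_def L1_norm_def)
  qed (use s in auto)
  then have l0: "(\<lambda>n. L1_norm (lebesgue_on \<Omega>) (z (s n) - z \<sigma>)) \<longlonglongrightarrow> 0" by (simp add: L1_norm_def)
  have 1: "(\<lambda>n. (LINT x|lebesgue_on \<Omega>. Sg (real (Suc n)) (z (s n) x)) - (LINT x|lebesgue_on \<Omega>. Sg (real (Suc n)) (z \<sigma> x))) \<longlonglongrightarrow> 0"
  proof (rule Lim_null_comparison[OF always_eventually l0], rule allI)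
    fix n
    show "norm ((LINT x|lebesgue_on \<Omega>. Sg (real (Suc n)) (z (s n) x)) - (LINT x|lebesgue_on \<Omega>. Sg (real (Suc n)) (z \<sigma> x)))
      \<le> L1_norm (lebesgue_on \<Omega>) (z (s n) - z \<sigma>)"
      unfolding real_norm_def
      by (rule lipschitz_integral_diff[OF zi[OF s(1)] zi[OF \<sigma>] lip Sg0]) simp
  qed
  have 2: "(\<lambda>n. LINT x|lebesgue_on \<Omega>. Sg (real (Suc n)) (z \<sigma> x)) \<longlonglongrightarrow> (LINT x|lebesgue_on \<Omega>. max (z \<sigma> x) 0)"
  proof (rule integral_dominated_convergence[where w="\<lambda>x. \<bar>z \<sigma> x\<bar>"])
    show "integrable (lebesgue_on \<Omega>) (\<lambda>x. \<bar>z \<sigma> x\<bar>)" using zi[OF \<sigma>] by simp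
    show "(\<lambda>x. Sg (real (Suc n)) (z \<sigma> x)) \<in> borel_measurable (lebesgue_on \<Omega>)" for n
      by (intro borel_measurable_integrable integrable_lipschitz[OF zi[OF \<sigma>] lip Sg0]) simp
    show "(\<lambda>x. max (z \<sigma> x) 0) \<in> borel_measurable (lebesgue_on \<Omega>)"
      using borel_measurable_integrable[OF zi[OF \<sigma>]] by measurable
    show "AE x in lebesgue_on \<Omega>. (\<lambda>n. Sg (real (Suc n)) (z \<sigma> x)) \<longlonglongrightarrow> max (z \<sigma> x) 0"
      using Sg_tendsto by simp
    show "AE x in lebesgue_on \<Omega>. norm (Sg (real (Suc n)) (z \<sigma> x)) \<le> \<bar>z \<sigma> x\<bar>" for n
    proof (rule AE_I2)
      show "norm (Sg (real (Suc n)) (z \<sigma> x)) \<le> \<bar>z \<sigma> x\<bar>" for x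
        using Sg_bounds[of "real (Suc n)" "z \<sigma> x"] by auto
    qed
  qed
  show ?thesis using tendsto_add[OF 1 2] by simp
qed

text \<open>The constant C does not depend on r, a or b, so one sequence can send r to infinity and
  the interval to (0, \<tau>) at the same time. Continuity in L^1 up to t = 0 and t = T recovers the
  end values.\<close>

lemma comparison_limit:
  fixes \<Omega> :: "'a::euclidean_space set" and z :: "real \<Rightarrow> 'a \<Rightarrow> real" and k y :: "real \<times> 'a \<Rightarrow> real"
  assumes op: "open \<Omega>" and \<tau>: "0 < \<tau>" "\<tau> \<le> T"
    and z: "z \<in> C_time (L1 (lebesgue_on \<Omega>)) (L1_norm (lebesgue_on \<Omega>)) T"
    and ki: "integrable lborel (\<lambda>p. indicator (cylinder T \<Omega>) p * k p)" and km: "k \<in> borel_measurable borel"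
    and ym: "y \<in> borel_measurable borel"
    and est: "\<And>r a b. r > 0 \<Longrightarrow> 0 < a \<Longrightarrow> a < b \<Longrightarrow> b < T \<Longrightarrow>
      (LINT x|lebesgue_on \<Omega>. Sg r (z b x)) - (LINT x|lebesgue_on \<Omega>. Sg r (z a x))
      \<le> (LINT p|lborel. indicator ({a..b} \<times> \<Omega>) p * (k p * gexp 0 (r * y p))) + C / r"
  shows "(LINT x|lebesgue_on \<Omega>. max (z \<tau> x) 0)
    \<le> (LINT p|lborel. indicator ({0..\<tau>} \<times> \<Omega>) p * (indicator (cylinder T \<Omega>) p * k p * indicator {p. y p > 0} p))
      + (LINT x|lebesgue_on \<Omega>. max (z 0 x) 0)"
proof -
  have [measurable]: "\<Omega> \<in> sets borel" "k \<in> borel_measurable borel" "y \<in> borel_measurable borel"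
    "cylinder T \<Omega> \<in> sets borel"
    using op km ym cylinder_sets by auto
  have [measurable]: "{c..d::real} \<times> \<Omega> \<in> sets borel" for c d by (intro borel_Times) auto
  \<comment> \<open>The factor 1 / (n + 3) is at most 1/3, which gives a n < \<tau> - a n = b n;
    moreover b n < \<tau> <= T, so \<tau> = T is covered.\<close>
  define a where "a n = \<tau> * inverse (real (Suc (Suc (Suc n))))" for n
  define b where "b n = \<tau> - a n" for n
  have inv: "inverse (real (Suc (Suc (Suc n)))) \<le> 1 / 3" for n by (simp add: field_simps)
  have ab: "0 < a n" "a n < b n" "b n < T" for n
  proof -
    show "0 < a n" using \<tau> by (simp add: a_def)
    moreover have "a n \<le> \<tau> * (1 / 3)" unfolding a_def using \<tau> inv by (intro mult_left_mono) auto
    ultimately show "a n < b n" "b n < T" using \<tau> by (auto simp: b_def)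
  qed
  have "(\<lambda>n. \<tau> * inverse (real (Suc (n + 2)))) \<longlonglongrightarrow> \<tau> * 0"
    by (intro tendsto_mult tendsto_const LIMSEQ_ignore_initial_segment[OF LIMSEQ_inverse_real_of_nat])
  then have a0: "a \<longlonglongrightarrow> 0" by (simp add: a_def[abs_def])
  then have b0: "b \<longlonglongrightarrow> \<tau>" using tendsto_diff[OF tendsto_const[of \<tau>] a0] by (simp add: b_def[abs_def])
  have rng: "a n \<in> {0..T}" "b n \<in> {0..T}" for n using ab[of n] by auto
  have 1: "(\<lambda>n. (LINT x|lebesgue_on \<Omega>. Sg (real (Suc n)) (z (b n) x)) - (LINT x|lebesgue_on \<Omega>. Sg (real (Suc n)) (z (a n) x)))
    \<longlonglongrightarrow> (LINT x|lebesgue_on \<Omega>. max (z \<tau> x) 0) - (LINT x|lebesgue_on \<Omega>. max (z 0 x) 0)"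
    using \<tau> by (intro tendsto_diff tendsto_integral_Sg[OF z] rng a0 b0) auto
  have 2: "(\<lambda>n. LINT p|lborel. indicator ({a n..b n} \<times> \<Omega>) p * (k p * gexp 0 (real (Suc n) * y p)))
    \<longlonglongrightarrow> (LINT p|lborel. indicator ({0..\<tau>} \<times> \<Omega>) p * (indicator (cylinder T \<Omega>) p * k p * indicator {p. y p > 0} p))"
  proof (rule integral_dominated_convergence[where w="\<lambda>p. \<bar>indicator (cylinder T \<Omega>) p * k p\<bar>"])
    show "integrable lborel (\<lambda>p. \<bar>indicator (cylinder T \<Omega>) p * k p\<bar>)" using ki by (rule integrable_abs)
    show "(\<lambda>p. indicator ({a n..b n} \<times> \<Omega>) p * (k p * gexp 0 (real (Suc n) * y p))) \<in> borel_measurable lborel" for n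
      by measurable
    show "(\<lambda>p. indicator ({0..\<tau>} \<times> \<Omega>) p * (indicator (cylinder T \<Omega>) p * k p * indicator {p. y p > 0} p)) \<in> borel_measurable lborel"
      by measurable
    show "AE p in lborel. norm (indicator ({a n..b n} \<times> \<Omega>) p * (k p * gexp 0 (real (Suc n) * y p))) \<le> \<bar>indicator (cylinder T \<Omega>) p * k p\<bar>" for n
    proof (rule AE_I2)
      fix p
      show "norm (indicator ({a n..b n} \<times> \<Omega>) p * (k p * gexp 0 (real (Suc n) * y p))) \<le> \<bar>indicator (cylinder T \<Omega>) p * k p\<bar>"
      proof (cases "p \<in> {a n..b n} \<times> \<Omega>")
        case True
        then have "p \<in> cylinder T \<Omega>" using ab[of n] by (auto simp: cylinder_def)
        then show ?thesis using True gexp_nonneg gexp_le_1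
          by (simp add: abs_mult abs_of_nonneg mult_right_le_one_le)
      qed simp
    qed
    \<comment> \<open>The intervals [a n, b n] never contain 0 or \<tau>, whereas the limit set
      does; these two time slices are null.\<close>
    have "AE t in lborel. t \<noteq> 0 \<and> t \<noteq> \<tau>" using AE_lborel_singleton[of "0::real"] AE_lborel_singleton[of \<tau>] by auto
    from AE_lborel_fst[OF this]
    show "AE p in lborel. (\<lambda>n. indicator ({a n..b n} \<times> \<Omega>) p * (k p * gexp 0 (real (Suc n) * y p)))
      \<longlonglongrightarrow> indicator ({0..\<tau>} \<times> \<Omega>) p * (indicator (cylinder T \<Omega>) p * k p * indicator {p. y p > 0} p)"
    proof eventually_elim
      case (elim p)
      show ?case
      proof (cases "fst p \<in> {0<..<\<tau>} \<and> snd p \<in> \<Omega>")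
        case True
        then have "eventually (\<lambda>n. a n < fst p) sequentially" "eventually (\<lambda>n. fst p < b n) sequentially"
          using order_tendstoD(2)[OF a0, of "fst p"] order_tendstoD(1)[OF b0, of "fst p"] by auto
        then have "eventually (\<lambda>n. k p * gexp 0 (real (Suc n) * y p) = indicator ({a n..b n} \<times> \<Omega>) p * (k p * gexp 0 (real (Suc n) * y p))) sequentially"
          by eventually_elim (use True in \<open>auto simp: indicator_def mem_Times_iff\<close>)
        moreover have "(\<lambda>n. k p * gexp 0 (real (Suc n) * y p)) \<longlonglongrightarrow> k p * (if y p > 0 then 1 else 0)"
          by (intro tendsto_mult tendsto_const gexp_tendsto_indicator)
        ultimately have "(\<lambda>n. indicator ({a n..b n} \<times> \<Omega>) p * (k p * gexp 0 (real (Suc n) * y p))) \<longlonglongrightarrow> k p * (if y p > 0 then 1 else 0)"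
          by (rule Lim_transform_eventually[rotated])
        moreover have "k p * (if y p > 0 then 1 else 0)
          = indicator ({0..\<tau>} \<times> \<Omega>) p * (indicator (cylinder T \<Omega>) p * k p * indicator {p. y p > 0} p)"
          using True \<tau> by (auto simp: cylinder_def mem_Times_iff)
        ultimately show ?thesis by simp
      next
        case False
        then have "p \<notin> {0..\<tau>} \<times> \<Omega>" using elim by (auto simp: mem_Times_iff)
        moreover have "p \<notin> {a n..b n} \<times> \<Omega>" for n
          using False ab[of n] \<open>p \<notin> {0..\<tau>} \<times> \<Omega>\<close> by (auto simp: mem_Times_iff b_def)
        ultimately show ?thesis by simp
      qed
    qed
  qed
  have 3: "(\<lambda>n. C / real (Suc n)) \<longlonglongrightarrow> 0"
    using tendsto_mult[OF tendsto_const[of C] LIMSEQ_inverse_real_of_nat] by (simp add: divide_inverse)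
  have "(LINT x|lebesgue_on \<Omega>. max (z \<tau> x) 0) - (LINT x|lebesgue_on \<Omega>. max (z 0 x) 0)
    \<le> (LINT p|lborel. indicator ({0..\<tau>} \<times> \<Omega>) p * (indicator (cylinder T \<Omega>) p * k p * indicator {p. y p > 0} p)) + 0"
    by (rule LIMSEQ_le[OF 1 tendsto_add[OF 2 3]]) (use est[OF _ ab] in auto)
  then show ?thesis by simp
qed

theorem theorem3p3:
  fixes \<Omega> :: "(real^'n) set"
    and T \<alpha> \<beta> \<theta> :: real
    and M :: "real \<Rightarrow> real^'n \<Rightarrow> real^'n^'n"
    and E :: "real \<Rightarrow> real^'n \<Rightarrow> real^'n"
    and f g v w :: "real \<Rightarrow> real^'n \<Rightarrow> real"
  assumes "CARD('n) \<ge> 3" and "T > 0"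
    and "open \<Omega>" and "bounded \<Omega>"
    and "0 < \<alpha>" and "\<alpha> \<le> \<beta>"
    and "case_prod M \<in> borel_measurable (lebesgue_on (cylinder T \<Omega>))"
    and "AE (t, x) in lebesgue_on (cylinder T \<Omega>).
           (\<forall>\<xi>. \<alpha> * (norm \<xi>)\<^sup>2 \<le> (M t x *v \<xi>) \<bullet> \<xi>) \<and> norm (M t x) \<le> \<beta>"
    and "\<theta> > 0"
    and "case_prod f \<in> L1 (lebesgue_on (cylinder T \<Omega>))"
    and "case_prod g \<in> L1 (lebesgue_on (cylinder T \<Omega>))"
    and "case_prod E \<in> L2 (lebesgue_on (cylinder T \<Omega>))"
    and "v \<in> C_time (L1 (lebesgue_on \<Omega>)) (L1_norm (lebesgue_on \<Omega>)) T \<inter> W2_loc T \<Omega>"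
    and "w \<in> C_time (L1 (lebesgue_on \<Omega>)) (L1_norm (lebesgue_on \<Omega>)) T \<inter> W2_loc T \<Omega>"
    and "(\<lambda>t x. norm (E t x) * (\<bar>v t x\<bar> powr (\<theta> + 1) + \<bar>w t x\<bar> powr (\<theta> + 1)))
           \<in> L2_loc_time (L2 (lebesgue_on \<Omega>)) (L2_norm (lebesgue_on \<Omega>)) T"
    and "\<And>t1 t2 \<phi>. \<lbrakk>0 < t1; t1 < t2; t2 < T; \<phi> \<in> W2 T \<Omega>;
             case_prod \<phi> \<in> Linf (lebesgue_on (cylinder T \<Omega>));
             AE (t, x) in lebesgue_on (cylinder T \<Omega>). \<phi> t x \<ge> 0\<rbrakk>
           \<Longrightarrow> weak_form T \<Omega> M E \<theta> t1 t2 v \<phi>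
                 \<le> (LINT t|lebesgue_on {t1..t2}. LINT x|lebesgue_on \<Omega>. f t x * \<phi> t x)"
    and "\<And>t1 t2 \<phi>. \<lbrakk>0 < t1; t1 < t2; t2 < T; \<phi> \<in> W2 T \<Omega>;
             case_prod \<phi> \<in> Linf (lebesgue_on (cylinder T \<Omega>));
             AE (t, x) in lebesgue_on (cylinder T \<Omega>). \<phi> t x \<ge> 0\<rbrakk>
           \<Longrightarrow> weak_form T \<Omega> M E \<theta> t1 t2 w \<phi>
                 \<ge> (LINT t|lebesgue_on {t1..t2}. LINT x|lebesgue_on \<Omega>. g t x * \<phi> t x)"
    and "(\<lambda>(t, x). (\<bar>v t x\<bar> powr \<theta> + \<bar>w t x\<bar> powr \<theta>) * norm (E t x))
           \<in> L2 (lebesgue_on (cylinder T \<Omega>))"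
  shows "\<forall>\<tau>\<in>{0..T}.
    (LINT x|lebesgue_on \<Omega>. max (v \<tau> x - w \<tau> x) 0)
      \<le> (LINT t|lebesgue_on {0..\<tau>}. LINT x|lebesgue_on \<Omega>.
            (f t x - g t x) * indicator {y. v t y > w t y} x)
        + (LINT x|lebesgue_on \<Omega>. max (v 0 x - w 0 x) 0)"
proof
  fix \<tau> assume \<tau>: "\<tau> \<in> {0..T}"
  note T = assms(2) and op = assms(3) and bd = assms(4)
  have cyl[measurable]: "cylinder T \<Omega> \<in> sets borel" by (rule cylinder_sets[OF op])
  have v: "v \<in> C_time (L1 (lebesgue_on \<Omega>)) (L1_norm (lebesgue_on \<Omega>)) T" "v \<in> W2_loc T \<Omega>"
    and w: "w \<in> C_time (L1 (lebesgue_on \<Omega>)) (L1_norm (lebesgue_on \<Omega>)) T" "w \<in> W2_loc T \<Omega>"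
    using assms(13,14) by auto
  \<comment> \<open>From here on all data are exchanged for Borel functions on space-time that agree
    with them almost everywhere, so that products, sections and shifts stay measurable.\<close>
  obtain v' where v': "v' \<in> borel_measurable borel" "AE p in lborel. p \<in> cylinder T \<Omega> \<longrightarrow> case_prod v p = v' p"
    "AE t in lborel. t \<in> {0<..<T} \<longrightarrow> (AE x in lborel. x \<in> \<Omega> \<longrightarrow> v t x = v' (t, x))"
    by (rule cylinder_borel_rep[OF op, of v T]) (use v(2) in \<open>auto simp: W2_loc_def\<close>)
  obtain w' where w': "w' \<in> borel_measurable borel" "AE p in lborel. p \<in> cylinder T \<Omega> \<longrightarrow> case_prod w p = w' p"
    "AE t in lborel. t \<in> {0<..<T} \<longrightarrow> (AE x in lborel. x \<in> \<Omega> \<longrightarrow> w t x = w' (t, x))"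
    by (rule cylinder_borel_rep[OF op, of w T]) (use w(2) in \<open>auto simp: W2_loc_def\<close>)
  obtain M' where M': "M' \<in> borel_measurable borel" "AE p in lborel. p \<in> cylinder T \<Omega> \<longrightarrow> case_prod M p = M' p"
    "AE t in lborel. t \<in> {0<..<T} \<longrightarrow> (AE x in lborel. x \<in> \<Omega> \<longrightarrow> M t x = M' (t, x))"
    by (rule cylinder_borel_rep[OF op assms(7)]) auto
  obtain E' where E': "E' \<in> borel_measurable borel" "AE p in lborel. p \<in> cylinder T \<Omega> \<longrightarrow> case_prod E p = E' p"
    "AE t in lborel. t \<in> {0<..<T} \<longrightarrow> (AE x in lborel. x \<in> \<Omega> \<longrightarrow> E t x = E' (t, x))"
    by (rule cylinder_borel_rep[OF op L2_measurable[OF assms(12)]]) auto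
  obtain f' where f': "f' \<in> borel_measurable borel" "AE p in lborel. p \<in> cylinder T \<Omega> \<longrightarrow> case_prod f p = f' p"
    "AE t in lborel. t \<in> {0<..<T} \<longrightarrow> (AE x in lborel. x \<in> \<Omega> \<longrightarrow> f t x = f' (t, x))"
    by (rule cylinder_borel_rep[OF op, of f T]) (use assms(10) in \<open>auto simp: L1_def\<close>)
  obtain g' where g': "g' \<in> borel_measurable borel" "AE p in lborel. p \<in> cylinder T \<Omega> \<longrightarrow> case_prod g p = g' p"
    "AE t in lborel. t \<in> {0<..<T} \<longrightarrow> (AE x in lborel. x \<in> \<Omega> \<longrightarrow> g t x = g' (t, x))"
    by (rule cylinder_borel_rep[OF op, of g T]) (use assms(11) in \<open>auto simp: L1_def\<close>)
  obtain V where V: "V \<in> borel_measurable borel"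
    "AE t in lborel. t \<in> {0..T} \<longrightarrow> v t \<in> W012 \<Omega> \<and> (AE x in lborel. x \<in> \<Omega> \<longrightarrow> weak_grad \<Omega> (v t) x = V (t, x))"
    "\<And>c d. 0 < c \<Longrightarrow> c \<le> d \<Longrightarrow> d < T \<Longrightarrow> (\<lambda>p. indicator ({c..d} \<times> \<Omega>) p *\<^sub>R V p) \<in> L2 lborel"
    by (rule grad_rep[OF op bd, of v T]) (use v(2) in \<open>auto simp: W2_loc_def\<close>)
  obtain W where W: "W \<in> borel_measurable borel"
    "AE t in lborel. t \<in> {0..T} \<longrightarrow> w t \<in> W012 \<Omega> \<and> (AE x in lborel. x \<in> \<Omega> \<longrightarrow> weak_grad \<Omega> (w t) x = W (t, x))"
    "\<And>c d. 0 < c \<Longrightarrow> c \<le> d \<Longrightarrow> d < T \<Longrightarrow> (\<lambda>p. indicator ({c..d} \<times> \<Omega>) p *\<^sub>R W p) \<in> L2 lborel"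
    by (rule grad_rep[OF op bd, of w T]) (use w(2) in \<open>auto simp: W2_loc_def\<close>)
  note [measurable] = v'(1) w'(1) M'(1) E'(1) f'(1) g'(1) V(1) W(1)
  have box[measurable]: "{c..d::real} \<times> \<Omega> \<in> sets borel" for c d using op by (intro borel_Times) auto
  have vV: "AE t in lborel. t \<in> {0<..<T} \<longrightarrow> v t \<in> W012 \<Omega> \<and> (AE x in lborel. x \<in> \<Omega> \<longrightarrow> v t x = v' (t, x) \<and> weak_grad \<Omega> (v t) x = V (t, x))"
    using v'(3) V(2) by eventually_elim auto
  have wW: "AE t in lborel. t \<in> {0<..<T} \<longrightarrow> w t \<in> W012 \<Omega> \<and> (AE x in lborel. x \<in> \<Omega> \<longrightarrow> w t x = w' (t, x) \<and> weak_grad \<Omega> (w t) x = W (t, x))"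
    using w'(3) W(2) by eventually_elim auto
  have ME: "AE t in lborel. t \<in> {0<..<T} \<longrightarrow> (AE x in lborel. x \<in> \<Omega> \<longrightarrow> M t x = M' (t, x) \<and> E t x = E' (t, x))"
    using M'(3) E'(3) by eventually_elim auto
  have Mbounds: "AE p in lborel. p \<in> cylinder T \<Omega> \<longrightarrow>
      (\<forall>\<xi>. \<alpha> * (norm \<xi>)\<^sup>2 \<le> (M' p *v \<xi>) \<bullet> \<xi>) \<and> norm (M' p) \<le> \<beta>"
    using AE_cylinder[OF op assms(8)] M'(2)
    by eventually_elim (auto simp: case_prod_unfold)
  then have ell: "AE p in lborel. p \<in> cylinder T \<Omega> \<longrightarrow> (\<forall>\<xi>. \<alpha> * (norm \<xi>)\<^sup>2 \<le> (M' p *v \<xi>) \<bullet> \<xi>)"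
    by eventually_elim auto
  \<comment> \<open>The diffusive flux inherits square integrability from the gradient, through the
    upper bound \<beta> on the matrix norm.\<close>
  have flux1: "(\<lambda>p. indicator ({c..d} \<times> \<Omega>) p *\<^sub>R (M' p *v U p)) \<in> L2 lborel"
    if U: "U \<in> borel_measurable borel" "(\<lambda>p. indicator ({c..d} \<times> \<Omega>) p *\<^sub>R U p) \<in> L2 lborel" and cd: "0 < c" "d < T"
    for U :: "real \<times> (real^'n) \<Rightarrow> real^'n" and c d
  proof (rule L2_bound)
    have m: "(\<lambda>p. M' p *v U p) \<in> borel_measurable borel" by (intro borel_measurable_matrix_vector M'(1) U(1))
    show "(\<lambda>p. indicator ({c..d} \<times> \<Omega>) p *\<^sub>R (M' p *v U p)) \<in> borel_measurable lborel"
      using m by measurable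
    show "integrable lborel (\<lambda>p. \<beta>\<^sup>2 * (norm (indicator ({c..d} \<times> \<Omega>) p *\<^sub>R U p))\<^sup>2)"
      by (intro integrable_mult_right L2_integrable_sq U(2))
    show "AE p in lborel. (norm (indicator ({c..d} \<times> \<Omega>) p *\<^sub>R (M' p *v U p)))\<^sup>2
        \<le> \<beta>\<^sup>2 * (norm (indicator ({c..d} \<times> \<Omega>) p *\<^sub>R U p))\<^sup>2"
      using Mbounds
    proof eventually_elim
      case (elim p)
      show ?case
      proof (cases "p \<in> {c..d} \<times> \<Omega>")
        case True
        then have "norm (M' p) \<le> \<beta>" using elim cd by (auto simp: cylinder_def)
        then have "norm (M' p *v U p) \<le> \<beta> * norm (U p)"
          using norm_matrix_vector_le[of "M' p" "U p"] mult_right_mono[of "norm (M' p)" \<beta> "norm (U p)"] by simp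
        from power_mono[OF this norm_ge_zero, of 2] True show ?thesis by (simp add: power_mult_distrib)
      qed simp
    qed
  qed
  define Q where "Q t x = norm (E t x) * (\<bar>v t x\<bar> powr (\<theta> + 1) + \<bar>w t x\<bar> powr (\<theta> + 1))" for t x
  have Q: "Q \<in> L2_loc_time (L2 (lebesgue_on \<Omega>)) (L2_norm (lebesgue_on \<Omega>)) T"
    unfolding Q_def[abs_def] by (rule assms(15))
  have pw: "norm ((\<bar>y\<bar> powr \<theta> * y) *\<^sub>R e) = norm e * \<bar>y\<bar> powr (\<theta> + 1)" for y and e :: "real^'n"
    by (simp add: abs_mult powr_add mult_ac)
  \<comment> \<open>For either of the two functions the drift is dominated pointwise by the field
    assumed to be locally square integrable in time.\<close>
  have flux2: "(\<lambda>p. indicator ({c..d} \<times> \<Omega>) p *\<^sub>R ((\<bar>u p\<bar> powr \<theta> * u p) *\<^sub>R E' p)) \<in> L2 lborel"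
    if u: "u = v' \<or> u = w'" and cd: "0 < c" "c \<le> d" "d < T" for u c d
  proof (rule L2_time_majorant[OF op Q _ _ cd])
    have um: "u \<in> borel_measurable borel" using u v'(1) w'(1) by auto
    show "(\<lambda>p. (\<bar>u p\<bar> powr \<theta> * u p) *\<^sub>R E' p) \<in> borel_measurable borel" using um by measurable
    show "AE t in lborel. t \<in> {0<..<T} \<longrightarrow> (AE x in lborel. x \<in> \<Omega> \<longrightarrow>
        norm ((\<bar>u (t, x)\<bar> powr \<theta> * u (t, x)) *\<^sub>R E' (t, x)) \<le> \<bar>Q t x\<bar>)"
      using v'(3) w'(3) E'(3)
    proof eventually_elim
      case (elim t)
      show ?case
      proof
        assume t: "t \<in> {0<..<T}"
        from elim[rule_format, OF t] show "AE x in lborel. x \<in> \<Omega> \<longrightarrow>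
          norm ((\<bar>u (t, x)\<bar> powr \<theta> * u (t, x)) *\<^sub>R E' (t, x)) \<le> \<bar>Q t x\<bar>"
        proof eventually_elim
          case (elim x)
          show ?case
          proof
            assume x: "x \<in> \<Omega>"
            have "\<bar>Q t x\<bar> = norm (E' (t, x)) * (\<bar>v' (t, x)\<bar> powr (\<theta> + 1) + \<bar>w' (t, x)\<bar> powr (\<theta> + 1))"
              using elim x by (simp add: Q_def abs_mult)
            moreover have "\<bar>u (t, x)\<bar> powr (\<theta> + 1) \<le> \<bar>v' (t, x)\<bar> powr (\<theta> + 1) + \<bar>w' (t, x)\<bar> powr (\<theta> + 1)"
              using u by auto
            ultimately show "norm ((\<bar>u (t, x)\<bar> powr \<theta> * u (t, x)) *\<^sub>R E' (t, x)) \<le> \<bar>Q t x\<bar>"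
              unfolding pw by (simp add: mult_left_mono)
          qed
        qed
      qed
    qed
  qed
  have L2Gv: "(\<lambda>p. indicator ({c..d} \<times> \<Omega>) p *\<^sub>R (M' p *v V p + (\<bar>v' p\<bar> powr \<theta> * v' p) *\<^sub>R E' p)) \<in> L2 lborel"
    if "0 < c" "c \<le> d" "d < T" for c d
    unfolding scaleR_add_right by (intro L2_add flux1 flux2 V that) auto
  have L2Gw: "(\<lambda>p. indicator ({c..d} \<times> \<Omega>) p *\<^sub>R (M' p *v W p + (\<bar>w' p\<bar> powr \<theta> * w' p) *\<^sub>R E' p)) \<in> L2 lborel"
    if "0 < c" "c \<le> d" "d < T" for c d
    unfolding scaleR_add_right by (intro L2_add flux1 flux2 W that) auto
  define h0 where "h0 p = (\<bar>v' p\<bar> powr \<theta> + \<bar>w' p\<bar> powr \<theta>) * norm (E' p)" for p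
  \<comment> \<open>The factor \<theta> + 1 is the constant of the difference estimate for the power
    nonlinearity; the rest is the field assumed to be square integrable on the whole
    cylinder.\<close>
  define hh where "hh p = (\<theta> + 1) * h0 p" for p
  have hh0: "hh p \<ge> 0" for p using assms(9) by (simp add: hh_def h0_def)
  have hhle: "\<bar>\<bar>v' p\<bar> powr \<theta> * v' p - \<bar>w' p\<bar> powr \<theta> * w' p\<bar> * norm (E' p) \<le> hh p * \<bar>v' p - w' p\<bar>" for p
    using mult_right_mono[OF powr_mult_diff_le[OF assms(9), of "v' p" "w' p"] norm_ge_zero[of "E' p"]]
    by (simp add: hh_def h0_def mult_ac)
  have hhi: "integrable lborel (\<lambda>p. indicator (cylinder T \<Omega>) p * (hh p)\<^sup>2)"
  proof -
    have m: "(\<lambda>p. (h0 p)\<^sup>2) \<in> borel_measurable borel" unfolding h0_def by measurable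
    have ae: "AE p in lborel. p \<in> cylinder T \<Omega> \<longrightarrow>
        (norm (case p of (t, x) \<Rightarrow> (\<bar>v t x\<bar> powr \<theta> + \<bar>w t x\<bar> powr \<theta>) * norm (E t x)))\<^sup>2 = (h0 p)\<^sup>2"
      using v'(2) w'(2) E'(2) by eventually_elim (auto simp: h0_def case_prod_unfold)
    have "integrable lborel (\<lambda>p. indicator (cylinder T \<Omega>) p *\<^sub>R (h0 p)\<^sup>2)"
      using lebesgue_on_lborel_integrable[OF cyl m ae] L2_integrable_sq[OF assms(18)] by simp
    from integrable_mult_right[OF this, of "(\<theta> + 1)\<^sup>2"] show ?thesis
      by (simp add: hh_def power_mult_distrib mult_ac)
  qed
  define k where "k p = f' p - g' p" for p
  define z where "z t x = v t x - w t x" for t x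
  have km: "k \<in> borel_measurable borel" unfolding k_def[abs_def] by measurable
  have f'i: "integrable lborel (\<lambda>p. indicator (cylinder T \<Omega>) p * f' p)"
    by (rule integrable_cylinder_rep[OF op assms(10) f'(1,2)])
  have g'i: "integrable lborel (\<lambda>p. indicator (cylinder T \<Omega>) p * g' p)"
    by (rule integrable_cylinder_rep[OF op assms(11) g'(1,2)])
  have ki: "integrable lborel (\<lambda>p. indicator (cylinder T \<Omega>) p * k p)"
    using Bochner_Integration.integrable_diff[OF f'i g'i] by (simp add: k_def right_diff_distrib)
  have zC: "z \<in> C_time (L1 (lebesgue_on \<Omega>)) (L1_norm (lebesgue_on \<Omega>)) T"
    unfolding z_def[abs_def] by (rule C_time_L1_diff[OF v(1) w(1)])
  have est: "(LINT x|lebesgue_on \<Omega>. Sg r (z b x)) - (LINT x|lebesgue_on \<Omega>. Sg r (z a x))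
      \<le> (LINT p|lborel. indicator ({a..b} \<times> \<Omega>) p * (k p * gexp 0 (r * (v' p - w' p))))
        + (LINT p|lborel. indicator (cylinder T \<Omega>) p * (hh p)\<^sup>2) / (4 * \<alpha>) / r"
    if "r > 0" "0 < a" "a < b" "b < T" for r a b
    unfolding z_def k_def divide_divide_eq_left
    by (rule interior_comparison[OF op bd T assms(5) that v w assms(16) assms(17) v'(1) w'(1) V(1) W(1) E'(1) M'(1) f'(1) g'(1)
        f'i f'(3) g'i g'(3) vV wW ME V(3) W(3) L2Gv L2Gw ell hhi hh0 hhle])
  show "(LINT x|lebesgue_on \<Omega>. max (v \<tau> x - w \<tau> x) 0)
      \<le> (LINT t|lebesgue_on {0..\<tau>}. LINT x|lebesgue_on \<Omega>.
            (f t x - g t x) * indicator {y. v t y > w t y} x)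
        + (LINT x|lebesgue_on \<Omega>. max (v 0 x - w 0 x) 0)"
  proof (cases "\<tau> = 0")
    \<comment> \<open>The time integral runs over a single point and vanishes; the two remaining
      terms coincide.\<close>
    case True
    have "AE t in lborel. t \<in> {0..0} \<longrightarrow> (LINT x|lebesgue_on \<Omega>. (f t x - g t x) * indicator {y. v t y > w t y} x) = 0"
      using AE_lborel_singleton[of "0::real"] by eventually_elim auto
    then have "(LINT t|lebesgue_on {0..0}. LINT x|lebesgue_on \<Omega>. (f t x - g t x) * indicator {y. v t y > w t y} x) = 0"
      by (intro integral_eq_zero_AE) (subst AE_lebesgue_on_iff, auto)
    then show ?thesis using True by simp
  next
    case False
    define F' where "F' p = indicator (cylinder T \<Omega>) p * k p * indicator {p. v' p - w' p > 0} p" for p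
    have F'm: "F' \<in> borel_measurable borel" unfolding F'_def[abs_def] using km by measurable
    have "(LINT t|lebesgue_on {0..\<tau>}. LINT x|lebesgue_on \<Omega>. (f t x - g t x) * indicator {y. v t y > w t y} x)
        = (LINT p|lborel. indicator ({0..\<tau>} \<times> \<Omega>) p * F' p)"
    proof (rule iterated_integral_rep[OF op F'm])
      show "integrable lborel (\<lambda>p. indicator ({0..\<tau>} \<times> \<Omega>) p * F' p)"
      proof (rule Bochner_Integration.integrable_bound[OF ki])
        show "(\<lambda>p. indicator ({0..\<tau>} \<times> \<Omega>) p * F' p) \<in> borel_measurable lborel" using F'm by measurable
        show "AE p in lborel. norm (indicator ({0..\<tau>} \<times> \<Omega>) p * F' p) \<le> norm (indicator (cylinder T \<Omega>) p * k p)"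
          by (auto simp: F'_def indicator_def)
      qed
      \<comment> \<open>The representatives agree with the data only for times in the open interval
        (0, T), while [0, \<tau>] contains 0 and possibly T.\<close>
      have "AE t in lborel. t \<noteq> 0 \<and> t \<noteq> T" using AE_lborel_singleton[of "0::real"] AE_lborel_singleton[of T] by auto
      with vV wW f'(3) g'(3) show "AE t in lborel. t \<in> {0..\<tau>} \<longrightarrow> (AE x in lborel. x \<in> \<Omega> \<longrightarrow>
          (f t x - g t x) * indicator {y. v t y > w t y} x = F' (t, x))"
      proof eventually_elim
        case (elim t)
        show ?case
        proof
          assume "t \<in> {0..\<tau>}"
          then have t: "t \<in> {0<..<T}" using elim(5) \<tau> by auto
          from elim(1)[rule_format, OF t, THEN conjunct2] elim(2)[rule_format, OF t, THEN conjunct2]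
            elim(3)[rule_format, OF t] elim(4)[rule_format, OF t]
          show "AE x in lborel. x \<in> \<Omega> \<longrightarrow> (f t x - g t x) * indicator {y. v t y > w t y} x = F' (t, x)"
            by eventually_elim (use t in \<open>auto simp: F'_def k_def cylinder_def indicator_def\<close>)
        qed
      qed
    qed
    then show ?thesis
      using comparison_limit[OF op _ _ zC ki km _ est, of \<tau>] \<tau> False
      by (simp add: z_def F'_def)
  qed
qed

end
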